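(* Let $\varepsilon,\delta\in(0,1/2)$. There is a randomized data structure for the Distance Estimation problem in Euclidean space $\mathbb{R}^d$ with accuracy $\varepsilon$, which is initialized correctly with probability at least $1-\delta$ and supports the following operations on a database $X=\{x_i\}_{i=1}^n\subset\mathbb{R}^d$: 1. Output a correct answer to a possibly adaptively chosen distance estimation query $q\in\mathbb{R}^d$ with probability at least $1-\delta$; that is, output $\{d_i\}_{i=1}^n$ with $(1-\varepsilon)\|q-x_i\|\le d_i\le(1+\varepsilon)\|q-x_i\|$ for all $i\in\{1,\dots,n\}$. 2. Add an input $x\in\mathbb{R}^d$ to the database $X$. Furthermore, the query time is $\widetilde O(\varepsilon^{-2}(n+d)\log(1/\delta))$, the update time (operation 2) is $\widetilde O(\varepsilon^{-2}d\log(1/\delta))$, and the data structure is constructed in time $\widetilde O(\varepsilon^{-2}nd\log(1/\delta))$.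
   Context: Distance Estimation problem (Euclidean case): given $X=\{x_i\}_{i=1}^n\subset\mathbb{R}^d$ and $\varepsilon\in(0,1)$, construct a data structure which, when given an input query $q\in\mathbb{R}^d$, outputs estimates $\{d_i\}_{i=1}^n$ satisfying $(1-\varepsilon)\|q-x_i\|\le d_i\le(1+\varepsilon)\|q-x_i\|$ for all $i$, where $\|\cdot\|$ is the Euclidean norm. Adaptive queries: the sequence of queries may be chosen adversarially with knowledge of the answers to previous queries and even of the instantiation of the data structure (the random bits drawn at initialization), but a query may not depend on the future randomness the algorithm draws in answering it. Accordingly, "initialized correctly with probability at least $1-\delta$" refers to the randomness of the initialization; given a correct initialization, each (adaptively chosen) query is answered correctly with probability at least $1-\delta$ over the fresh randomness drawn to answer that query. $n$ denotes the current number of points in the database. Running time counts elementary operations (unit-cost real arithmetic and sampling). $\widetilde O(\cdot)$ hides absolute constants and factors polylogarithmic in $n,d,1/\varepsilon$. *)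

theory Defs
  imports "HOL-Probability.Probability"
begin

section \<open>A randomized real RAM\<close>

text \<open>
  Running time is measured on a machine with two sorts of memory: natural numbers (addresses,
  counters) and exact reals, each organised as named one-dimensional arrays (a scalar is cell 0 of an
  array). Real arithmetic is \<open>+, -, *, /\<close> and comparison, as in the Blum-Shub-Smale model; a
  program may mention finitely many fixed real constants. To keep unit cost honest there is no
  rounding of reals to naturals, and naturals can only be added, subtracted and compared.
  Division by zero yields zero and subtraction of naturals is truncated, as in HOL.
\<close>

type_synonym name = string

datatype nexp =
    NConst nat
  | NCell name nexp
  | NAdd nexp nexp
  | NSub nexp nexp

datatype rexp =
    RConst real
  | RCell name nexp
  | RNat nexp
  | RAdd rexp rexp
  | RSub rexp rexp
  | RMul rexp rexp
  | RDiv rexp rexp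

datatype bexp =
    NLess nexp nexp
  | RLess rexp rexp
  | BNot bexp
  | BAnd bexp bexp

datatype com =
    Skip
  | NAssign name nexp nexp
  | RAssign name nexp rexp
  | SampleNormal name nexp
  | SampleIndex name nexp nexp
  | Seq com com
  | Cond bexp com com
  | While bexp com

record mem =
  nats :: "name \<Rightarrow> nat \<Rightarrow> nat"
  reals :: "name \<Rightarrow> nat \<Rightarrow> real"

definition set_nat :: "name \<Rightarrow> nat \<Rightarrow> nat \<Rightarrow> mem \<Rightarrow> mem" where
  "set_nat a i v s = s\<lparr>nats := (nats s)(a := (nats s a)(i := v))\<rparr>"

definition set_real :: "name \<Rightarrow> nat \<Rightarrow> real \<Rightarrow> mem \<Rightarrow> mem" where
  "set_real a i v s = s\<lparr>reals := (reals s)(a := (reals s a)(i := v))\<rparr>"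

fun nval :: "nexp \<Rightarrow> mem \<Rightarrow> nat" where
  "nval (NConst k) s = k"
| "nval (NCell a e) s = nats s a (nval e s)"
| "nval (NAdd e f) s = nval e s + nval f s"
| "nval (NSub e f) s = nval e s - nval f s"

fun rval :: "rexp \<Rightarrow> mem \<Rightarrow> real" where
  "rval (RConst c) s = c"
| "rval (RCell a e) s = reals s a (nval e s)"
| "rval (RNat e) s = real (nval e s)"
| "rval (RAdd e f) s = rval e s + rval f s"
| "rval (RSub e f) s = rval e s - rval f s"
| "rval (RMul e f) s = rval e s * rval f s"
| "rval (RDiv e f) s = rval e s / rval f s"

fun bval :: "bexp \<Rightarrow> mem \<Rightarrow> bool" where
  "bval (NLess e f) s = (nval e s < nval f s)"
| "bval (RLess e f) s = (rval e s < rval f s)"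
| "bval (BNot b) s = (\<not> bval b s)"
| "bval (BAnd b c) s = (bval b s \<and> bval c s)"

fun ncost :: "nexp \<Rightarrow> nat" where
  "ncost (NConst k) = 1"
| "ncost (NCell a e) = 1 + ncost e"
| "ncost (NAdd e f) = 1 + ncost e + ncost f"
| "ncost (NSub e f) = 1 + ncost e + ncost f"

fun rcost :: "rexp \<Rightarrow> nat" where
  "rcost (RConst c) = 1"
| "rcost (RCell a e) = 1 + ncost e"
| "rcost (RNat e) = 1 + ncost e"
| "rcost (RAdd e f) = 1 + rcost e + rcost f"
| "rcost (RSub e f) = 1 + rcost e + rcost f"
| "rcost (RMul e f) = 1 + rcost e + rcost f"
| "rcost (RDiv e f) = 1 + rcost e + rcost f"

fun bcost :: "bexp \<Rightarrow> nat" where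
  "bcost (NLess e f) = 1 + ncost e + ncost f"
| "bcost (RLess e f) = 1 + rcost e + rcost f"
| "bcost (BNot b) = 1 + bcost b"
| "bcost (BAnd b c) = 1 + bcost b + bcost c"

text \<open>
  Randomness is an infinite tape of independent cells, each holding a standard Gaussian and an
  independent uniform number from the unit interval. Every sampling command consumes one cell and
  uses one of its two components, so distinct samples are independent.
\<close>

type_synonym tape = "nat \<Rightarrow> real \<times> real"

definition tapes :: "tape measure" where
  "tapes = (\<Pi>\<^sub>M i\<in>UNIV.
     density lborel (\<lambda>x. ennreal (std_normal_density x)) \<Otimes>\<^sub>M uniform_measure lborel {0..1})"

text \<open>
  For uniform \<open>u\<close> the following is uniform on \<open>{0..<m}\<close>. Taking \<open>frac u\<close> instead of \<open>u\<close> only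
  matters on a null set; it keeps the index below \<open>m\<close> on every tape.
\<close>

definition index_of :: "nat \<Rightarrow> real \<Rightarrow> nat" where
  "index_of m u = nat \<lfloor>real m * frac u\<rfloor>"

text \<open>
  \<open>exec \<omega> c (s, p) t (s', p')\<close>: started in memory \<open>s\<close> with the head of the tape \<open>\<omega>\<close> at cell \<open>p\<close>,
  the program \<open>c\<close> terminates after \<open>t\<close> elementary operations in \<open>s'\<close> with the head at \<open>p'\<close>.
\<close>

inductive exec :: "tape \<Rightarrow> com \<Rightarrow> mem \<times> nat \<Rightarrow> nat \<Rightarrow> mem \<times> nat \<Rightarrow> bool" for \<omega> :: tape where
  Skip: "exec \<omega> Skip (s, p) 1 (s, p)"
| NAssign: "exec \<omega> (NAssign a i e) (s, p) (1 + ncost i + ncost e)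
     (set_nat a (nval i s) (nval e s) s, p)"
| RAssign: "exec \<omega> (RAssign a i e) (s, p) (1 + ncost i + rcost e)
     (set_real a (nval i s) (rval e s) s, p)"
| SampleNormal: "exec \<omega> (SampleNormal a i) (s, p) (1 + ncost i)
     (set_real a (nval i s) (fst (\<omega> p)) s, Suc p)"
| SampleIndex: "exec \<omega> (SampleIndex a i e) (s, p) (1 + ncost i + ncost e)
     (set_nat a (nval i s) (index_of (nval e s) (snd (\<omega> p))) s, Suc p)"
| Seq: "exec \<omega> c u t u' \<Longrightarrow> exec \<omega> c' u' t' u'' \<Longrightarrow> exec \<omega> (Seq c c') u (t + t') u''"
| CondTrue: "bval b s \<Longrightarrow> exec \<omega> c (s, p) t u \<Longrightarrow>
     exec \<omega> (Cond b c c') (s, p) (1 + bcost b + t) u"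
| CondFalse: "\<not> bval b s \<Longrightarrow> exec \<omega> c' (s, p) t u \<Longrightarrow>
     exec \<omega> (Cond b c c') (s, p) (1 + bcost b + t) u"
| WhileFalse: "\<not> bval b s \<Longrightarrow> exec \<omega> (While b c) (s, p) (1 + bcost b) (s, p)"
| WhileTrue: "bval b s \<Longrightarrow> exec \<omega> c (s, p) t u \<Longrightarrow> exec \<omega> (While b c) u t' u' \<Longrightarrow>
     exec \<omega> (While b c) (s, p) (1 + bcost b + t + t') u'"

inductive_cases SkipE: "exec \<omega> Skip u t v"
inductive_cases NAssignE: "exec \<omega> (NAssign a i e) u t v"
inductive_cases RAssignE: "exec \<omega> (RAssign a i e) u t v"
inductive_cases SampleNormalE: "exec \<omega> (SampleNormal a i) u t v"
inductive_cases SampleIndexE: "exec \<omega> (SampleIndex a i e) u t v"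
inductive_cases SeqE: "exec \<omega> (Seq c c') u t v"
inductive_cases CondE: "exec \<omega> (Cond b c c') u t v"
inductive_cases WhileE: "exec \<omega> (While b c) u t v"

lemma exec_deterministic:
  "exec \<omega> c u t v \<Longrightarrow> exec \<omega> c u t' v' \<Longrightarrow> t' = t \<and> v' = v"
proof (induction arbitrary: t' v' rule: exec.induct)
  case (Skip s p)
  show ?case by (rule SkipE[OF Skip]) simp
next
  case (NAssign a i e s p)
  show ?case by (rule NAssignE[OF NAssign]) simp
next
  case (RAssign a i e s p)
  show ?case by (rule RAssignE[OF RAssign]) simp
next
  case (SampleNormal a i s p)
  show ?case by (rule SampleNormalE[OF SampleNormal]) simp
next
  case (SampleIndex a i e s p)
  show ?case by (rule SampleIndexE[OF SampleIndex]) simp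
next
  case (Seq c u t u' c' t2 u'')
  show ?case
  proof (rule SeqE[OF Seq.prems])
    fix r w r' assume "t' = r + r'" and "exec \<omega> c u r w" and "exec \<omega> c' w r' v'"
    then show ?thesis using Seq.IH(1)[of r w] Seq.IH(2)[of r' v'] by simp
  qed
next
  case (CondTrue b s c p t u c')
  show ?case by (rule CondE[OF CondTrue.prems]) (use CondTrue.hyps in \<open>simp_all add: CondTrue.IH\<close>)
next
  case (CondFalse b s c' p t u c)
  show ?case by (rule CondE[OF CondFalse.prems]) (use CondFalse.hyps in \<open>simp_all add: CondFalse.IH\<close>)
next
  case (WhileFalse b s c p)
  show ?case by (rule WhileE[OF WhileFalse.prems]) (use WhileFalse.hyps in simp_all)
next
  case (WhileTrue b s c p t u t2 u')
  show ?case
  proof (rule WhileE[OF WhileTrue.prems])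
    fix s1 p1 r w r'
    assume "(s, p) = (s1, p1)" and "t' = Suc (bcost b + r + r')" and "exec \<omega> c (s1, p1) r w"
      and "exec \<omega> (While b c) w r' v'"
    then show ?thesis using WhileTrue.IH(1)[of r w] WhileTrue.IH(2)[of r' v'] by simp
  qed (use WhileTrue.hyps in simp_all)
qed

definition run :: "tape \<Rightarrow> com \<Rightarrow> mem \<Rightarrow> nat \<Rightarrow> mem \<Rightarrow> bool" where
  "run \<omega> c s t s' \<longleftrightarrow> (\<exists>p. exec \<omega> c (s, 0) t (s', p))"

text \<open>Termination and the time bound are required for every outcome of the randomness.\<close>

definition runs_within :: "com \<Rightarrow> mem \<Rightarrow> real \<Rightarrow> bool" where
  "runs_within c s B \<longleftrightarrow> (\<forall>\<omega>. \<exists>t s'. run \<omega> c s t s' \<and> real t \<le> B)"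

text \<open>
  The good outcomes only have to contain an event of the given probability, so that no measurability
  of \<open>P\<close> itself (which may quantify over all future queries) is presupposed.
\<close>

definition with_prob :: "real \<Rightarrow> (tape \<Rightarrow> bool) \<Rightarrow> bool" where
  "with_prob r P \<longleftrightarrow> (\<exists>A \<in> sets tapes. r \<le> measure tapes A \<and> (\<forall>\<omega>\<in>A. P \<omega>))"

section \<open>Data structures for distance estimation\<close>

text \<open>
  A point of Euclidean \<open>d\<close>-space is a list of length \<open>d\<close>; the database is the list of its points.
\<close>

type_synonym point = "real list"

definition eucl_dist :: "point \<Rightarrow> point \<Rightarrow> real" where
  "eucl_dist x y = L2_set (\<lambda>j. x ! j - y ! j) {..<length x}"

definition correct_estimates :: "real \<Rightarrow> point list \<Rightarrow> point \<Rightarrow> (nat \<Rightarrow> real) \<Rightarrow> bool" where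
  "correct_estimates \<epsilon> X q e \<longleftrightarrow> (\<forall>i<length X.
     (1 - \<epsilon>) * eucl_dist q (X ! i) \<le> e i \<and> e i \<le> (1 + \<epsilon>) * eucl_dist q (X ! i))"

record data_structure =
  init_prog :: com
  query_prog :: com
  add_prog :: com

definition as_array :: "real list \<Rightarrow> nat \<Rightarrow> real" where
  "as_array xs j = (if j < length xs then xs ! j else 0)"

text \<open>
  Initialization starts from zeroed memory with the parameters in place; coordinate \<open>j\<close> of point
  number \<open>i\<close> of the initial database is cell \<open>i * d + j\<close> of the array \<open>in\<close>. The argument of a later
  operation also arrives in \<open>in\<close>, everything else being as the previous operation left it. The
  answer to a query is left in the array \<open>out\<close>.
\<close>

definition initial_mem :: "nat \<Rightarrow> real \<Rightarrow> real \<Rightarrow> point list \<Rightarrow> mem" where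
  "initial_mem d \<epsilon> \<delta> X =
     \<lparr>nats = (\<lambda>_ _. 0)(''n'' := (\<lambda>_. 0)(0 := length X), ''d'' := (\<lambda>_. 0)(0 := d)),
      reals = (\<lambda>_ _. 0)(''eps'' := (\<lambda>_. 0)(0 := \<epsilon>), ''delta'' := (\<lambda>_. 0)(0 := \<delta>),
                        ''in'' := as_array (concat X))\<rparr>"

definition feed :: "point \<Rightarrow> mem \<Rightarrow> mem" where
  "feed x s = s\<lparr>reals := (reals s)(''in'' := as_array x)\<rparr>"

text \<open>
  \<open>reachable D d s0 X s Y\<close>: some finite sequence of operations, each with its own fresh tape, leads
  from memory \<open>s0\<close> holding the database \<open>X\<close> to memory \<open>s\<close> holding the database \<open>Y\<close>. All operations
  and all tapes are allowed, so a statement about every reachable \<open>s\<close> holds for each history that an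
  adaptive adversary, who even sees the whole memory and all past randomness, can bring about.
\<close>

inductive reachable ::
    "data_structure \<Rightarrow> nat \<Rightarrow> mem \<Rightarrow> point list \<Rightarrow> mem \<Rightarrow> point list \<Rightarrow> bool"
  for D :: data_structure and d :: nat and s0 :: mem and X :: "point list" where
  start: "reachable D d s0 X s0 X"
| query: "reachable D d s0 X s Y \<Longrightarrow> length q = d \<Longrightarrow> run \<omega> (query_prog D) (feed q s) t s' \<Longrightarrow>
     reachable D d s0 X s' Y"
| add: "reachable D d s0 X s Y \<Longrightarrow> length x = d \<Longrightarrow> run \<omega> (add_prog D) (feed x s) t s' \<Longrightarrow>
     reachable D d s0 X s' (Y @ [x])"

definition answers_query :: "data_structure \<Rightarrow> real \<Rightarrow> real \<Rightarrow> mem \<Rightarrow> point list \<Rightarrow> point \<Rightarrow> bool" where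
  "answers_query D \<epsilon> \<delta> s Y q \<longleftrightarrow> with_prob (1 - \<delta>) (\<lambda>\<omega>. \<exists>t s'.
     run \<omega> (query_prog D) (feed q s) t s' \<and> correct_estimates \<epsilon> Y q (reals s' ''out''))"

definition correctly_initialized ::
    "data_structure \<Rightarrow> nat \<Rightarrow> real \<Rightarrow> real \<Rightarrow> mem \<Rightarrow> point list \<Rightarrow> bool" where
  "correctly_initialized D d \<epsilon> \<delta> s0 X \<longleftrightarrow>
     (\<forall>s Y q. reachable D d s0 X s Y \<longrightarrow> length q = d \<longrightarrow> answers_query D \<epsilon> \<delta> s Y q)"

text \<open>The factors hidden by the soft-O notation; the base is at least 1 for \<open>n, d \<ge> 1\<close>, \<open>\<epsilon> < 1\<close>.\<close>

definition polylog :: "nat \<Rightarrow> nat \<Rightarrow> nat \<Rightarrow> real \<Rightarrow> real" where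
  "polylog k n d \<epsilon> = (1 + ln (real n) + ln (real d) + ln (1 / \<epsilon>)) ^ k"

end

theory Submission
  imports Defs
begin

text \<open>
  The sketch of a vector \<open>v\<close> consists of \<open>m\<close> independent copies of \<open>H diag(g) v\<close>, where \<open>g\<close> is
  Gaussian and \<open>H\<close> is a fast transform of Walsh-Hadamard type. Every coordinate is distributed as
  \<open>N(0, \<parallel>v\<parallel>\<^sup>2)\<close>, and with high probability the average of the absolute values of the \<open>m * D\<close>
  coordinates is \<open>sqrt (2 / pi) * \<parallel>v\<parallel>\<close> up to a factor \<open>1 \<plusminus> O(\<epsilon>)\<close> for \<^emph>\<open>all\<close> \<open>v\<close> simultaneously, although
  \<open>m\<close> is only polylogarithmic in \<open>D\<close>: one integrates out the columns of \<open>v\<close> in stages, by dyadic size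
  of the entries. The average, as a function of the Gaussians of the columns with entries of size at
  most \<open>2 ^ -l\<close>, is Lipschitz with constant \<open>2 ^ -l / sqrt m\<close>, and only about \<open>4 ^ l\<close> entries are
  larger, so at every stage Gaussian concentration beats the entropy of a grid.

  A query samples a few coordinates with fresh randomness and averages them for each point. Since
  \<open>v\<close> may be adversarially aligned with some rows, the averages are truncated, at a level that is
  found by iterating the estimate itself; the truncated mean satisfies a Bernstein bound for
  every fixed \<open>v\<close>, and a union bound over the points finishes the proof. The Gaussians are clipped at
  \<open>8 / \<epsilon>\<close>, so that about \<open>log D\<close> iterations suffice irrespective of \<open>\<delta>\<close>.
\<close>

section \<open>Gaussian concentration\<close>

text \<open>The obstacle is adaptivity: a query or an added point may depend on \<open>g\<close>, so
  a guarantee for one vector at a time is worthless, and what is drawn at initialization must be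
  good for all vectors at once. Only the sampled indices are fresh. A single net of the unit ball
  would force \<open>m\<close> to be of order \<open>D\<close>; in the staged argument scale
  \<open>l\<close> has about \<open>\<Lambda> * 4 ^ l\<close> bits of entropy and a tail exponent of
  order \<open>s^2 * m * 4 ^ l\<close>, so the same \<open>m\<close> serves every scale. With
  \<open>\<Lambda> + 1\<close> scales of tolerance
  \<open>\<epsilon> / (16 * (\<Lambda> + 1))\<close> this leads to
  \<open>m = E * (\<Lambda> + 1)^2 * (\<Lambda> + q + 1)\<close>, where \<open>E\<close> is about
  \<open>16384 / \<epsilon>^2\<close> and \<open>2 ^ - q \<le> \<delta>\<close>. Absolute values are
  averaged rather than squares because their mean is Lipschitz in the Gaussians and hence
  subgaussian. The concentration inequality is derived from Maurey's infimum-convolution inequality,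
  which needs no differentiability: transport on the line, then induction on the coordinates.
  Sampling sees only what holds uniformly in \<open>v\<close>, a mean and a second moment; the
  largest coordinate may exceed the mean by a factor of order \<open>D / \<epsilon>\<close>, which
  is why the truncation level has to be searched for.\<close>

lemma density_cdf_has_derivative:
  fixes u :: "real \<Rightarrow> real"
  assumes cont: "continuous_on UNIV u" and pos: "\<And>x. 0 < u x" and one: "(\<integral>\<^sup>+x. u x \<partial>lborel) = 1"
  defines "M \<equiv> density lborel u"
  shows "real_distribution M" and "(cdf M has_real_derivative u x) (at x)"
proof -
  have [measurable]: "u \<in> borel_measurable borel"
    using cont by (rule borel_measurable_continuous_onI)
  interpret prob_space M
    by (rule prob_spaceI) (simp add: M_def emeasure_density one)
  show rd: "real_distribution M"
    by unfold_locales (auto simp: M_def)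
  interpret real_distribution M by (rule rd)
  have "continuous_on {x - 2..x + 2} u"
    using cont continuous_on_subset by blast
  then obtain F where F0: "\<And>y. y \<in> {x - 2..x + 2} \<Longrightarrow> (F has_vector_derivative u y) (at y within {x - 2..x + 2})"
    using antiderivative_continuous by blast
  have F: "(F has_real_derivative u y) (at y)" if "x - 2 < y" "y < x + 2" for y
    using F0[of y] that at_within_Icc_at[of "x - 2" y "x + 2"]
    by (simp add: has_real_derivative_iff_has_vector_derivative)
  have eq: "cdf M y = F y - F (x - 1) + cdf M (x - 1)" if y: "x - 1 < y" "y < x + 1" for y
  proof -
    have diff: "cdf M y - cdf M (x - 1) = measure M {x - 1<..y}"
      using y by (intro cdf_diff_eq) auto
    have "emeasure M {x - 1<..y} = (\<integral>\<^sup>+z. ennreal (u z) * indicator {x - 1..y} z \<partial>lborel)"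
      unfolding M_def
      by (subst emeasure_density, simp_all, intro nn_integral_cong_AE AE_I[where N="{x - 1}"])
         (auto split: split_indicator)
    also have "\<dots> = ennreal (F y - F (x - 1))"
      using y pos by (intro nn_integral_FTC_Icc F) (auto intro: less_imp_le)
    finally have "measure M {x - 1<..y} = max 0 (F y - F (x - 1))"
      by (simp add: measure_def enn2real_ennreal max_def ennreal_neg)
    moreover have "F (x - 1) \<le> F y"
      using y pos by (intro DERIV_nonneg_imp_nondecreasing[of "x - 1" y F]) (auto intro!: exI[of _ "u _"] F less_imp_le)
    ultimately show ?thesis
      using diff by simp
  qed
  have "(F has_real_derivative u x) (at x)"
    by (rule F) auto
  then have "((\<lambda>y. F y - F (x - 1) + cdf M (x - 1)) has_real_derivative u x) (at x)"
    by (auto intro!: derivative_eq_intros)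
  then show "(cdf M has_real_derivative u x) (at x)"
    by (rule has_field_derivative_transform_within_open[where S="{x - 1<..<x + 1}"]) (use eq in auto)
qed

text \<open>The monotone transport of \<open>u\<close> to \<open>w\<close>: the distribution
  functions \<open>U\<close> and \<open>W\<close> are strictly increasing and differentiable,
  \<open>T\<close> is \<open>U\<close> followed by the inverse of \<open>W\<close>, and
  differentiating \<open>W (T x) = U x\<close> gives the formula.\<close>

lemma continuous_deriv_bij_transport:
  fixes u w :: "real \<Rightarrow> real"
  assumes u: "continuous_on UNIV u" "\<And>x. 0 < u x" "(\<integral>\<^sup>+x. u x \<partial>lborel) = 1"
      and w: "continuous_on UNIV w" "\<And>x. 0 < w x" "(\<integral>\<^sup>+x. w x \<partial>lborel) = 1"
  obtains T where "\<And>x. (T has_real_derivative u x / w (T x)) (at x)"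
proof -
  define U W where "U = cdf (density lborel u)" and "W = cdf (density lborel w)"
  interpret u: real_distribution "density lborel u" by (rule density_cdf_has_derivative(1)[OF u])
  interpret w: real_distribution "density lborel w" by (rule density_cdf_has_derivative(1)[OF w])
  have dU: "(U has_real_derivative u x) (at x)" for x
    unfolding U_def by (rule density_cdf_has_derivative(2)[OF u])
  have dW: "(W has_real_derivative w x) (at x)" for x
    unfolding W_def by (rule density_cdf_has_derivative(2)[OF w])
  have mono: "U x < U y" "W x < W y" if "x < y" for x y
    by (rule DERIV_pos_imp_increasing[OF that]; use dU dW u w in blast)+
  have U01: "0 < U x" "U x < 1" for x
    using mono(1)[of "x - 1" x] mono(1)[of x "x + 1"] u.cdf_nonneg[of "x - 1"] u.cdf_bounded_prob[of "x + 1"]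
    by (auto simp: U_def)
  have "\<exists>y. W y = U x" for x
  proof -
    have "eventually (\<lambda>y. W y < U x) at_bot" "eventually (\<lambda>y. U x < W y) at_top"
      using w.cdf_lim_at_bot w.cdf_lim_at_top_prob U01[of x] unfolding W_def
      by (auto intro: order_tendstoD)
    then obtain a b where "W a < U x" "U x < W b"
      by (metis eventually_at_bot_linorder eventually_at_top_linorder order_refl)
    moreover from this have "a < b"
      using mono(2)[of b a] by (metis linorder_neqE_linordered_idom order.strict_trans order_less_irrefl)
    moreover have "isCont W y" for y
      using dW DERIV_isCont by blast
    ultimately show ?thesis
      using IVT[of W a "U x" b] by auto
  qed
  then obtain T where T: "\<And>x. W (T x) = U x" by metis
  have injW: "W x = W y \<longleftrightarrow> x = y" for x y
    using mono(2) by (metis linorder_neqE_linordered_idom order_less_irrefl)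
  define V where "V z = (THE y. W y = z)" for z
  have VW: "V (W y) = y" for y
    unfolding V_def by (simp add: injW)
  have VT: "V (U x) = T x" for x
    using VW[of "T x"] T by simp
  have "(T has_real_derivative u x / w (T x)) (at x)" for x
  proof -
    have "isCont V (W (T x))"
      by (rule isCont_inverse_function[where d = 1 and f = W]) (use VW DERIV_isCont[OF dW] in auto)
    moreover have "\<exists>y. W y = z" if "W (T x - 1) < z" "z < W (T x + 1)" for z
      using IVT[of W "T x - 1" z "T x + 1"] that dW DERIV_isCont by fastforce
    ultimately have "(V has_real_derivative inverse (w (T x))) (at (U x))"
      using dW[of "T x"] w(2)[of "T x"] mono(2)[of "T x - 1" "T x"] mono(2)[of "T x" "T x + 1"]
      by (intro DERIV_inverse_function[of W _ _ _ "W (T x - 1)" "W (T x + 1)"])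
         (use VW in \<open>force simp: VT T\<close>)+
    from DERIV_chain2[OF this dU] show ?thesis
      by (simp add: VT divide_inverse mult.commute)
  qed
  then show ?thesis by (rule that)
qed

abbreviation std_normal :: "real measure" where
  "std_normal \<equiv> density lborel (\<lambda>x. ennreal (std_normal_density x))"

text \<open>Maurey's infimum-convolution inequality in dimension one. The tilted densities
  \<open>u\<close> and \<open>w\<close> are joined by the monotone transport \<open>T\<close>, and
  substitution along the midpoint \<open>(x + T x) / 2\<close> compares \<open>sqrt (A * B)\<close>
  with the total mass of the Gaussian.\<close>

lemma gaussian_prekopa_leindler_line:
  fixes f g :: "real \<Rightarrow> real"
  assumes cf: "continuous_on UNIV f" and cg: "continuous_on UNIV g"
    and le: "\<And>x y. f x + g y \<le> (x - y)\<^sup>2 / 4"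
    and A: "(\<integral>\<^sup>+x. ennreal (exp (f x)) \<partial>std_normal) = ennreal A" "0 < A"
    and B: "(\<integral>\<^sup>+x. ennreal (exp (g x)) \<partial>std_normal) = ennreal B" "0 < B"
  shows "A * B \<le> 1"
proof -
  let ?\<gamma> = std_normal_density
  have [measurable]: "f \<in> borel_measurable borel" "g \<in> borel_measurable borel"
    using cf cg by (auto intro: borel_measurable_continuous_onI)
  have cga: "continuous_on UNIV ?\<gamma>"
    unfolding std_normal_density_def by (intro continuous_intros) auto
  have gpos: "0 < ?\<gamma> x" for x by (rule normal_density_pos) simp
  define u where "u x = exp (f x) * ?\<gamma> x / A" for x
  define w where "w x = exp (g x) * ?\<gamma> x / B" for x
  have u: "continuous_on UNIV u" "\<And>x. 0 < u x"
    unfolding u_def using A gpos by (auto intro!: continuous_intros cf cga)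
  have w: "continuous_on UNIV w" "\<And>x. 0 < w x"
    unfolding w_def using B gpos by (auto intro!: continuous_intros cg cga)
  have [measurable]: "u \<in> borel_measurable borel" "w \<in> borel_measurable borel"
    using u w by (auto intro: borel_measurable_continuous_onI)
  have u1: "(\<integral>\<^sup>+x. u x \<partial>lborel) = 1"
  proof -
    have "(\<integral>\<^sup>+x. u x \<partial>lborel) = (\<integral>\<^sup>+x. ennreal (1 / A) * (ennreal (?\<gamma> x) * ennreal (exp (f x))) \<partial>lborel)"
      using A by (intro nn_integral_cong) (simp add: u_def ennreal_mult'[symmetric] mult.commute)
    also have "\<dots> = ennreal (1 / A) * ennreal A"
      by (subst nn_integral_cmult) (simp_all add: A(1)[symmetric] nn_integral_density)
    finally show ?thesis using A by (simp add: ennreal_mult'[symmetric])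
  qed
  have w1: "(\<integral>\<^sup>+x. w x \<partial>lborel) = 1"
  proof -
    have "(\<integral>\<^sup>+x. w x \<partial>lborel) = (\<integral>\<^sup>+x. ennreal (1 / B) * (ennreal (?\<gamma> x) * ennreal (exp (g x))) \<partial>lborel)"
      using B by (intro nn_integral_cong) (simp add: w_def ennreal_mult'[symmetric] mult.commute)
    also have "\<dots> = ennreal (1 / B) * ennreal B"
      by (subst nn_integral_cmult) (simp_all add: B(1)[symmetric] nn_integral_density)
    finally show ?thesis using B by (simp add: ennreal_mult'[symmetric])
  qed
  obtain T where T: "\<And>x. (T has_real_derivative u x / w (T x)) (at x)"
    using continuous_deriv_bij_transport[OF u u1 w w1] by blast
  have cT: "continuous_on UNIV T"
    using T by (meson DERIV_isCont continuous_at_imp_continuous_on)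
  define z where "z x = (x + T x) / 2" for x
  define z' where "z' x = (1 + u x / w (T x)) / 2" for x
  have dz: "(z has_real_derivative z' x) (at x)" for x
    unfolding z_def z'_def by (auto intro!: derivative_eq_intros T)
  have cwT: "continuous_on UNIV (\<lambda>x. w (T x))"
    using continuous_on_compose2[OF w(1) cT] by simp
  have cz': "continuous_on UNIV z'"
    unfolding z'_def using w(2) by (intro continuous_intros u(1) cwT) (auto simp: less_imp_neq[symmetric])
  \<comment> \<open>Two ingredients: by the parallelogram identity,
    \<open>exp ((x - y)^2 / 4)\<close> times the two Gaussian densities is the square of the density
    at the midpoint; and the arithmetic-geometric mean inequality bounds the root of
    \<open>u x / w (T x)\<close>, the derivative of \<open>T\<close>, by the derivative of the
    midpoint.\<close>
  have key: "sqrt (A * B) * u x \<le> ?\<gamma> (z x) * z' x" for x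
  proof -
    define y where "y = T x"
    have "(exp (f x) * ?\<gamma> x) * (exp (g y) * ?\<gamma> y) = exp (f x + g y) * (?\<gamma> x * ?\<gamma> y)"
      by (simp add: exp_add)
    also have "\<dots> \<le> exp ((x - y)\<^sup>2 / 4) * (?\<gamma> x * ?\<gamma> y)"
      using le by (intro mult_right_mono) auto
    also have "\<dots> = (?\<gamma> ((x + y) / 2))\<^sup>2"
      unfolding std_normal_density_def
      by (simp add: power2_eq_square exp_add[symmetric] mult_exp_exp field_simps)
    finally have "A * B * (u x * w y) \<le> (?\<gamma> ((x + y) / 2))\<^sup>2"
      using A B by (simp add: u_def w_def field_simps)
    then have "sqrt (A * B * (u x * w y)) \<le> ?\<gamma> ((x + y) / 2)"
      by (intro real_le_lsqrt) (simp_all add: less_imp_le)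
    moreover have "sqrt (u x / w y) \<le> (1 + u x / w y) / 2"
      using arith_geo_mean_sqrt[of 1 "u x / w y"] u(2) w(2) by (simp add: less_imp_le)
    ultimately have "sqrt (A * B * (u x * w y)) * sqrt (u x / w y) \<le> ?\<gamma> ((x + y) / 2) * ((1 + u x / w y) / 2)"
      using u(2)[of x] w(2)[of y] A B by (intro mult_mono) auto
    moreover have "sqrt (A * B * (u x * w y)) * sqrt (u x / w y) = sqrt (A * B) * u x"
      using u(2)[of x] w(2)[of y] A B
      by (simp add: real_sqrt_mult[symmetric] real_sqrt_divide[symmetric] power2_eq_square[symmetric])
         (simp add: real_sqrt_mult)
    ultimately show ?thesis by (simp add: z_def z'_def y_def)
  qed
  \<comment> \<open>Substitution works on compact intervals; the image interval has Gaussian mass at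
    most 1, uniformly in \<open>n\<close>.\<close>
  have "ennreal (sqrt (A * B)) * (\<integral>\<^sup>+x. ennreal (u x) * indicator {- real n..real n} x \<partial>lborel) \<le> 1" for n
  proof -
    have "ennreal (sqrt (A * B)) * (\<integral>\<^sup>+x. ennreal (u x) * indicator {- real n..real n} x \<partial>lborel)
        = (\<integral>\<^sup>+x. ennreal (sqrt (A * B) * u x) * indicator {- real n..real n} x \<partial>lborel)"
      using A B by (subst nn_integral_cmult[symmetric]) (simp_all add: ennreal_mult' mult.assoc)
    also have "\<dots> \<le> (\<integral>\<^sup>+x. ennreal (?\<gamma> (z x) * z' x) * indicator {- real n..real n} x \<partial>lborel)"
      by (intro nn_integral_mono mult_right_mono ennreal_leI key) auto
    also have "\<dots> = (\<integral>\<^sup>+x. ennreal (?\<gamma> x) * indicator {z (- real n)..z (real n)} x \<partial>lborel)"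
      unfolding nn_integral_set_ennreal
      by (rule nn_integral_substitution[symmetric, where g = z and g' = z'])
         (use u(2) w(2) in \<open>auto simp: set_borel_measurable_def z'_def intro!: dz[unfolded z'_def] continuous_on_subset[OF cz'[unfolded z'_def]] less_imp_le[OF add_pos_pos]\<close>)
    also have "\<dots> \<le> (\<integral>\<^sup>+x. ennreal (?\<gamma> x) \<partial>lborel)"
      by (intro nn_integral_mono) (auto split: split_indicator)
    also have "\<dots> = 1"
      by (subst nn_integral_eq_integral) auto
    finally show ?thesis .
  qed
  then have "(SUP n. ennreal (sqrt (A * B)) * (\<integral>\<^sup>+x. ennreal (u x) * indicator {- real n..real n} x \<partial>lborel)) \<le> 1"
    by (intro SUP_least)
  moreover have "(SUP n. (\<integral>\<^sup>+x. ennreal (u x) * indicator {- real n..real n} x \<partial>lborel))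
      = (\<integral>\<^sup>+x. (SUP n. ennreal (u x) * indicator {- real n..real n} x) \<partial>lborel)"
    by (intro nn_integral_monotone_convergence_SUP[symmetric])
       (auto simp: incseq_def le_fun_def split: split_indicator)
  moreover have "(SUP n. ennreal (u x) * indicator {- real n..real n} x) = ennreal (u x)" for x
  proof (rule antisym)
    obtain n where "\<bar>x\<bar> \<le> real n" using real_arch_simple by blast
    then show "ennreal (u x) \<le> (SUP n. ennreal (u x) * indicator {- real n..real n} x)"
      by (intro SUP_upper2[of n]) (auto simp: abs_le_iff indicator_def)
  qed (auto intro!: SUP_least split: split_indicator)
  ultimately have "ennreal (sqrt (A * B)) \<le> 1"
    using u1 by (simp add: SUP_mult_left_ennreal[symmetric])
  then have "sqrt (A * B) \<le> 1" by simp
  then show ?thesis by simp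
qed


section \<open>Product measures: tensorization and concentration of Lipschitz functions\<close>

lemma prob_space_std_normal: "prob_space std_normal"
  by (rule prob_space_normal_density) simp

interpretation std_normal: prob_space std_normal
  by (rule prob_space_std_normal)

interpretation std_normals: product_prob_space "\<lambda>_::'i. std_normal" I for I :: "'i set"
  by unfold_locales

lemma sets_PiM_std_normal [measurable_cong]:
  "sets (Pi\<^sub>M I (\<lambda>_. std_normal)) = sets (Pi\<^sub>M I (\<lambda>_. borel))"
  by (intro sets_PiM_cong) auto

lemma nn_integral_exp_pos:
  assumes "prob_space M" and "F \<in> borel_measurable M"
  shows "(\<integral>\<^sup>+x. ennreal (exp (F x)) \<partial>M) \<noteq> 0"
proof
  interpret prob_space M by fact
  assume "(\<integral>\<^sup>+x. ennreal (exp (F x)) \<partial>M) = 0"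
  then have "AE x in M. False"
    using assms by (subst (asm) nn_integral_0_iff_AE) (auto simp: ennreal_eq_0_iff not_le[symmetric])
  then show False
    by (simp add: AE_False)
qed

text \<open>Tensorization. With one coordinate frozen at \<open>a\<close> and at \<open>b\<close>,
  the induction hypothesis bounds the product of the partial integrals by
  \<open>exp ((a - b)^2 / 4)\<close>, so their logarithms satisfy the hypothesis of the inequality
  on the line. The Lipschitz condition uses the sum norm, which splits over the coordinates, and
  keeps these logarithms continuous.\<close>

lemma gaussian_inf_convolution:
  fixes F G :: "('i \<Rightarrow> real) \<Rightarrow> real"
  assumes "finite I" and "0 \<le> K"
    and "F \<in> borel_measurable (Pi\<^sub>M I (\<lambda>_. borel))" "G \<in> borel_measurable (Pi\<^sub>M I (\<lambda>_. borel))"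
    and "\<And>x y. \<bar>F x - F y\<bar> \<le> K * (\<Sum>i\<in>I. \<bar>x i - y i\<bar>)" "\<And>x y. \<bar>G x - G y\<bar> \<le> K * (\<Sum>i\<in>I. \<bar>x i - y i\<bar>)"
    and "\<And>x y. F x + G y \<le> (\<Sum>i\<in>I. (x i - y i)\<^sup>2) / 4"
  shows "(\<integral>\<^sup>+x. exp (F x) \<partial>Pi\<^sub>M I (\<lambda>_. std_normal)) * (\<integral>\<^sup>+x. exp (G x) \<partial>Pi\<^sub>M I (\<lambda>_. std_normal)) \<le> 1"
  using assms(1,3-)
proof (induction I arbitrary: F G rule: finite_induct)
  case empty
  have "exp (F (\<lambda>_. undefined)) * exp (G (\<lambda>_. undefined)) \<le> 1"
    using empty(5)[of "\<lambda>_. undefined" "\<lambda>_. undefined"] by (simp add: exp_add[symmetric])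
  then show ?case
    by (simp add: PiM_empty nn_integral_count_space_finite ennreal_mult'[symmetric])
next
  case (insert i I)
  note [simp] = insert(1,2)
  note [measurable] = insert(4,5)
  let ?P = "Pi\<^sub>M I (\<lambda>_::'i. std_normal)"
  have P: "prob_space ?P"
    by (intro prob_space_PiM prob_space_std_normal)
  have upd: "(\<Sum>j\<in>insert i I. \<bar>(x(i := a)) j - (y(i := b)) j\<bar>) = \<bar>a - b\<bar> + (\<Sum>j\<in>I. \<bar>x j - y j\<bar>)"
      "(\<Sum>j\<in>insert i I. ((x(i := a)) j - (y(i := b)) j)\<^sup>2) = (a - b)\<^sup>2 + (\<Sum>j\<in>I. (x j - y j)\<^sup>2)"
    for x y :: "'i \<Rightarrow> real" and a b
  proof -
    have "(\<Sum>j\<in>I. H ((x(i := a)) j) ((y(i := b)) j)) = (\<Sum>j\<in>I. H (x j) (y j))" for H :: "real \<Rightarrow> real \<Rightarrow> real"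
      by (intro sum.cong) (use insert(2) in auto)
    from this[of "\<lambda>a b. \<bar>a - b\<bar>"] this[of "\<lambda>a b. (a - b)\<^sup>2"] show
      "(\<Sum>j\<in>insert i I. \<bar>(x(i := a)) j - (y(i := b)) j\<bar>) = \<bar>a - b\<bar> + (\<Sum>j\<in>I. \<bar>x j - y j\<bar>)"
      "(\<Sum>j\<in>insert i I. ((x(i := a)) j - (y(i := b)) j)\<^sup>2) = (a - b)\<^sup>2 + (\<Sum>j\<in>I. (x j - y j)\<^sup>2)"
      by simp_all
  qed
  define Fi Gi where "Fi a x = F (x(i := a))" and "Gi a x = G (x(i := a))" for a x
  have [measurable]: "Fi a \<in> borel_measurable (Pi\<^sub>M I (\<lambda>_. borel))" "Gi a \<in> borel_measurable (Pi\<^sub>M I (\<lambda>_. borel))" for a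
    unfolding Fi_def Gi_def by measurable
  have lF: "\<bar>Fi a x - Fi b y\<bar> \<le> K * (\<Sum>i\<in>I. \<bar>x i - y i\<bar>) + K * \<bar>a - b\<bar>"
   and lG: "\<bar>Gi a x - Gi b y\<bar> \<le> K * (\<Sum>i\<in>I. \<bar>x i - y i\<bar>) + K * \<bar>a - b\<bar>" for x y a b
    unfolding Fi_def Gi_def using insert(6,7)[of "x(i := a)" "y(i := b)"] unfolding upd
    by (simp_all add: distrib_left add.commute del: fun_upd_apply)
  have le: "Fi a x + Gi b y \<le> ((a - b)\<^sup>2 + (\<Sum>i\<in>I. (x i - y i)\<^sup>2)) / 4" for a x b y
    unfolding Fi_def Gi_def using insert(8)[of "x(i := a)" "y(i := b)"] unfolding upd .
  define U where "U a = (\<integral>\<^sup>+x. exp (Fi a x) \<partial>?P)" for a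
  define V where "V a = (\<integral>\<^sup>+x. exp (Gi a x) \<partial>?P)" for a
  have U0: "U a \<noteq> 0" and V0: "V a \<noteq> 0" for a
    unfolding U_def V_def by (intro nn_integral_exp_pos P; measurable)+
  \<comment> \<open>Subtracting the constant \<open>(a - b)^2 / 4\<close> from \<open>Fi a\<close>
    restores the hypothesis in the remaining coordinates.\<close>
  have UV: "U a * V b \<le> exp ((a - b)\<^sup>2 / 4)" for a b
  proof -
    have "(\<integral>\<^sup>+x. exp (Fi a x - (a - b)\<^sup>2 / 4) \<partial>?P) * V b \<le> 1"
      unfolding V_def
    proof (rule insert(3))
      fix x y
      show "Fi a x - (a - b)\<^sup>2 / 4 + Gi b y \<le> (\<Sum>i\<in>I. (x i - y i)\<^sup>2) / 4"
        using le[of a x b y] by (simp add: add_divide_distrib)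
    qed (use lF[of a _ a _] lG[of b _ b _] in auto)
    moreover have "U a = exp ((a - b)\<^sup>2 / 4) * (\<integral>\<^sup>+x. exp (Fi a x - (a - b)\<^sup>2 / 4) \<partial>?P)"
      unfolding U_def
      by (subst nn_integral_cmult[symmetric]) (auto simp: ennreal_mult'[symmetric] exp_add[symmetric])
    ultimately show ?thesis
      using mult_left_mono[of _ 1 "ennreal (exp ((a - b)\<^sup>2 / 4))"] by (simp add: mult.assoc)
  qed
  have top: "U a \<noteq> top" "V a \<noteq> top" for a
    using UV[of a a] U0[of a] V0[of a]
    by (auto simp: ennreal_mult_eq_top_iff ennreal_mult_top ennreal_top_mult top_unique)
  have lip: "U a \<le> ennreal (exp (K * \<bar>a - b\<bar>)) * U b" "V a \<le> ennreal (exp (K * \<bar>a - b\<bar>)) * V b" for a b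
  proof -
    have le: "Fi a x \<le> K * \<bar>a - b\<bar> + Fi b x" "Gi a x \<le> K * \<bar>a - b\<bar> + Gi b x" for x
      using lF[of a x b x] lG[of a x b x] by (auto simp: abs_le_iff)
    have "U a \<le> (\<integral>\<^sup>+x. ennreal (exp (K * \<bar>a - b\<bar>)) * exp (Fi b x) \<partial>?P)"
      unfolding U_def using le(1)
      by (intro nn_integral_mono) (simp add: ennreal_mult'[symmetric] exp_add[symmetric])
    then show "U a \<le> ennreal (exp (K * \<bar>a - b\<bar>)) * U b"
      unfolding U_def by (subst (asm) nn_integral_cmult) simp_all
    have "V a \<le> (\<integral>\<^sup>+x. ennreal (exp (K * \<bar>a - b\<bar>)) * exp (Gi b x) \<partial>?P)"
      unfolding V_def using le(2)
      by (intro nn_integral_mono) (simp add: ennreal_mult'[symmetric] exp_add[symmetric])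
    then show "V a \<le> ennreal (exp (K * \<bar>a - b\<bar>)) * V b"
      unfolding V_def by (subst (asm) nn_integral_cmult) simp_all
  qed
  define f where "f a = ln (enn2real (U a))" for a
  define g where "g a = ln (enn2real (V a))" for a
  have Upos: "0 < enn2real (U a)" and Vpos: "0 < enn2real (V a)" for a
    using U0 V0 top by (simp_all add: enn2real_positive_iff less_top[symmetric] zero_less_iff_neq_zero)
  have Uf: "U a = ennreal (exp (f a))" and Vg: "V a = ennreal (exp (g a))" for a
    using Upos Vpos top by (simp_all add: f_def g_def less_top)
  have "f a \<le> K * \<bar>a - b\<bar> + f b" "g a \<le> K * \<bar>a - b\<bar> + g b" for a b
    using lip[of a b] by (simp_all add: Uf Vg ennreal_mult'[symmetric] exp_add[symmetric])
  then have "\<bar>f a - f b\<bar> \<le> K * \<bar>a - b\<bar>" "\<bar>g a - g b\<bar> \<le> K * \<bar>a - b\<bar>" for a b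
    by (smt (verit) abs_minus_commute)+
  then have cont: "continuous_on UNIV f" "continuous_on UNIV g"
    using \<open>0 \<le> K\<close> by (auto intro!: lipschitz_on_continuous_on[of K] lipschitz_onI simp: dist_real_def)
  have int: "(\<integral>\<^sup>+x. exp (F x) \<partial>Pi\<^sub>M (insert i I) (\<lambda>_. std_normal)) = (\<integral>\<^sup>+a. exp (f a) \<partial>std_normal)"
      "(\<integral>\<^sup>+x. exp (G x) \<partial>Pi\<^sub>M (insert i I) (\<lambda>_. std_normal)) = (\<integral>\<^sup>+a. exp (g a) \<partial>std_normal)"
    by (subst std_normals.product_nn_integral_insert_rev; simp add: Uf[symmetric] Vg[symmetric] U_def V_def Fi_def Gi_def)+
  have fg: "f a + g b \<le> (a - b)\<^sup>2 / 4" for a b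
    using UV[of a b] by (simp add: Uf Vg ennreal_mult'[symmetric] exp_add[symmetric])
  have [measurable]: "f \<in> borel_measurable borel" "g \<in> borel_measurable borel"
    using cont by (auto intro: borel_measurable_continuous_onI)
  have "(\<integral>\<^sup>+a. exp (h a) \<partial>std_normal) \<noteq> top"
    if h: "\<And>a. h a \<le> a\<^sup>2 / 4 + c" and [measurable]: "h \<in> borel_measurable borel" for h :: "real \<Rightarrow> real" and c
  proof -
    have "(\<integral>\<^sup>+a. exp (h a) \<partial>std_normal) = (\<integral>\<^sup>+a. std_normal_density a * exp (h a) \<partial>lborel)"
      by (simp add: nn_integral_density ennreal_mult')
    also have "\<dots> \<le> (\<integral>\<^sup>+a. exp c * sqrt 2 * normal_density 0 (sqrt 2) a \<partial>lborel)"
    proof (intro nn_integral_mono ennreal_leI)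
      fix a
      have le: "exp (- a\<^sup>2 / 2) * exp (h a) \<le> exp c * exp (- a\<^sup>2 / 4)"
        using h[of a] by (simp add: exp_add[symmetric] field_simps)
      have eq: "sqrt 2 * normal_density 0 (sqrt 2) a = exp (- a\<^sup>2 / 4) / sqrt (2 * pi)"
      proof -
        have "sqrt (2 * pi * (sqrt 2)\<^sup>2) = sqrt 2 * sqrt (2 * pi)"
          by (simp add: real_sqrt_mult[symmetric])
        then show ?thesis unfolding normal_density_def by simp
      qed
      show "std_normal_density a * exp (h a) \<le> exp c * sqrt 2 * normal_density 0 (sqrt 2) a"
        unfolding mult.assoc eq using divide_right_mono[OF le, of "sqrt (2 * pi)"]
        by (simp add: std_normal_density_def)
    qed
    also have "\<dots> = ennreal (exp c * sqrt 2)"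
      by (subst nn_integral_eq_integral) auto
    finally show ?thesis by (auto simp: top_unique)
  qed
  \<comment> \<open>Setting one argument of \<open>fg\<close> to 0 shows that \<open>f\<close> and
    \<open>g\<close> grow at most like \<open>a^2 / 4\<close>, which the Gaussian weight beats; the
    comparison density is the normal one of variance 2.\<close>
  from this[of f "- g 0"] this[of g "- f 0"] fg[of _ 0] fg[of 0]
  have fin: "(\<integral>\<^sup>+a. exp (f a) \<partial>std_normal) \<noteq> top" "(\<integral>\<^sup>+a. exp (g a) \<partial>std_normal) \<noteq> top"
    by (auto simp: algebra_simps)
  then obtain A B where AB: "(\<integral>\<^sup>+a. exp (f a) \<partial>std_normal) = ennreal A" "(\<integral>\<^sup>+a. exp (g a) \<partial>std_normal) = ennreal B" "0 \<le> A" "0 \<le> B"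
    by (metis ennreal_cases)
  moreover have "A \<noteq> 0" "B \<noteq> 0"
    using AB nn_integral_exp_pos[OF prob_space_std_normal, of f] nn_integral_exp_pos[OF prob_space_std_normal, of g] by auto
  ultimately have "A * B \<le> 1"
    using gaussian_prekopa_leindler_line[OF cont fg, of A B] by simp
  then show ?case
    using AB by (simp add: int ennreal_mult'[symmetric])
qed

text \<open>The infimum-convolution inequality is applied to \<open>t * \<phi>\<close>, lowered by a
  constant, and to the negative of \<open>t * \<phi>\<close>: the hypothesis becomes
  \<open>\<bar>t\<bar> * L * r \<le> t^2 * L^2 + r^2 / 4\<close>, and the second factor is at least
  1 because \<open>1 + u \<le> exp u\<close> and \<open>u\<close> has mean 0. The exponent is twice
  the optimal one, which costs only a constant factor in \<open>m\<close>.\<close>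

lemma gaussian_concentration_mgf:
  fixes \<phi> :: "('i \<Rightarrow> real) \<Rightarrow> real"
  assumes fin: "finite I" and L: "0 \<le> L"
    and [measurable]: "\<phi> \<in> borel_measurable (Pi\<^sub>M I (\<lambda>_. borel))"
    and lip: "\<And>x y. \<bar>\<phi> x - \<phi> y\<bar> \<le> L * L2_set (\<lambda>i. x i - y i) I"
    and int: "integrable (Pi\<^sub>M I (\<lambda>_. std_normal)) \<phi>"
    and mean: "(\<integral>x. \<phi> x \<partial>Pi\<^sub>M I (\<lambda>_. std_normal)) = \<mu>"
  shows "(\<integral>\<^sup>+x. exp (t * (\<phi> x - \<mu>)) \<partial>Pi\<^sub>M I (\<lambda>_. std_normal)) \<le> exp (t\<^sup>2 * L\<^sup>2)"
proof -
  let ?P = "Pi\<^sub>M I (\<lambda>_::'i. std_normal)"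
  have P: "prob_space ?P"
    by (intro prob_space_PiM prob_space_std_normal)
  have l1: "\<bar>\<phi> x - \<phi> y\<bar> \<le> L * (\<Sum>i\<in>I. \<bar>x i - y i\<bar>)" for x y
    by (rule order_trans[OF lip mult_left_mono[OF L2_set_le_sum_abs L]])
  have l2: "\<bar>t * \<phi> x - t * \<phi> y\<bar> \<le> (\<bar>t\<bar> * L) * (\<Sum>i\<in>I. \<bar>x i - y i\<bar>)" for x y
    using mult_left_mono[OF l1[of x y], of "\<bar>t\<bar>"]
    by (simp add: abs_mult[symmetric] right_diff_distrib[symmetric] mult.assoc)
  have prod: "(\<integral>\<^sup>+x. exp (t * \<phi> x - (t * \<mu> + t\<^sup>2 * L\<^sup>2)) \<partial>?P) * (\<integral>\<^sup>+x. exp (t * \<mu> - t * \<phi> x) \<partial>?P) \<le> 1"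
  proof (rule gaussian_inf_convolution[OF fin, of "\<bar>t\<bar> * L"])
    fix x y
    define r where "r = L2_set (\<lambda>i. x i - y i) I"
    have "t * \<phi> x - t * \<phi> y \<le> \<bar>t\<bar> * L * r"
    proof -
      have "t * \<phi> x - t * \<phi> y \<le> \<bar>t\<bar> * \<bar>\<phi> x - \<phi> y\<bar>"
        by (metis abs_ge_self abs_mult right_diff_distrib)
      then show ?thesis
        using mult_left_mono[OF lip[of x y], of "\<bar>t\<bar>"] by (simp add: r_def mult.assoc)
    qed
    moreover have "\<bar>t\<bar> * L * r \<le> t\<^sup>2 * L\<^sup>2 + r\<^sup>2 / 4"
      using zero_le_power2[of "\<bar>t\<bar> * L - r / 2"] by (simp add: power2_eq_square algebra_simps)
    moreover have "r\<^sup>2 = (\<Sum>i\<in>I. (x i - y i)\<^sup>2)"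
      by (simp add: r_def L2_set_def sum_nonneg)
    ultimately show "t * \<phi> x - (t * \<mu> + t\<^sup>2 * L\<^sup>2) + (t * \<mu> - t * \<phi> y) \<le> (\<Sum>i\<in>I. (x i - y i)\<^sup>2) / 4"
      by simp
  next
    fix x y
    show "\<bar>t * \<mu> - t * \<phi> x - (t * \<mu> - t * \<phi> y)\<bar> \<le> \<bar>t\<bar> * L * (\<Sum>i\<in>I. \<bar>x i - y i\<bar>)"
      using l2[of x y] by (simp add: abs_minus_commute)
  qed (use L l2 in auto)
  have one: "1 \<le> (\<integral>\<^sup>+x. exp (t * \<mu> - t * \<phi> x) \<partial>?P)"
  proof -
    have "1 = ennreal (\<integral>x. 1 + (t * \<mu> - t * \<phi> x) \<partial>?P)"
      using int by (simp add: mean prob_space.prob_space[OF P])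
    also have "\<dots> \<le> (\<integral>\<^sup>+x. ennreal (1 + (t * \<mu> - t * \<phi> x)) \<partial>?P)"
    proof -
      have "ennreal (\<integral>x. 1 + (t * \<mu> - t * \<phi> x) \<partial>?P) \<le> ennreal (\<integral>x. max 0 (1 + (t * \<mu> - t * \<phi> x)) \<partial>?P)"
        using int by (intro ennreal_leI integral_mono) auto
      also have "\<dots> = (\<integral>\<^sup>+x. ennreal (max 0 (1 + (t * \<mu> - t * \<phi> x))) \<partial>?P)"
        using int by (intro nn_integral_eq_integral[symmetric]) auto
      finally show ?thesis
        by (simp add: ennreal_max_0)
    qed
    also have "\<dots> \<le> (\<integral>\<^sup>+x. exp (t * \<mu> - t * \<phi> x) \<partial>?P)"
      by (intro nn_integral_mono ennreal_leI exp_ge_add_one_self)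
    finally show ?thesis .
  qed
  have "(\<integral>\<^sup>+x. exp (t * \<phi> x - (t * \<mu> + t\<^sup>2 * L\<^sup>2)) \<partial>?P) \<le> 1"
  proof -
    have "a \<le> 1" if "a * b \<le> 1" "1 \<le> b" for a b :: ennreal
      using mult_left_mono[OF that(2), of a] that(1) by simp
    then show ?thesis using prod one by blast
  qed
  moreover have "(\<integral>\<^sup>+x. exp (t * (\<phi> x - \<mu>)) \<partial>?P) =
      ennreal (exp (t\<^sup>2 * L\<^sup>2)) * (\<integral>\<^sup>+x. exp (t * \<phi> x - (t * \<mu> + t\<^sup>2 * L\<^sup>2)) \<partial>?P)"
  proof -
    have "exp (t * (\<phi> x - \<mu>)) = exp (t\<^sup>2 * L\<^sup>2) * exp (t * \<phi> x - (t * \<mu> + t\<^sup>2 * L\<^sup>2))" for x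
      by (simp add: exp_add[symmetric] right_diff_distrib)
    then show ?thesis
      by (subst nn_integral_cmult[symmetric]) (auto simp: ennreal_mult'[symmetric])
  qed
  ultimately show ?thesis
    using mult_left_mono[of _ 1 "ennreal (exp (t\<^sup>2 * L\<^sup>2))"] by simp
qed

section \<open>Smoothing by a Gaussian\<close>

text \<open>Chernoff's bound with \<open>t = s / (2 * v)\<close>, the minimizer of
  \<open>t^2 * v - t * s\<close>; the signs \<open>c = 1\<close> and \<open>c = -1\<close> give the
  two sides.\<close>

lemma subgaussian_tail:
  assumes "prob_space M" and [measurable]: "X \<in> borel_measurable M"
    and mgf: "\<And>t. (\<integral>\<^sup>+x. exp (t * X x) \<partial>M) \<le> exp (t\<^sup>2 * v)"
    and v: "0 < v" and s: "0 \<le> s"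
  shows "measure M {x \<in> space M. s \<le> \<bar>X x\<bar>} \<le> 2 * exp (- s\<^sup>2 / (4 * v))"
proof -
  interpret prob_space M by fact
  have side: "measure M {x \<in> space M. s \<le> c * X x} \<le> exp (- s\<^sup>2 / (4 * v))" if c: "c\<^sup>2 = 1" for c
  proof -
    let ?t = "s / (2 * v)"
    have "emeasure M {x \<in> space M. s \<le> c * X x} \<le> (\<integral>\<^sup>+x. ennreal (exp (- ?t * s)) * exp ((?t * c) * X x) \<partial>M)"
    proof (subst nn_integral_indicator[symmetric], simp, intro nn_integral_mono)
      fix x
      have "1 \<le> exp (- ?t * s) * exp ((?t * c) * X x)" if "s \<le> c * X x"
        using mult_left_mono[OF that, of ?t] s v by (simp add: exp_add[symmetric] mult.assoc)
      then show "indicator {x \<in> space M. s \<le> c * X x} x \<le> ennreal (exp (- ?t * s)) * ennreal (exp ((?t * c) * X x))"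
        by (auto simp: indicator_def ennreal_mult'[symmetric] simp del: ennreal_1 simp flip: ennreal_1)
    qed
    also have "\<dots> = ennreal (exp (- ?t * s)) * (\<integral>\<^sup>+x. exp ((?t * c) * X x) \<partial>M)"
      by (rule nn_integral_cmult) simp
    also have "\<dots> \<le> ennreal (exp (- ?t * s)) * ennreal (exp ((?t * c)\<^sup>2 * v))"
      by (intro mult_left_mono mgf) simp
    also have "\<dots> = ennreal (exp (- s\<^sup>2 / (4 * v)))"
      using v c by (simp add: ennreal_mult'[symmetric] exp_add[symmetric] power_mult_distrib)
        (simp add: power2_eq_square field_simps)
    finally show ?thesis
      by (simp add: emeasure_eq_measure)
  qed
  have "measure M {x \<in> space M. s \<le> \<bar>X x\<bar>} \<le>
      measure M ({x \<in> space M. s \<le> 1 * X x} \<union> {x \<in> space M. s \<le> -1 * X x})"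
    by (intro finite_measure_mono) auto
  also have "\<dots> \<le> measure M {x \<in> space M. s \<le> 1 * X x} + measure M {x \<in> space M. s \<le> -1 * X x}"
    by (intro measure_Un_le) auto
  finally show ?thesis
    using side[of 1] side[of "-1"] by simp
qed

section \<open>Gaussian sums and partially averaged absolute values\<close>

lemma emeasure_std_normal_UNIV [simp]: "emeasure std_normal UNIV = 1"
  using std_normal.emeasure_space_1 by simp

lemma nn_integral_std_normal_scale:
  assumes [measurable]: "f \<in> borel_measurable borel" and a: "a \<noteq> 0"
  shows "(\<integral>\<^sup>+x. f (a * x) \<partial>std_normal) = (\<integral>\<^sup>+x. ennreal (normal_density 0 \<bar>a\<bar> x) * f x \<partial>lborel)"
proof -
  have "(\<integral>\<^sup>+x. ennreal (normal_density 0 \<bar>a\<bar> x) * f x \<partial>lborel)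
     = \<bar>a\<bar> * (\<integral>\<^sup>+x. ennreal (normal_density 0 \<bar>a\<bar> (0 + a * x)) * f (0 + a * x) \<partial>lborel)"
    by (rule nn_integral_real_affine) (use a in simp_all)
  also have "\<dots> = (\<integral>\<^sup>+x. ennreal \<bar>a\<bar> * (ennreal (normal_density 0 \<bar>a\<bar> (0 + a * x)) * f (0 + a * x)) \<partial>lborel)"
    by (rule nn_integral_cmult[symmetric]) simp
  also have "\<dots> = (\<integral>\<^sup>+x. ennreal (std_normal_density x) * f (a * x) \<partial>lborel)"
  proof (intro nn_integral_cong)
    fix x
    have "\<bar>a\<bar> * normal_density 0 \<bar>a\<bar> (a * x) = std_normal_density x"
      using a by (simp add: normal_density_def real_sqrt_mult power_mult_distrib)
    then show "ennreal \<bar>a\<bar> * (ennreal (normal_density 0 \<bar>a\<bar> (0 + a * x)) * f (0 + a * x))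
       = ennreal (std_normal_density x) * f (a * x)"
      by (simp add: ennreal_mult'[symmetric] mult.assoc[symmetric])
  qed
  finally show ?thesis by (simp add: nn_integral_density)
qed

lemma nn_integral_std_normal_abs:
  assumes [measurable]: "f \<in> borel_measurable borel"
  shows "(\<integral>\<^sup>+x. f (a * x) \<partial>std_normal) = (\<integral>\<^sup>+x. f (\<bar>a\<bar> * x) \<partial>std_normal)"
  by (cases "a = 0") (simp_all add: nn_integral_std_normal_scale)

lemma nn_integral_std_normal_conv:
  assumes [measurable]: "f \<in> borel_measurable borel"
  shows "(\<integral>\<^sup>+x. \<integral>\<^sup>+z. f (a * x + b * z) \<partial>std_normal \<partial>std_normal) = (\<integral>\<^sup>+z. f (sqrt (a\<^sup>2 + b\<^sup>2) * z) \<partial>std_normal)"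
proof (cases "a = 0 \<or> b = 0")
  case True
  then show ?thesis
    using nn_integral_std_normal_abs[of f a] nn_integral_std_normal_abs[of f b]
    by auto
next
  case False
  then have a: "a \<noteq> 0" and b: "b \<noteq> 0" and ab: "0 < a\<^sup>2 + b\<^sup>2"
    by (auto simp: sum_power2_gt_zero_iff)
  have "(\<integral>\<^sup>+x. \<integral>\<^sup>+z. f (a * x + b * z) \<partial>std_normal \<partial>std_normal)
      = (\<integral>\<^sup>+x. (\<integral>\<^sup>+z. ennreal (normal_density 0 \<bar>b\<bar> z) * f (a * x + z) \<partial>lborel) \<partial>std_normal)"
    by (intro nn_integral_cong nn_integral_std_normal_scale[OF _ b]) measurable
  also have "\<dots> = (\<integral>\<^sup>+x. ennreal (normal_density 0 \<bar>a\<bar> x) * (\<integral>\<^sup>+z. ennreal (normal_density 0 \<bar>b\<bar> z) * f (x + z) \<partial>lborel) \<partial>lborel)"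
    by (rule nn_integral_std_normal_scale[OF _ a, of "\<lambda>x. \<integral>\<^sup>+z. ennreal (normal_density 0 \<bar>b\<bar> z) * f (x + z) \<partial>lborel"]) measurable
  also have "\<dots> = (\<integral>\<^sup>+x. ennreal (normal_density 0 \<bar>a\<bar> x) * (\<integral>\<^sup>+z. ennreal (normal_density 0 \<bar>b\<bar> (z - x)) * f z \<partial>lborel) \<partial>lborel)"
  proof -
    have "(\<integral>\<^sup>+z. ennreal (normal_density 0 \<bar>b\<bar> (z - x)) * f z \<partial>lborel) =
      \<bar>1::real\<bar> * (\<integral>\<^sup>+z. ennreal (normal_density 0 \<bar>b\<bar> (x + 1 * z - x)) * f (x + 1 * z) \<partial>lborel)" for x
      by (rule nn_integral_real_affine) measurable
    then show ?thesis by simp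
  qed
  also have "\<dots> = (\<integral>\<^sup>+x. \<integral>\<^sup>+z. ennreal (normal_density 0 \<bar>b\<bar> (z - x)) * ennreal (normal_density 0 \<bar>a\<bar> x) * f z \<partial>lborel \<partial>lborel)"
    by (subst nn_integral_cmult[symmetric]) (simp_all add: ac_simps)
  also have "\<dots> = (\<integral>\<^sup>+z. \<integral>\<^sup>+x. ennreal (normal_density 0 \<bar>b\<bar> (z - x)) * ennreal (normal_density 0 \<bar>a\<bar> x) * f z \<partial>lborel \<partial>lborel)"
    by (rule lborel_pair.Fubini') measurable
  also have "\<dots> = (\<integral>\<^sup>+z. (\<integral>\<^sup>+x. ennreal (normal_density 0 \<bar>b\<bar> (z - x) * normal_density 0 \<bar>a\<bar> x) \<partial>lborel) * f z \<partial>lborel)"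
    by (intro nn_integral_cong, subst nn_integral_multc[symmetric]) (simp_all add: ennreal_mult')
  also have "\<dots> = (\<integral>\<^sup>+z. ennreal (normal_density 0 (sqrt (a\<^sup>2 + b\<^sup>2)) z) * f z \<partial>lborel)"
    using fun_cong[OF conv_normal_density_zero_mean[of "\<bar>b\<bar>" "\<bar>a\<bar>"]] a b
    by (simp add: add.commute)
  also have "\<dots> = (\<integral>\<^sup>+z. f (sqrt (a\<^sup>2 + b\<^sup>2) * z) \<partial>std_normal)"
    using nn_integral_std_normal_scale[of f "sqrt (a\<^sup>2 + b\<^sup>2)"] ab a by simp
  finally show ?thesis .
qed

text \<open>The extra summand \<open>\<sigma> * z\<close> makes the induction run: each Gaussian
  \<open>y i\<close> is absorbed into it, and the squares of the coefficients add up.\<close>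

lemma nn_integral_std_normals_linear:
  assumes "finite J" and "f \<in> borel_measurable borel"
  shows "(\<integral>\<^sup>+y. \<integral>\<^sup>+z. f ((\<Sum>i\<in>J. \<alpha> i * y i) + \<sigma> * z) \<partial>std_normal \<partial>Pi\<^sub>M J (\<lambda>_. std_normal))
       = (\<integral>\<^sup>+z. f (sqrt (\<sigma>\<^sup>2 + (\<Sum>i\<in>J. (\<alpha> i)\<^sup>2)) * z) \<partial>std_normal)"
  using assms
proof (induction J arbitrary: f \<sigma> rule: finite_induct)
  case (empty f)
  then show ?case
    using nn_integral_std_normal_abs[of f \<sigma>]
    by (simp add: PiM_empty nn_integral_count_space_finite)
next
  case (insert i J)
  note [measurable] = insert.prems
  have "(\<integral>\<^sup>+y. \<integral>\<^sup>+z. f ((\<Sum>j\<in>insert i J. \<alpha> j * y j) + \<sigma> * z) \<partial>std_normal \<partial>Pi\<^sub>M (insert i J) (\<lambda>_. std_normal))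
     = (\<integral>\<^sup>+y. \<integral>\<^sup>+x. \<integral>\<^sup>+z. f ((\<Sum>j\<in>insert i J. \<alpha> j * (y(i := x)) j) + \<sigma> * z) \<partial>std_normal \<partial>std_normal \<partial>Pi\<^sub>M J (\<lambda>_. std_normal))"
    using insert.hyps by (intro std_normals.product_nn_integral_insert) measurable
  also have "\<dots> = (\<integral>\<^sup>+y. \<integral>\<^sup>+x. \<integral>\<^sup>+z. f ((\<Sum>j\<in>J. \<alpha> j * y j) + (\<alpha> i * x + \<sigma> * z)) \<partial>std_normal \<partial>std_normal \<partial>Pi\<^sub>M J (\<lambda>_. std_normal))"
  proof -
    have "(\<Sum>j\<in>insert i J. \<alpha> j * (y(i := x)) j) = \<alpha> i * x + (\<Sum>j\<in>J. \<alpha> j * y j)" for x y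
      using insert.hyps by (auto intro!: sum.cong)
    then show ?thesis by (simp only: ac_simps)
  qed
  also have "\<dots> = (\<integral>\<^sup>+y. \<integral>\<^sup>+z. f ((\<Sum>j\<in>J. \<alpha> j * y j) + sqrt ((\<alpha> i)\<^sup>2 + \<sigma>\<^sup>2) * z) \<partial>std_normal \<partial>Pi\<^sub>M J (\<lambda>_. std_normal))"
    by (intro nn_integral_cong nn_integral_std_normal_conv) measurable
  also have "\<dots> = (\<integral>\<^sup>+z. f (sqrt (\<sigma>\<^sup>2 + (\<Sum>j\<in>insert i J. (\<alpha> j)\<^sup>2)) * z) \<partial>std_normal)"
    by (subst insert.IH) (simp_all add: insert.hyps ac_simps)
  finally show ?case .
qed

text \<open>The absolute value of a sketch coordinate after part of its Gaussians has been averaged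
  out: \<open>c\<close> is the contribution of those kept and \<open>\<sigma>^2\<close> the variance
  of the others. It interpolates between the coordinate itself (\<open>\<sigma> = 0\<close>) and the
  multiple \<open>sqrt (2 / pi)\<close> of the norm (\<open>c = 0\<close>).\<close>

definition smoothed_abs :: "real \<Rightarrow> real \<Rightarrow> real" where
  "smoothed_abs \<sigma> c = (\<integral>z. \<bar>c + \<sigma> * z\<bar> \<partial>std_normal)"

lemma integrable_std_normal_abs [simp]: "integrable std_normal (\<lambda>z. \<bar>c + \<sigma> * z\<bar>)"
proof -
  have "integrable std_normal (\<lambda>z. z)"
    using integrable_std_normal_distribution_moment[of 1] by simp
  then show ?thesis by (intro integrable_abs integrable_add) auto
qed

lemma nn_integral_smoothed_abs: "(\<integral>\<^sup>+z. \<bar>c + \<sigma> * z\<bar> \<partial>std_normal) = ennreal (smoothed_abs \<sigma> c)"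
  unfolding smoothed_abs_def by (rule nn_integral_eq_integral) auto

lemma smoothed_abs_nonneg [simp]: "0 \<le> smoothed_abs \<sigma> c"
  by (simp add: smoothed_abs_def)

lemma smoothed_abs_0 [simp]: "smoothed_abs 0 c = \<bar>c\<bar>"
  by (simp add: smoothed_abs_def std_normal.prob_space[simplified])

lemma smoothed_abs_at_0: "0 \<le> \<sigma> \<Longrightarrow> smoothed_abs \<sigma> 0 = \<sigma> * sqrt (2 / pi)"
  using integral_std_normal_moment_abs_odd[of 0]
  by (simp add: smoothed_abs_def abs_mult integral_density)

lemma smoothed_abs_lipschitz: "\<bar>smoothed_abs \<sigma> c - smoothed_abs \<sigma> c'\<bar> \<le> \<bar>c - c'\<bar>"
proof -
  have "smoothed_abs \<sigma> a \<le> \<bar>a - b\<bar> + smoothed_abs \<sigma> b" for a b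
  proof -
    have "smoothed_abs \<sigma> a \<le> (\<integral>z. \<bar>a - b\<bar> + \<bar>b + \<sigma> * z\<bar> \<partial>std_normal)"
      unfolding smoothed_abs_def by (intro integral_mono) auto
    also have "\<dots> = \<bar>a - b\<bar> + smoothed_abs \<sigma> b"
      unfolding smoothed_abs_def by (subst Bochner_Integration.integral_add) (auto simp: std_normal.prob_space[simplified])
    finally show ?thesis .
  qed
  from this[of c c'] this[of c' c] show ?thesis by (simp add: abs_le_iff abs_minus_commute)
qed

lemma borel_measurable_smoothed_abs [measurable]: "smoothed_abs \<sigma> \<in> borel_measurable borel"
  unfolding smoothed_abs_def by measurable

text \<open>Averaging over further independent Gaussians only adds variance, so conditional means of
  \<open>smoothed_abs\<close> stay in the same family. This is what allows the stages to be
  chained.\<close>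

lemma smoothed_abs_linear:
  assumes "finite J"
  shows "has_bochner_integral (Pi\<^sub>M J (\<lambda>_. std_normal)) (\<lambda>y. smoothed_abs \<sigma> (c + (\<Sum>i\<in>J. \<alpha> i * y i)))
    (smoothed_abs (sqrt (\<sigma>\<^sup>2 + (\<Sum>i\<in>J. (\<alpha> i)\<^sup>2))) c)"
proof (rule has_bochner_integral_nn_integral)
  show "(\<integral>\<^sup>+y. smoothed_abs \<sigma> (c + (\<Sum>i\<in>J. \<alpha> i * y i)) \<partial>Pi\<^sub>M J (\<lambda>_. std_normal))
     = ennreal (smoothed_abs (sqrt (\<sigma>\<^sup>2 + (\<Sum>i\<in>J. (\<alpha> i)\<^sup>2))) c)"
    using nn_integral_std_normals_linear[OF assms, of "\<lambda>u. ennreal \<bar>c + u\<bar>" \<alpha> \<sigma>]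
    by (simp add: nn_integral_smoothed_abs add.assoc[symmetric])
qed (use assms in auto)

section \<open>Uniform estimates over a grid\<close>

text \<open>The entropy count of the union bound: a sparse function is recorded by a list of exactly
  \<open>K\<close> pairs of a position and a value, and vanishes at the positions not
  listed.\<close>

lemma card_sparse_functions:
  fixes G :: "real set" and K :: nat
  assumes G: "finite G" and D: "0 < D"
  defines "U \<equiv> {u :: nat \<Rightarrow> real. (\<forall>i<D. u i \<in> G) \<and> (\<forall>i\<ge>D. u i = 0) \<and> card {i. u i \<noteq> 0} \<le> K}"
  shows "finite U" and "card U \<le> (D * card G) ^ K"
proof -
  let ?f = "\<lambda>xs i. case map_of xs i of None \<Rightarrow> 0 | Some v \<Rightarrow> (v :: real)"
  let ?L = "{xs :: (nat \<times> real) list. set xs \<subseteq> {..<D} \<times> G \<and> length xs = K}"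
  have "U \<subseteq> ?f ` ?L"
  proof
    fix u assume "u \<in> U"
    then have u: "\<And>i. i < D \<Longrightarrow> u i \<in> G" "\<And>i. D \<le> i \<Longrightarrow> u i = 0" "card {i. u i \<noteq> 0} \<le> K"
      by (auto simp: U_def)
    have sub: "{i. u i \<noteq> 0} \<subseteq> {..<D}" using u(2) by (force simp: not_less[symmetric])
    then have fin: "finite {i. u i \<noteq> 0}" using finite_subset by blast
    \<comment> \<open>Position 0, paired with its true value \<open>u 0\<close>, pads the list to
      length exactly \<open>K\<close>; it is a legal position because \<open>0 < D\<close>.\<close>
    define js where "js = sorted_list_of_set {i. u i \<noteq> 0} @ replicate (K - card {i. u i \<noteq> 0}) 0"
    have js: "{i. u i \<noteq> 0} \<subseteq> set js" "set js \<subseteq> {..<D}" "length js = K"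
      using fin sub D u(3) by (auto simp: js_def)
    have "u = ?f (map (\<lambda>i. (i, u i)) js)"
      using js(1) by (auto simp: map_of_map_restrict restrict_map_def fun_eq_iff)
    moreover have "map (\<lambda>i. (i, u i)) js \<in> ?L"
      using js u(1) by auto
    ultimately show "u \<in> ?f ` ?L" by (rule image_eqI)
  qed
  moreover have "finite ?L" "card ?L = (D * card G) ^ K"
    using G by (simp_all add: finite_lists_length_eq card_lists_length_eq)
  ultimately show "finite U" "card U \<le> (D * card G) ^ K"
    using finite_surj[of ?L U ?f] surj_card_le[of ?L U ?f] by auto
qed

lemma exp_minus_le_half_power: "real n \<le> x \<Longrightarrow> exp (- x) \<le> (1 / 2) ^ n"
proof -
  assume "real n \<le> x"
  have "(2::real) ^ n \<le> exp 1 ^ n"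
    using exp_ge_add_one_self[of 1] by (intro power_mono) auto
  also have "\<dots> \<le> exp x"
    using \<open>real n \<le> x\<close> by (simp add: exp_of_nat_mult[symmetric])
  finally show ?thesis
    by (simp add: exp_minus power_divide inverse_eq_divide divide_simps)
qed

text \<open>Index \<open>i\<close> stands for the Gaussian of column \<open>i mod D\<close> in copy
  \<open>i div D\<close>. Two properties of the transform suffice: by \<open>col\<close>, every
  coordinate of the sketch of \<open>w\<close> has variance equal to the squared norm of
  \<open>w\<close>, and \<open>op\<close> bounds the squared operator norm by
  \<open>D\<close>.\<close>

locale gaussian_sketch =
  fixes m D :: nat and \<alpha> :: "nat \<Rightarrow> nat \<Rightarrow> real"
  assumes m: "0 < m" and D: "0 < D"
    and col: "\<And>e l. e < m * D \<Longrightarrow> l < D \<Longrightarrow> (\<Sum>i | i < m * D \<and> i mod D = l. (\<alpha> e i)\<^sup>2) = 1"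
    and op: "\<And>z. (\<Sum>e<m * D. (\<Sum>i<m * D. \<alpha> e i * z i)\<^sup>2) \<le> real D * (\<Sum>i<m * D. (z i)\<^sup>2)"
begin

definition coord :: "(nat \<Rightarrow> real) \<Rightarrow> (nat \<Rightarrow> real) \<Rightarrow> nat \<Rightarrow> real" where
  "coord x w e = (\<Sum>i<m * D. \<alpha> e i * (x i * w (i mod D)))"

definition mean_abs :: "real \<Rightarrow> (nat \<Rightarrow> real) \<Rightarrow> (nat \<Rightarrow> real) \<Rightarrow> real" where
  "mean_abs \<sigma> w x = (\<Sum>e<m * D. smoothed_abs \<sigma> (coord x w e)) / real (m * D)"

abbreviation gaussians :: "(nat \<Rightarrow> real) measure" where
  "gaussians \<equiv> Pi\<^sub>M {..<m * D} (\<lambda>_. std_normal)"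

lemma mD: "0 < real (m * D)"
  using m D by simp

text \<open>Cauchy-Schwarz over the \<open>m * D\<close> rows: the factor \<open>D\<close> of
  \<open>op\<close> cancels against the number of rows, and a gain of \<open>1 / sqrt m\<close>
  remains. This is the source of every Lipschitz constant below.\<close>

lemma mean_linear_le:
  "(\<Sum>e<m * D. \<bar>\<Sum>i<m * D. \<alpha> e i * z i\<bar>) / real (m * D) \<le> sqrt ((\<Sum>i<m * D. (z i)\<^sup>2) / real m)"
proof -
  let ?a = "\<lambda>e. \<Sum>i<m * D. \<alpha> e i * z i"
  have "(\<Sum>e<m * D. \<bar>?a e\<bar> * \<bar>1\<bar>) \<le> L2_set ?a {..<m * D} * L2_set (\<lambda>_. 1) {..<m * D}"
    by (rule L2_set_mult_ineq)
  also have "\<dots> \<le> sqrt (real D * (\<Sum>i<m * D. (z i)\<^sup>2)) * sqrt (real (m * D))"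
  proof -
    have "0 \<le> real D * (\<Sum>i<m * D. (z i)\<^sup>2)"
      by (intro mult_nonneg_nonneg sum_nonneg) auto
    then show ?thesis
      unfolding L2_set_def using op[of z] by (intro mult_mono) auto
  qed
  finally have "(\<Sum>e<m * D. \<bar>?a e\<bar>) / real (m * D)
      \<le> sqrt (real D * (\<Sum>i<m * D. (z i)\<^sup>2)) * sqrt (real (m * D)) / real (m * D)"
    using mD by (intro divide_right_mono) auto
  also have "\<dots> = sqrt (real D * (\<Sum>i<m * D. (z i)\<^sup>2)) / sqrt (real (m * D))"
  proof -
    define r where "r = sqrt (real (m * D))"
    have r: "real (m * D) = r * r" "0 < r"
      using mD by (simp_all add: r_def del: of_nat_mult)
    show ?thesis unfolding r_def[symmetric] unfolding r(1) using r(2) by simp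
  qed
  also have "\<dots> = sqrt ((\<Sum>i<m * D. (z i)\<^sup>2) / real m)"
    using D by (simp add: real_sqrt_divide[symmetric])
  finally show ?thesis .
qed

lemma mean_sq_le:
  "(\<Sum>e<m * D. (coord x v e)\<^sup>2) / real (m * D) \<le> (\<Sum>i<m * D. (x i * v (i mod D))\<^sup>2) / real m"
  using op[of "\<lambda>i. x i * v (i mod D)"] D m
  by (simp add: coord_def field_simps)

lemma mean_abs_diff_le:
  assumes "\<And>e. e < m * D \<Longrightarrow> coord x w e - coord y v e = (\<Sum>i<m * D. \<alpha> e i * z i)"
  shows "\<bar>mean_abs \<sigma> w x - mean_abs \<sigma> v y\<bar> \<le> sqrt ((\<Sum>i<m * D. (z i)\<^sup>2) / real m)"
proof -
  have "\<bar>mean_abs \<sigma> w x - mean_abs \<sigma> v y\<bar> =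
      \<bar>\<Sum>e<m * D. smoothed_abs \<sigma> (coord x w e) - smoothed_abs \<sigma> (coord y v e)\<bar> / real (m * D)"
    using mD by (simp add: mean_abs_def sum_subtractf diff_divide_distrib[symmetric])
  also have "\<dots> \<le> (\<Sum>e<m * D. \<bar>coord x w e - coord y v e\<bar>) / real (m * D)"
    using mD by (intro divide_right_mono order_trans[OF sum_abs sum_mono[OF smoothed_abs_lipschitz]]) auto
  also have "\<dots> = (\<Sum>e<m * D. \<bar>\<Sum>i<m * D. \<alpha> e i * z i\<bar>) / real (m * D)"
    using assms by (intro arg_cong2[where f = "(/)"] sum.cong) auto
  also have "\<dots> \<le> sqrt ((\<Sum>i<m * D. (z i)\<^sup>2) / real m)"
    by (rule mean_linear_le)
  finally show ?thesis .
qed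

lemma measurable_mean_abs [measurable]: "mean_abs \<sigma> w \<in> borel_measurable (Pi\<^sub>M {..<m * D} (\<lambda>_. borel))"
  unfolding mean_abs_def[abs_def] coord_def by measurable

text \<open>
  Conditionally on the Gaussians of the columns outside \<open>S\<close>, the average is a Lipschitz function of the
  remaining ones, and its conditional mean is the average with these columns smoothed out.
\<close>

lemma smoothing_step_mgf:
  fixes \<sigma> :: real and u :: "nat \<Rightarrow> real"
  assumes S: "S \<subseteq> {..<D}" and a: "0 \<le> a" "\<And>l. l \<in> S \<Longrightarrow> \<bar>u l\<bar> \<le> a"
  defines "\<sigma>' \<equiv> sqrt (\<sigma>\<^sup>2 + (\<Sum>l\<in>S. (u l)\<^sup>2))" and "u' \<equiv> \<lambda>l. if l \<in> S then 0 else u l"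
  shows "(\<integral>\<^sup>+x. exp (t * (mean_abs \<sigma> u x - mean_abs \<sigma>' u' x)) \<partial>gaussians) \<le> exp (t\<^sup>2 * (a\<^sup>2 / real m))"
proof -
  define J where "J = {i. i < m * D \<and> i mod D \<in> S}"
  define I where "I = {..<m * D} - J"
  have IJ: "I \<union> J = {..<m * D}" "I \<inter> J = {}" "finite I" "finite J"
    by (auto simp: I_def J_def)
  let ?P = "\<lambda>I. Pi\<^sub>M I (\<lambda>_::nat. std_normal)"
  have finS: "finite S" using S finite_subset by blast
  define \<beta> where "\<beta> e i = \<alpha> e i * u (i mod D)" for e i
  have Y: "coord (merge I J (x, y)) u e = coord x u' e + (\<Sum>i\<in>J. \<beta> e i * y i)"
    and Y': "coord (merge I J (x, y)) u' e = coord x u' e" for x y e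
  proof -
    have "coord (merge I J (x, y)) u e = (\<Sum>i\<in>I. \<alpha> e i * (x i * u (i mod D))) + (\<Sum>i\<in>J. \<beta> e i * y i)"
      unfolding coord_def IJ(1)[symmetric] using IJ(2-)
      by (subst sum.union_disjoint) (auto intro!: arg_cong2[where f = "(+)"] sum.cong simp: \<beta>_def)
    moreover have "coord x' u' e = (\<Sum>i\<in>I. \<alpha> e i * (x' i * u (i mod D)))" for x'
      unfolding coord_def by (rule sum.mono_neutral_cong_right) (auto simp: I_def J_def u'_def)
    ultimately show "coord (merge I J (x, y)) u e = coord x u' e + (\<Sum>i\<in>J. \<beta> e i * y i)"
      "coord (merge I J (x, y)) u' e = coord x u' e"
      using IJ by (auto intro!: sum.cong)
  qed
  \<comment> \<open>The column sums are the same in every row, so a single \<open>\<sigma>'\<close>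
    serves all coordinates.\<close>
  have var: "(\<Sum>i\<in>J. (\<beta> e i)\<^sup>2) = (\<Sum>l\<in>S. (u l)\<^sup>2)" if "e < m * D" for e
  proof -
    have "(\<Sum>i\<in>J. (\<beta> e i)\<^sup>2) = (\<Sum>l\<in>S. \<Sum>i\<in>{i \<in> J. i mod D = l}. (\<beta> e i)\<^sup>2)"
      by (rule sum.group[symmetric]) (use finS in \<open>auto simp: J_def\<close>)
    also have "\<dots> = (\<Sum>l\<in>S. \<Sum>i | i < m * D \<and> i mod D = l. (\<alpha> e i)\<^sup>2 * (u l)\<^sup>2)"
      by (intro sum.cong refl) (auto simp: J_def \<beta>_def power_mult_distrib)
    also have "\<dots> = (\<Sum>l\<in>S. (u l)\<^sup>2)"
      using S col[OF that] by (intro sum.cong) (auto simp: sum_distrib_right[symmetric])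
    finally show ?thesis .
  qed
  have inner: "(\<integral>\<^sup>+y. exp (t * (mean_abs \<sigma> u (merge I J (x, y)) - mean_abs \<sigma>' u' (merge I J (x, y)))) \<partial>?P J)
      \<le> exp (t\<^sup>2 * (a\<^sup>2 / real m))" for x
  proof -
    define \<phi> where "\<phi> y = (\<Sum>e<m * D. smoothed_abs \<sigma> (coord x u' e + (\<Sum>i\<in>J. \<beta> e i * y i))) / real (m * D)" for y
    have "has_bochner_integral (?P J) \<phi> ((\<Sum>e<m * D. smoothed_abs \<sigma>' (coord x u' e)) / real (m * D))"
      unfolding \<phi>_def
    proof (intro has_bochner_integral_divide_zero has_bochner_integral_sum)
      fix e assume "e \<in> {..<m * D}"
      then show "has_bochner_integral (?P J) (\<lambda>y. smoothed_abs \<sigma> (coord x u' e + (\<Sum>i\<in>J. \<beta> e i * y i)))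
          (smoothed_abs \<sigma>' (coord x u' e))"
        using smoothed_abs_linear[OF IJ(4), of \<sigma> "coord x u' e" "\<beta> e"] var[of e] by (simp add: \<sigma>'_def)
    qed
    then have int: "integrable (?P J) \<phi>" "(\<integral>y. \<phi> y \<partial>?P J) = mean_abs \<sigma>' u' x"
      by (auto simp: has_bochner_integral_iff mean_abs_def)
    have "(\<integral>\<^sup>+y. exp (t * (\<phi> y - mean_abs \<sigma>' u' x)) \<partial>?P J) \<le> exp (t\<^sup>2 * (a / sqrt (real m))\<^sup>2)"
    proof (rule gaussian_concentration_mgf[OF IJ(4) _ _ _ int])
      show "0 \<le> a / sqrt (real m)" using a by simp
      show "\<phi> \<in> borel_measurable (Pi\<^sub>M J (\<lambda>_. borel))"
        unfolding \<phi>_def by measurable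
      fix y y'
      \<comment> \<open>The perturbation as \<open>\<alpha>\<close> sees it: a change of the
        Gaussian \<open>i\<close> is multiplied by \<open>u (i mod D)\<close>, of size at most
        \<open>a\<close>, hence the Lipschitz constant \<open>a / sqrt m\<close>.\<close>
      define z where "z i = (if i \<in> J then (y i - y' i) * u (i mod D) else 0)" for i
      have "(\<Sum>i\<in>J. \<beta> e i * y i) - (\<Sum>i\<in>J. \<beta> e i * y' i) = (\<Sum>i<m * D. \<alpha> e i * z i)" for e
        unfolding sum_subtractf[symmetric]
        by (rule sum.mono_neutral_cong_left) (auto simp: J_def z_def \<beta>_def algebra_simps)
      then have "\<bar>mean_abs \<sigma> u (merge I J (x, y)) - mean_abs \<sigma> u (merge I J (x, y'))\<bar> \<le> sqrt ((\<Sum>i<m * D. (z i)\<^sup>2) / real m)"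
        by (intro mean_abs_diff_le) (simp add: Y)
      also have "(\<Sum>i<m * D. (z i)\<^sup>2) = (\<Sum>i\<in>J. (z i)\<^sup>2)"
        by (rule sum.mono_neutral_right) (auto simp: J_def z_def)
      also have "\<dots> \<le> (\<Sum>i\<in>J. a\<^sup>2 * (y i - y' i)\<^sup>2)"
      proof (rule sum_mono)
        fix i assume "i \<in> J"
        then have "(u (i mod D))\<^sup>2 \<le> a\<^sup>2"
          using a by (auto simp: J_def abs_le_square_iff[symmetric])
        then show "(z i)\<^sup>2 \<le> a\<^sup>2 * (y i - y' i)\<^sup>2"
          using \<open>i \<in> J\<close> by (simp add: z_def power_mult_distrib mult.commute[of "(y i - y' i)\<^sup>2"] mult_right_mono)
      qed
      also have "sqrt ((\<Sum>i\<in>J. a\<^sup>2 * (y i - y' i)\<^sup>2) / real m) = a / sqrt (real m) * L2_set (\<lambda>i. y i - y' i) J"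
        using a by (simp add: L2_set_def sum_distrib_left[symmetric] real_sqrt_mult real_sqrt_divide)
      finally show "\<bar>\<phi> y - \<phi> y'\<bar> \<le> a / sqrt (real m) * L2_set (\<lambda>i. y i - y' i) J"
        by (simp add: mean_abs_def Y \<phi>_def divide_right_mono)
    qed
    then show ?thesis
      by (simp add: mean_abs_def Y Y' \<phi>_def power_divide)
  qed
  have "(\<integral>\<^sup>+x. exp (t * (mean_abs \<sigma> u x - mean_abs \<sigma>' u' x)) \<partial>gaussians)
      = (\<integral>\<^sup>+x. \<integral>\<^sup>+y. exp (t * (mean_abs \<sigma> u (merge I J (x, y)) - mean_abs \<sigma>' u' (merge I J (x, y)))) \<partial>?P J \<partial>?P I)"
    unfolding IJ(1)[symmetric]
    by (rule std_normals.product_nn_integral_fold[OF IJ(2-)]) (unfold IJ(1), measurable)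
  also have "\<dots> \<le> (\<integral>\<^sup>+x. exp (t\<^sup>2 * (a\<^sup>2 / real m)) \<partial>?P I)"
    by (intro nn_integral_mono inner)
  also have "\<dots> = exp (t\<^sup>2 * (a\<^sup>2 / real m))"
    by (simp add: prob_space.emeasure_space_1[OF prob_space_PiM[OF prob_space_std_normal]])
  finally show ?thesis .
qed

lemma smoothing_step_tail:
  fixes \<sigma> :: real and u :: "nat \<Rightarrow> real"
  assumes S: "S \<subseteq> {..<D}" and a: "0 < a" "\<And>l. l \<in> S \<Longrightarrow> \<bar>u l\<bar> \<le> a" and s: "0 \<le> s"
  defines "\<sigma>' \<equiv> sqrt (\<sigma>\<^sup>2 + (\<Sum>l\<in>S. (u l)\<^sup>2))" and "u' \<equiv> \<lambda>l. if l \<in> S then 0 else u l"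
  shows "measure gaussians {x \<in> space gaussians. s \<le> \<bar>mean_abs \<sigma> u x - mean_abs \<sigma>' u' x\<bar>}
    \<le> 2 * exp (- s\<^sup>2 * real m / (4 * a\<^sup>2))"
proof -
  have "measure gaussians {x \<in> space gaussians. s \<le> \<bar>mean_abs \<sigma> u x - mean_abs \<sigma>' u' x\<bar>}
      \<le> 2 * exp (- s\<^sup>2 / (4 * (a\<^sup>2 / real m)))"
    unfolding \<sigma>'_def u'_def
    by (rule subgaussian_tail[OF prob_space_PiM[OF prob_space_std_normal] _ smoothing_step_mgf])
       (use assms m in \<open>auto\<close>)
  then show ?thesis by simp
qed


section \<open>Dyadic scales and the union bound over their states\<close>

definition large_part :: "nat \<Rightarrow> (nat \<Rightarrow> real) \<Rightarrow> nat \<Rightarrow> real" where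
  "large_part l w i = (if 1 / 2 ^ l < \<bar>w i\<bar> then w i else 0)"

definition small_norm :: "nat \<Rightarrow> (nat \<Rightarrow> real) \<Rightarrow> real" where
  "small_norm l w = sqrt (\<Sum>i<D. (if 1 / 2 ^ l < \<bar>w i\<bar> then 0 else (w i)\<^sup>2))"

definition small_set :: "nat \<Rightarrow> (nat \<Rightarrow> real) \<Rightarrow> nat set" where
  "small_set l w = {i. i < D \<and> \<bar>w i\<bar> \<le> 1 / 2 ^ l}"

definition dyadic :: "nat \<Rightarrow> (nat \<Rightarrow> real) \<Rightarrow> bool" where
  "dyadic \<Lambda> w \<longleftrightarrow> (\<forall>i. \<exists>z::int. w i = real_of_int z / 2 ^ \<Lambda>) \<and> (\<forall>i\<ge>D. w i = 0) \<and> (\<Sum>i<D. (w i)\<^sup>2) \<le> 1"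

definition dyadic_values :: "nat \<Rightarrow> real set" where
  "dyadic_values \<Lambda> = (\<lambda>z::int. real_of_int z / 2 ^ \<Lambda>) ` {- (2 ^ \<Lambda>)..2 ^ \<Lambda>}"

definition sparse_dyadic :: "nat \<Rightarrow> nat \<Rightarrow> (nat \<Rightarrow> real) set" where
  "sparse_dyadic \<Lambda> l = {u. (\<forall>i<D. u i \<in> dyadic_values \<Lambda>) \<and> (\<forall>i\<ge>D. u i = 0) \<and> card {i. u i \<noteq> 0} \<le> 4 ^ Suc l}"

text \<open>A state of the chaining consists of a sparse vector and of the norm of what has been
  smoothed out. On the grid the square of that norm is a multiple of \<open>4 ^ - \<Lambda>\<close>,
  so the union bound over the second component is finite as well.\<close>

definition dyadic_norms :: "nat \<Rightarrow> real set" where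
  "dyadic_norms \<Lambda> = (\<lambda>k. sqrt (real k / 4 ^ \<Lambda>)) ` {..4 ^ \<Lambda>}"

text \<open>The nonzero entries of \<open>u\<close> selected by \<open>small_set l u\<close> form
  one dyadic layer, between \<open>2 ^ - Suc l\<close> and \<open>2 ^ - l\<close>; its zero entries
  contribute nothing. Smoothing this set out turns the state at \<open>Suc l\<close> into the state
  at \<open>l\<close>.\<close>

lemma large_part_Suc:
  fixes l :: nat
  assumes "\<And>i. D \<le> i \<Longrightarrow> w i = 0"
  defines "u \<equiv> large_part (Suc l) w"
  shows "(\<lambda>i. if i \<in> small_set l u then 0 else u i) = large_part l w"
    and "sqrt ((small_norm (Suc l) w)\<^sup>2 + (\<Sum>i\<in>small_set l u. (u i)\<^sup>2)) = small_norm l w"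
proof -
  have half: "(1::real) / 2 ^ Suc l \<le> 1 / 2 ^ l" by (simp add: field_simps)
  show "(\<lambda>i. if i \<in> small_set l u then 0 else u i) = large_part l w"
    using half assms(1) by (intro ext) (force simp: u_def small_set_def large_part_def not_less)
  have "(\<Sum>i\<in>small_set l u. (u i)\<^sup>2) = (\<Sum>i<D. if \<bar>u i\<bar> \<le> 1 / 2 ^ l then (u i)\<^sup>2 else 0)"
    unfolding small_set_def by (rule sum.mono_neutral_cong_left) auto
  then have "(small_norm (Suc l) w)\<^sup>2 + (\<Sum>i\<in>small_set l u. (u i)\<^sup>2)
      = (\<Sum>i<D. (if 1 / 2 ^ Suc l < \<bar>w i\<bar> then 0 else (w i)\<^sup>2) + (if \<bar>u i\<bar> \<le> 1 / 2 ^ l then (u i)\<^sup>2 else 0))"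
    by (simp add: small_norm_def sum_nonneg sum.distrib)
  also have "\<dots> = (\<Sum>i<D. if 1 / 2 ^ l < \<bar>w i\<bar> then 0 else (w i)\<^sup>2)"
    using half by (intro sum.cong) (auto simp: u_def large_part_def)
  finally show "sqrt ((small_norm (Suc l) w)\<^sup>2 + (\<Sum>i\<in>small_set l u. (u i)\<^sup>2)) = small_norm l w"
    by (simp add: small_norm_def)
qed

lemma dyadic_abs_le_1:
  assumes "dyadic \<Lambda> w"
  shows "\<bar>w i\<bar> \<le> 1"
proof (cases "i < D")
  case True
  then have "(w i)\<^sup>2 \<le> (\<Sum>i<D. (w i)\<^sup>2)"
    by (intro member_le_sum) auto
  then have "(w i)\<^sup>2 \<le> 1"
    using assms by (simp add: dyadic_def)
  then show ?thesis by (simp add: abs_square_le_1)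
qed (use assms in \<open>auto simp: dyadic_def\<close>)

lemma dyadic_values_dyadic:
  assumes "dyadic \<Lambda> w"
  shows "w i \<in> dyadic_values \<Lambda>"
proof -
  obtain z :: int where z: "w i = real_of_int z / 2 ^ \<Lambda>"
    using assms by (auto simp: dyadic_def)
  then have "\<bar>real_of_int z\<bar> \<le> 2 ^ \<Lambda>"
    using dyadic_abs_le_1[OF assms, of i] by (simp add: abs_divide pos_divide_le_eq)
  then have "\<bar>z\<bar> \<le> 2 ^ \<Lambda>"
    by (metis of_int_abs of_int_le_iff of_int_numeral of_int_power)
  then show ?thesis
    using z by (auto simp: dyadic_values_def abs_le_iff)
qed

text \<open>Every entry counted exceeds \<open>2 ^ - Suc l\<close> and so takes more than
  \<open>4 ^ - Suc l\<close> of the squared norm, which is at most 1.\<close>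

lemma large_part_sparse:
  assumes w: "dyadic \<Lambda> w"
  shows "large_part (Suc l) w \<in> sparse_dyadic \<Lambda> l"
proof -
  let ?u = "large_part (Suc l) w"
  let ?A = "{i. ?u i \<noteq> 0}"
  have A: "?A \<subseteq> {..<D}"
    using w by (force simp: large_part_def dyadic_def not_less[symmetric])
  then have fin: "finite ?A" using finite_subset by blast
  have "real (card ?A) * (1 / 4 ^ Suc l) = (\<Sum>i\<in>?A. 1 / 4 ^ Suc l)"
    by simp
  also have "\<dots> \<le> (\<Sum>i\<in>?A. (w i)\<^sup>2)"
  proof (rule sum_mono)
    fix i assume "i \<in> ?A"
    then have "1 / 2 ^ Suc l < \<bar>w i\<bar>" by (simp add: large_part_def split: if_splits)
    then have "(1 / 2 ^ Suc l)\<^sup>2 \<le> \<bar>w i\<bar>\<^sup>2" by (intro power_mono) auto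
    moreover have "(1 / 2 ^ Suc l)\<^sup>2 = (1 / 4 ^ Suc l :: real)"
      by (simp add: power2_eq_square power_mult_distrib[symmetric] del: power_Suc)
    ultimately show "1 / 4 ^ Suc l \<le> (w i)\<^sup>2" by simp
  qed
  also have "\<dots> \<le> (\<Sum>i<D. (w i)\<^sup>2)"
    using A by (intro sum_mono2) auto
  also have "\<dots> \<le> 1" using w by (simp add: dyadic_def)
  finally have "real (card ?A) \<le> real (4 ^ Suc l)"
    by (simp add: field_simps)
  then have "card ?A \<le> 4 ^ Suc l" by (simp only: of_nat_le_iff)
  moreover have "0 \<in> dyadic_values \<Lambda>"
    by (auto simp: dyadic_values_def)
  ultimately show ?thesis
    using dyadic_values_dyadic[OF w] w by (auto simp: sparse_dyadic_def large_part_def dyadic_def)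
qed

lemma small_norm_dyadic:
  assumes w: "dyadic \<Lambda> w"
  shows "small_norm l w \<in> dyadic_norms \<Lambda>"
proof -
  obtain z :: "nat \<Rightarrow> int" where z: "\<And>i. w i = real_of_int (z i) / 2 ^ \<Lambda>"
    using w unfolding dyadic_def by metis
  define Z where "Z = (\<Sum>i<D. if 1 / 2 ^ l < \<bar>w i\<bar> then 0 else (z i)\<^sup>2)"
  have four: "(2::real) ^ \<Lambda> * 2 ^ \<Lambda> = 4 ^ \<Lambda>"
    by (simp add: power_mult_distrib[symmetric])
  have eq: "(\<Sum>i<D. if 1 / 2 ^ l < \<bar>w i\<bar> then 0 else (w i)\<^sup>2) = real_of_int Z / 4 ^ \<Lambda>"
    unfolding Z_def of_int_sum sum_divide_distrib
    by (intro sum.cong refl) (simp add: z power_divide power2_eq_square four)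
  have "(\<Sum>i<D. if 1 / 2 ^ l < \<bar>w i\<bar> then 0 else (w i)\<^sup>2) \<le> (\<Sum>i<D. (w i)\<^sup>2)"
    by (intro sum_mono) auto
  moreover have "(\<Sum>i<D. (w i)\<^sup>2) \<le> 1"
    using w by (simp add: dyadic_def)
  ultimately have "real_of_int Z / 4 ^ \<Lambda> \<le> 1"
    unfolding eq by linarith
  then have "real_of_int Z \<le> real_of_int (4 ^ \<Lambda>)"
    by (simp add: field_simps)
  then have "Z \<le> 4 ^ \<Lambda>"
    by (simp only: of_int_le_iff)
  moreover have "0 \<le> Z" by (simp add: Z_def sum_nonneg)
  ultimately have "nat Z \<le> 4 ^ \<Lambda>" "real (nat Z) = real_of_int Z"
    by (simp_all add: nat_le_iff)
  then show ?thesis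
    unfolding small_norm_def eq dyadic_norms_def by (intro image_eqI[of _ _ "nat Z"]) auto
qed

lemma card_sparse_dyadic:
  assumes "D \<le> 2 ^ \<Lambda>"
  shows "finite (sparse_dyadic \<Lambda> l)" and "real (card (sparse_dyadic \<Lambda> l)) \<le> 2 ^ ((2 * \<Lambda> + 2) * 4 ^ Suc l)"
proof -
  have fin: "finite (dyadic_values \<Lambda>)" by (simp add: dyadic_values_def)
  show "finite (sparse_dyadic \<Lambda> l)"
    unfolding sparse_dyadic_def by (rule card_sparse_functions(1)[OF fin D])
  have "card (dyadic_values \<Lambda>) \<le> card {- (2 ^ \<Lambda>)..2 ^ \<Lambda>::int}"
    unfolding dyadic_values_def by (rule card_image_le) simp
  also have "\<dots> = nat (2 * 2 ^ \<Lambda> + 1)" by simp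
  also have "\<dots> \<le> nat (4 * 2 ^ \<Lambda>)"
    using one_le_power[of "2::int" \<Lambda>] by (intro nat_mono) linarith
  also have "\<dots> = 2 ^ (\<Lambda> + 2)" by (simp add: nat_mult_distrib nat_power_eq power_add)
  finally have G: "card (dyadic_values \<Lambda>) \<le> 2 ^ (\<Lambda> + 2)" .
  have "card (sparse_dyadic \<Lambda> l) \<le> (D * card (dyadic_values \<Lambda>)) ^ 4 ^ Suc l"
    unfolding sparse_dyadic_def by (rule card_sparse_functions(2)[OF fin D])
  also have "\<dots> \<le> (2 ^ \<Lambda> * 2 ^ (\<Lambda> + 2)) ^ 4 ^ Suc l"
    using assms G by (intro power_mono mult_mono) auto
  also have "\<dots> = (2::nat) ^ ((2 * \<Lambda> + 2) * 4 ^ Suc l)"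
  proof -
    have "(2::nat) ^ \<Lambda> * 2 ^ (\<Lambda> + 2) = 2 ^ (2 * \<Lambda> + 2)"
    proof -
      have "2 * \<Lambda> + 2 = \<Lambda> + (\<Lambda> + 2)" by simp
      then show ?thesis by (simp only: power_add)
    qed
    then show ?thesis by (simp only: power_mult)
  qed
  finally have "real (card (sparse_dyadic \<Lambda> l)) \<le> real (2 ^ ((2 * \<Lambda> + 2) * 4 ^ Suc l))"
    by (simp only: of_nat_le_iff)
  then show "real (card (sparse_dyadic \<Lambda> l)) \<le> 2 ^ ((2 * \<Lambda> + 2) * 4 ^ Suc l)"
    by simp
qed

text \<open>Chaining over the scales. At scale \<open>l\<close> there are at most
  \<open>2 ^ ((10 * \<Lambda> + 10) * 4 ^ l)\<close> states, up to a factor 2, while the tail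
  exponent is \<open>(11 * \<Lambda> + 10 + c) * 4 ^ l\<close>. Of the surplus
  \<open>\<Lambda> + c\<close>, the part \<open>\<Lambda>\<close> pays for the
  \<open>\<Lambda> + 1\<close> scales and \<open>c\<close> is the final confidence.\<close>

lemma mean_abs_dyadic_uniform:
  assumes D2: "D \<le> 2 ^ \<Lambda>" and s: "0 \<le> s" "real (11 * \<Lambda> + 10 + c) \<le> s\<^sup>2 * real m / 4"
  obtains A where "A \<in> sets gaussians" "1 - (1 / 2) ^ c \<le> measure gaussians A"
    "\<And>x w. x \<in> A \<Longrightarrow> dyadic \<Lambda> w \<Longrightarrow>
       \<bar>mean_abs 0 w x - sqrt (2 / pi) * L2_set w {..<D}\<bar> \<le> real (\<Lambda> + 1) * s"
proof -
  define bad where "bad l u \<sigma> = {x \<in> space gaussians. s \<le> \<bar>mean_abs \<sigma> u x -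
     mean_abs (sqrt (\<sigma>\<^sup>2 + (\<Sum>i\<in>small_set l u. (u i)\<^sup>2))) (\<lambda>i. if i \<in> small_set l u then 0 else u i) x\<bar>}" for l u \<sigma>
  have P: "prob_space gaussians"
    by (rule prob_space_PiM[OF prob_space_std_normal])
  have [measurable]: "bad l u \<sigma> \<in> sets gaussians" for l u \<sigma>
    unfolding bad_def by measurable
  \<comment> \<open>The columns smoothed at scale \<open>l\<close> have entries at most
    \<open>2 ^ - l\<close>, whence the factor \<open>4 ^ l\<close> in the exponent.\<close>
  have tail: "measure gaussians (bad l u \<sigma>) \<le> 2 * (1 / 2) ^ ((11 * \<Lambda> + 10 + c) * 4 ^ l)" for l u \<sigma>
  proof -
    have "measure gaussians (bad l u \<sigma>) \<le> 2 * exp (- s\<^sup>2 * real m / (4 * (1 / 2 ^ l)\<^sup>2))"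
      unfolding bad_def by (rule smoothing_step_tail) (use s in \<open>auto simp: small_set_def\<close>)
    also have "- s\<^sup>2 * real m / (4 * (1 / 2 ^ l)\<^sup>2) = - (s\<^sup>2 * real m / 4 * 4 ^ l)"
      by (simp add: power_divide power2_eq_square[of "2 ^ l"] power_mult_distrib[symmetric])
    also have "exp \<dots> \<le> (1 / 2) ^ ((11 * \<Lambda> + 10 + c) * 4 ^ l)"
    proof (rule exp_minus_le_half_power)
      show "real ((11 * \<Lambda> + 10 + c) * 4 ^ l) \<le> s\<^sup>2 * real m / 4 * 4 ^ l"
        using mult_right_mono[OF s(2), of "4 ^ l"] by simp
    qed
    finally show ?thesis by simp
  qed
  define K where "K l = sparse_dyadic \<Lambda> l \<times> dyadic_norms \<Lambda>" for l
  have finK: "finite (K l)" for l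
    unfolding K_def by (intro finite_cartesian_product card_sparse_dyadic(1)[OF D2]) (simp add: dyadic_norms_def)
  have cardK: "real (card (K l)) * 2 \<le> 2 ^ ((10 * \<Lambda> + 10) * 4 ^ l)" for l
  proof -
    have "card (dyadic_norms \<Lambda>) \<le> card {..4 ^ \<Lambda>::nat}"
      unfolding dyadic_norms_def by (rule card_image_le) simp
    then have "real (card (dyadic_norms \<Lambda>)) * 2 \<le> (4 ^ \<Lambda> + 1) * 2"
      by (simp add: of_nat_le_iff[where 'a = real, symmetric])
    also have "\<dots> \<le> 4 * 4 ^ \<Lambda>" by simp
    also have "\<dots> = 2 ^ (2 * \<Lambda> + 2)" by (simp add: power_add power_mult)
    finally have "real (card (K l)) * 2 \<le> 2 ^ ((2 * \<Lambda> + 2) * 4 ^ Suc l) * 2 ^ (2 * \<Lambda> + 2)"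
      unfolding K_def card_cartesian_product of_nat_mult mult.assoc
      using card_sparse_dyadic(2)[OF D2, of l] by (intro mult_mono) auto
    also have "\<dots> = 2 ^ ((2 * \<Lambda> + 2) * (4 ^ Suc l + 1))"
      by (simp add: power_add[symmetric])
    also have "\<dots> \<le> (2::real) ^ ((2 * \<Lambda> + 2) * (5 * 4 ^ l))"
      by (intro power_increasing mult_left_mono) auto
    also have "(2 * \<Lambda> + 2) * (5 * 4 ^ l) = (10 * \<Lambda> + 10) * 4 ^ l"
      by (simp add: algebra_simps)
    finally show ?thesis .
  qed
  define B where "B = (\<Union>l\<in>{..\<Lambda>}. \<Union>(u, \<sigma>)\<in>K l. bad l u \<sigma>)"
  have [measurable]: "B \<in> sets gaussians"
    unfolding B_def using finK by (intro sets.finite_UN) auto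
  have "measure gaussians B \<le> (\<Sum>l\<le>\<Lambda>. measure gaussians (\<Union>(u, \<sigma>)\<in>K l. bad l u \<sigma>))"
    unfolding B_def using finK by (intro measure_UNION_le sets.finite_UN) auto
  also have "\<dots> \<le> (\<Sum>l\<le>\<Lambda>. (1 / 2) ^ (\<Lambda> + c))"
  proof (rule sum_mono)
    fix l assume "l \<in> {..\<Lambda>}"
    have "measure gaussians (\<Union>(u, \<sigma>)\<in>K l. bad l u \<sigma>) \<le> (\<Sum>(u, \<sigma>)\<in>K l. measure gaussians (bad l u \<sigma>))"
      using measure_UNION_le[OF finK, of l "\<lambda>(u, \<sigma>). bad l u \<sigma>" gaussians] by (simp add: case_prod_beta)
    also have "\<dots> \<le> (\<Sum>k\<in>K l. 2 * (1 / 2) ^ ((11 * \<Lambda> + 10 + c) * 4 ^ l))"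
      by (intro sum_mono) (use tail in \<open>auto\<close>)
    also have "\<dots> = real (card (K l)) * 2 * (1 / 2) ^ ((11 * \<Lambda> + 10 + c) * 4 ^ l)"
      by simp
    also have "\<dots> \<le> 2 ^ ((10 * \<Lambda> + 10) * 4 ^ l) * (1 / 2) ^ ((11 * \<Lambda> + 10 + c) * 4 ^ l)"
      by (intro mult_right_mono cardK) auto
    also have "(11 * \<Lambda> + 10 + c) * 4 ^ l = (10 * \<Lambda> + 10) * 4 ^ l + (\<Lambda> + c) * 4 ^ l"
      by (simp add: algebra_simps)
    also have "2 ^ ((10 * \<Lambda> + 10) * 4 ^ l) * (1 / 2) ^ \<dots> = ((1::real) / 2) ^ ((\<Lambda> + c) * 4 ^ l)"
      unfolding power_add mult.assoc[symmetric] power_mult_distrib[symmetric] by simp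
    also have "\<dots> \<le> (1 / 2) ^ (\<Lambda> + c)"
      by (intro power_decreasing) auto
    finally show "measure gaussians (\<Union>(u, \<sigma>)\<in>K l. bad l u \<sigma>) \<le> (1 / 2) ^ (\<Lambda> + c)" .
  qed
  also have "\<dots> = real (Suc \<Lambda>) / 2 ^ \<Lambda> * (1 / 2) ^ c"
    by (simp add: power_add power_divide)
  also have "\<dots> \<le> 1 * (1 / 2) ^ c"
  proof (rule mult_right_mono)
    have "Suc \<Lambda> \<le> 2 ^ \<Lambda>" by (simp add: Suc_leI)
    then have "real (Suc \<Lambda>) \<le> real (2 ^ \<Lambda>)" by (simp only: of_nat_le_iff)
    then show "real (Suc \<Lambda>) / 2 ^ \<Lambda> \<le> 1" by simp
  qed auto
  finally have B: "measure gaussians B \<le> (1 / 2) ^ c" by simp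
  show ?thesis
  proof (rule that[of "space gaussians - B"])
    show "1 - (1 / 2) ^ c \<le> measure gaussians (space gaussians - B)"
      using B prob_space.prob_compl[OF P, of B] by simp
    fix x w assume x: "x \<in> space gaussians - B" and w: "dyadic \<Lambda> w"
    have w0: "w i = 0" if "D \<le> i" for i using w that by (simp add: dyadic_def)
    \<comment> \<open>The telescoping path: at \<open>l = 0\<close> everything is smoothed, since
      all entries are at most 1, and at \<open>l = Suc \<Lambda>\<close> nothing is.\<close>
    define \<Psi> where "\<Psi> l = mean_abs (small_norm l w) (large_part l w) x" for l
    have step: "\<bar>\<Psi> (Suc l) - \<Psi> l\<bar> \<le> s" if "l \<le> \<Lambda>" for l
    proof -
      have "x \<notin> bad l (large_part (Suc l) w) (small_norm (Suc l) w)"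
        using x that large_part_sparse[OF w, of l] small_norm_dyadic[OF w, of "Suc l"]
        unfolding B_def K_def by blast
      then show ?thesis
        using x by (simp add: bad_def large_part_Suc[OF w0] \<Psi>_def)
    qed
    have "\<bar>\<Psi> l - \<Psi> 0\<bar> \<le> real l * s" if "l \<le> Suc \<Lambda>" for l
      using that
    proof (induction l)
      case (Suc l)
      then show ?case using step[of l] by (simp add: algebra_simps)
    qed simp
    from this[of "Suc \<Lambda>"] have "\<bar>\<Psi> (Suc \<Lambda>) - \<Psi> 0\<bar> \<le> real (\<Lambda> + 1) * s" by simp
    moreover have "\<Psi> 0 = sqrt (2 / pi) * L2_set w {..<D}"
    proof -
      have "large_part 0 w = (\<lambda>_. 0)" "small_norm 0 w = L2_set w {..<D}"
        using dyadic_abs_le_1[OF w] by (auto simp: large_part_def small_norm_def L2_set_def not_less[symmetric] intro!: sum.cong)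
      then show ?thesis
        using m D by (simp add: \<Psi>_def mean_abs_def coord_def smoothed_abs_at_0 mult.commute)
    qed
    \<comment> \<open>One scale beyond \<open>\<Lambda>\<close> is needed because
      \<open>large_part\<close> uses a strict comparison and a nonzero grid entry may equal
      \<open>2 ^ - \<Lambda>\<close> in size.\<close>
    moreover have "\<Psi> (Suc \<Lambda>) = mean_abs 0 w x"
    proof -
      have large: "1 / 2 ^ Suc \<Lambda> < \<bar>w i\<bar>" if "w i \<noteq> 0" for i
      proof -
        obtain z :: int where z: "w i = real_of_int z / 2 ^ \<Lambda>"
          using w by (auto simp: dyadic_def)
        with that have "1 \<le> \<bar>z\<bar>" by auto
        then have "1 \<le> \<bar>real_of_int z\<bar>" by linarith
        then have "1 / 2 ^ \<Lambda> \<le> \<bar>w i\<bar>" using z by (simp add: abs_divide divide_right_mono)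
        moreover have "(1::real) / 2 ^ Suc \<Lambda> < 1 / 2 ^ \<Lambda>" by (simp add: field_simps)
        ultimately show ?thesis by linarith
      qed
      have "large_part (Suc \<Lambda>) w = w"
        using large unfolding large_part_def by (intro ext) (auto simp del: power_Suc)
      moreover have "small_norm (Suc \<Lambda>) w = 0"
      proof -
        have "(if 1 / 2 ^ Suc \<Lambda> < \<bar>w i\<bar> then 0 else (w i)\<^sup>2) = 0" for i
          using large[of i] by (cases "w i = 0") (simp_all del: power_Suc)
        then show ?thesis unfolding small_norm_def by (simp only: sum.neutral_const real_sqrt_zero)
      qed
      ultimately show ?thesis by (simp add: \<Psi>_def)
    qed
    ultimately show "\<bar>mean_abs 0 w x - sqrt (2 / pi) * L2_set w {..<D}\<bar> \<le> real (\<Lambda> + 1) * s"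
      by simp
  qed simp
qed

end

section \<open>Uniform estimates over all vectors\<close>

definition clip :: "real \<Rightarrow> real \<Rightarrow> real" where
  "clip T x = max (- T) (min T x)"

text \<open>From \<open>(\<bar>x\<bar> - 2 * T)^2 \<ge> 0\<close> one gets
  \<open>\<bar>x\<bar> - T \<le> x^2 / (4 * T)\<close>. After squaring, the clipping error is
  controlled by a fourth moment, so that no Gaussian tail has to be integrated.\<close>

lemma clip_tail_le:
  assumes T: "0 < T"
  shows "(x - clip T x)\<^sup>2 \<le> x ^ 4 / (16 * T\<^sup>2)"
proof -
  have "\<bar>x - clip T x\<bar> \<le> x\<^sup>2 / (4 * T)"
  proof -
    have "4 * T * (\<bar>x\<bar> - T) \<le> x\<^sup>2"
      using zero_le_power2[of "\<bar>x\<bar> - 2 * T"] by (simp add: power2_diff power2_eq_square algebra_simps)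
    moreover have "\<bar>x - clip T x\<bar> = max 0 (\<bar>x\<bar> - T)"
      using T by (auto simp: clip_def max_def min_def)
    ultimately show ?thesis
      using T by (simp add: max_def pos_le_divide_eq mult.commute)
  qed
  then have "\<bar>x - clip T x\<bar>\<^sup>2 \<le> (x\<^sup>2 / (4 * T))\<^sup>2"
    by (intro power_mono) auto
  then show ?thesis
    by (simp add: power_divide power_mult_distrib)
qed

lemma abs_clip_le: "0 \<le> T \<Longrightarrow> \<bar>clip T x\<bar> \<le> T" "0 \<le> T \<Longrightarrow> \<bar>clip T x\<bar> \<le> \<bar>x\<bar>"
  by (auto simp: clip_def max_def min_def)

lemma clip_diff_lipschitz: "\<bar>(x - clip T x) - (y - clip T y)\<bar> \<le> \<bar>x - y\<bar>"
  by (auto simp: clip_def max_def min_def)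

lemma std_normal_moments:
  "has_bochner_integral std_normal (\<lambda>x. x\<^sup>2) 1" "has_bochner_integral std_normal (\<lambda>x. x ^ 4) 3"
  using std_normal_distribution_even_moments[of 1] std_normal_distribution_even_moments[of 2]
  by (simp_all add: has_bochner_integral_iff fact_numeral)

lemma has_bochner_integral_PiM_component:
  fixes f :: "real \<Rightarrow> real"
  assumes "i \<in> I" "has_bochner_integral std_normal f c"
  shows "has_bochner_integral (Pi\<^sub>M I (\<lambda>_. std_normal)) (\<lambda>x. f (x i)) c"
proof -
  have d: "distr (Pi\<^sub>M I (\<lambda>_. std_normal)) std_normal (\<lambda>x. x i) = std_normal"
    using assms(1) by (intro distr_PiM_component prob_space_std_normal)
  have "has_bochner_integral (distr (Pi\<^sub>M I (\<lambda>_. std_normal)) std_normal (\<lambda>x. x i)) f c"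
    unfolding d by fact
  moreover have "f \<in> borel_measurable std_normal" "(\<lambda>x. x i) \<in> measurable (Pi\<^sub>M I (\<lambda>_. std_normal)) std_normal"
    using assms by (auto dest: borel_measurable_has_bochner_integral)
  ultimately show ?thesis
    by (simp only: has_bochner_integral_iff integrable_distr_eq integral_distr)
qed

lemma card_residue_class:
  assumes "l < D"
  shows "card {i. i < m * D \<and> i mod D = l} = m"
proof -
  have "bij_betw (\<lambda>j. j * D + l) {..<m} {i. i < m * D \<and> i mod D = l}"
  proof (rule bij_betwI[of _ _ _ "\<lambda>i. i div D"])
    show "(\<lambda>j. j * D + l) \<in> {..<m} \<rightarrow> {i. i < m * D \<and> i mod D = l}"
    proof
      fix j assume "j \<in> {..<m}"
      then have "Suc j * D \<le> m * D" by (intro mult_right_mono) auto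
      then show "j * D + l \<in> {i. i < m * D \<and> i mod D = l}" using assms by auto
    qed
    show "(\<lambda>i. i div D) \<in> {i. i < m * D \<and> i mod D = l} \<rightarrow> {..<m}"
      by (auto simp: less_mult_imp_div_less)
  qed (use assms in auto)
  from bij_betw_same_card[OF this] show ?thesis by simp
qed

context gaussian_sketch
begin

section \<open>Column norms and the good event for the Gaussians\<close>

text \<open>The normalized column norm is Lipschitz with constant \<open>1 / sqrt m\<close>, since
  \<open>h\<close> and the Euclidean norm are 1-Lipschitz, and its mean is at most
  \<open>\<rho>\<close> by the second moment. It serves for the Gaussians themselves and for their
  clipping errors.\<close>

lemma column_tail:
  fixes h :: "real \<Rightarrow> real"
  assumes l: "l < D" and lip: "\<And>x y. \<bar>h x - h y\<bar> \<le> \<bar>x - y\<bar>"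
    and moment: "has_bochner_integral std_normal (\<lambda>x. (h x)\<^sup>2) c" "c \<le> \<rho>\<^sup>2" and \<rho>: "0 < \<rho>" and s: "0 \<le> s"
  shows "measure gaussians {x \<in> space gaussians. \<rho> + s \<le> sqrt ((\<Sum>i | i < m * D \<and> i mod D = l. (h (x i))\<^sup>2) / real m)}
    \<le> 2 * exp (- s\<^sup>2 * real m / 4)"
proof -
  let ?R = "{i. i < m * D \<and> i mod D = l}"
  define \<phi> where "\<phi> x = sqrt ((\<Sum>i\<in>?R. (h (x i))\<^sup>2) / real m)" for x
  define \<mu> where "\<mu> = (\<integral>x. \<phi> x \<partial>gaussians)"
  have P: "prob_space gaussians" by (rule prob_space_PiM[OF prob_space_std_normal])
  have cont: "continuous_on UNIV h"
    using lip by (intro lipschitz_on_continuous_on[of 1] lipschitz_onI) (auto simp: dist_real_def)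
  have [measurable]: "h \<in> borel_measurable borel"
    using cont by (rule borel_measurable_continuous_onI)
  have [measurable]: "(\<lambda>x. h (x i)) \<in> borel_measurable (Pi\<^sub>M {..<m * D} (\<lambda>_. borel))" if "i \<in> ?R" for i
    using that by (intro measurable_compose[OF measurable_component_singleton]) auto
  have [measurable]: "\<phi> \<in> borel_measurable (Pi\<^sub>M {..<m * D} (\<lambda>_. borel))"
    unfolding \<phi>_def by measurable
  have sq: "has_bochner_integral gaussians (\<lambda>x. (\<phi> x)\<^sup>2) c"
  proof -
    have "has_bochner_integral gaussians (\<lambda>x. (\<Sum>i\<in>?R. (h (x i))\<^sup>2) / real m) ((\<Sum>i\<in>?R. c) / real m)"
      by (intro has_bochner_integral_divide_zero has_bochner_integral_sum has_bochner_integral_PiM_component moment) auto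
    moreover have "(\<Sum>i\<in>?R. c) / real m = c"
      using m by (simp add: card_residue_class[OF l])
    ultimately show ?thesis by (simp add: \<phi>_def sum_nonneg)
  qed
  \<comment> \<open>In place of Jensen's inequality: this bound by the square yields integrability
    and the estimate of the mean together.\<close>
  have amgm: "\<phi> x \<le> ((\<phi> x)\<^sup>2 / \<rho> + \<rho>) / 2" for x
    using zero_le_power2[of "\<phi> x - \<rho>"] \<rho> by (simp add: power2_diff field_simps power2_eq_square)
  have int2: "integrable gaussians (\<lambda>x. ((\<phi> x)\<^sup>2 / \<rho> + \<rho>) / 2)"
    using sq P by (intro integrable_divide integrable_add) (auto simp: has_bochner_integral_iff prob_space_def finite_measure.integrable_const)
  have int: "integrable gaussians \<phi>"
  proof (rule Bochner_Integration.integrable_bound[OF int2])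
    show "AE x in gaussians. norm (\<phi> x) \<le> norm (((\<phi> x)\<^sup>2 / \<rho> + \<rho>) / 2)"
      using amgm \<rho> by (intro AE_I2) (auto simp: \<phi>_def sum_nonneg intro: order_trans[OF _ abs_ge_self])
  qed measurable
  have "\<mu> \<le> (\<integral>x. ((\<phi> x)\<^sup>2 / \<rho> + \<rho>) / 2 \<partial>gaussians)"
    unfolding \<mu>_def by (intro integral_mono int int2 amgm)
  also have "\<dots> = (c / \<rho> + \<rho>) / 2"
    using sq P by (simp add: has_bochner_integral_iff prob_space.prob_space)
  also have "\<dots> \<le> \<rho>"
    using moment(2) \<rho> by (simp add: field_simps power2_eq_square)
  finally have \<mu>: "\<mu> \<le> \<rho>" .
  have mgf: "(\<integral>\<^sup>+x. exp (t * (\<phi> x - \<mu>)) \<partial>gaussians) \<le> exp (t\<^sup>2 * (1 / real m))" for t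
  proof -
    have "(\<integral>\<^sup>+x. exp (t * (\<phi> x - \<mu>)) \<partial>gaussians) \<le> exp (t\<^sup>2 * (1 / sqrt (real m))\<^sup>2)"
    proof (rule gaussian_concentration_mgf[OF _ _ _ _ int \<mu>_def[symmetric]])
      fix x y
      have eq: "\<phi> z = L2_set (\<lambda>i. h (z i)) ?R / sqrt (real m)" for z
        by (simp add: \<phi>_def L2_set_def real_sqrt_divide)
      have tri: "L2_set (\<lambda>i. h (a i)) ?R - L2_set (\<lambda>i. h (b i)) ?R \<le> L2_set (\<lambda>i. a i - b i) {..<m * D}" for a b
      proof -
        have "L2_set (\<lambda>i. h (b i) + (h (a i) - h (b i))) ?R \<le> L2_set (\<lambda>i. h (b i)) ?R + L2_set (\<lambda>i. h (a i) - h (b i)) ?R"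
          by (rule L2_set_triangle_ineq)
        moreover have "L2_set (\<lambda>i. h (a i) - h (b i)) ?R \<le> L2_set (\<lambda>i. a i - b i) {..<m * D}"
          unfolding L2_set_def
          by (intro real_sqrt_le_mono order_trans[OF sum_mono sum_mono2]) (auto simp: abs_le_square_iff[symmetric] lip)
        ultimately show ?thesis by simp
      qed
      have "\<bar>L2_set (\<lambda>i. h (x i)) ?R - L2_set (\<lambda>i. h (y i)) ?R\<bar> \<le> L2_set (\<lambda>i. x i - y i) {..<m * D}"
        using tri[of x y] tri[of y x] by (simp add: abs_le_iff L2_set_def power2_commute)
      then show "\<bar>\<phi> x - \<phi> y\<bar> \<le> 1 / sqrt (real m) * L2_set (\<lambda>i. x i - y i) {..<m * D}"
        by (simp add: eq diff_divide_distrib[symmetric] abs_divide divide_right_mono)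
    qed auto
    then show ?thesis by (simp add: power_divide)
  qed
  have "measure gaussians {x \<in> space gaussians. \<rho> + s \<le> \<phi> x} \<le> measure gaussians {x \<in> space gaussians. s \<le> \<bar>\<phi> x - \<mu>\<bar>}"
    using \<mu> by (intro finite_measure.finite_measure_mono) (auto simp: P prob_space.finite_measure)
  also have "\<dots> \<le> 2 * exp (- s\<^sup>2 / (4 * (1 / real m)))"
    by (rule subgaussian_tail[OF P _ mgf]) (use m s in auto)
  finally show ?thesis by (simp add: \<phi>_def)
qed


text \<open>The third clause is the estimate on the grid. The first clause makes rounding a vector
  to the grid cheap, the second makes clipping the Gaussians cheap; together they carry the estimate
  to all vectors.\<close>

definition good_matrix :: "real \<Rightarrow> nat \<Rightarrow> (nat \<Rightarrow> real) \<Rightarrow> bool" where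
  "good_matrix \<epsilon> \<Lambda> x \<longleftrightarrow>
     (\<forall>l<D. (\<Sum>i | i < m * D \<and> i mod D = l. (x i)\<^sup>2) \<le> 4 * real m) \<and>
     (\<forall>l<D. (\<Sum>i | i < m * D \<and> i mod D = l. (x i - clip (8 / \<epsilon>) (x i))\<^sup>2) \<le> (\<epsilon> / 8)\<^sup>2 * real m) \<and>
     (\<forall>w. dyadic \<Lambda> w \<longrightarrow> \<bar>mean_abs 0 w x - sqrt (2 / pi) * L2_set w {..<D}\<bar> \<le> \<epsilon> / 16)"

lemma column_event:
  fixes h :: "real \<Rightarrow> real"
  assumes lip: "\<And>x y. \<bar>h x - h y\<bar> \<le> \<bar>x - y\<bar>"
    and moment: "has_bochner_integral std_normal (\<lambda>x. (h x)\<^sup>2) c" "c \<le> \<rho>\<^sup>2" and \<rho>: "0 < \<rho>"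
    and n: "real n \<le> \<rho>\<^sup>2 * real m / 4" and D2: "D \<le> 2 ^ \<Lambda>"
  obtains A where "A \<in> sets gaussians" "measure gaussians A \<le> 2 ^ Suc \<Lambda> * (1 / 2) ^ n"
    "\<And>x l. x \<in> space gaussians - A \<Longrightarrow> l < D \<Longrightarrow>
      (\<Sum>i | i < m * D \<and> i mod D = l. (h (x i))\<^sup>2) \<le> (2 * \<rho>)\<^sup>2 * real m"
proof -
  let ?S = "\<lambda>l x. \<Sum>i | i < m * D \<and> i mod D = l. (h (x i))\<^sup>2"
  define B where "B l = {x \<in> space gaussians. \<rho> + \<rho> \<le> sqrt (?S l x / real m)}" for l
  have cont: "continuous_on UNIV h"
    using lip by (intro lipschitz_on_continuous_on[of 1] lipschitz_onI) (auto simp: dist_real_def)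
  have [measurable]: "h \<in> borel_measurable borel"
    using cont by (rule borel_measurable_continuous_onI)
  have [measurable]: "(\<lambda>x. h (x i)) \<in> borel_measurable (Pi\<^sub>M {..<m * D} (\<lambda>_. borel))" if "i < m * D" for i
    using that by (intro measurable_compose[OF measurable_component_singleton]) auto
  have B: "B l \<in> sets gaussians" for l
    unfolding B_def by measurable
  have tail: "measure gaussians (B l) \<le> 2 * (1 / 2) ^ n" if "l < D" for l
  proof -
    have "measure gaussians (B l) \<le> 2 * exp (- \<rho>\<^sup>2 * real m / 4)"
      unfolding B_def by (rule column_tail[OF that lip moment \<rho>]) (use \<rho> in auto)
    also have "exp (- \<rho>\<^sup>2 * real m / 4) \<le> (1 / 2) ^ n"
      using exp_minus_le_half_power[OF n] by simp
    finally show ?thesis by simp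
  qed
  show ?thesis
  proof (rule that[of "\<Union>l<D. B l"])
    have "measure gaussians (\<Union>l<D. B l) \<le> (\<Sum>l<D. measure gaussians (B l))"
      by (intro measure_UNION_le B) auto
    also have "\<dots> \<le> (\<Sum>l<D. 2 * (1 / 2) ^ n)"
      by (intro sum_mono tail) auto
    also have "\<dots> = real D * 2 * (1 / 2) ^ n" by simp
    also have "\<dots> \<le> 2 ^ \<Lambda> * 2 * (1 / 2) ^ n"
    proof -
      have "real D \<le> real (2 ^ \<Lambda>)" using D2 by (simp only: of_nat_le_iff)
      then show ?thesis by (intro mult_right_mono) auto
    qed
    finally show "measure gaussians (\<Union>l<D. B l) \<le> 2 ^ Suc \<Lambda> * (1 / 2) ^ n" by simp
  next
    fix x l assume "x \<in> space gaussians - (\<Union>l<D. B l)" "l < D"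
    then have "sqrt (?S l x / real m) \<le> 2 * \<rho>" by (force simp: B_def not_le)
    then have "?S l x / real m \<le> (2 * \<rho>)\<^sup>2"
      by (rule sqrt_le_D)
    then show "?S l x \<le> (2 * \<rho>)\<^sup>2 * real m"
      using m by (simp add: pos_divide_le_eq)
  qed (use B in auto)
qed

lemma good_matrix_event:
  assumes \<epsilon>: "0 < \<epsilon>" "\<epsilon> < 1" and D2: "D \<le> 2 ^ \<Lambda>"
    and E: "16384 / \<epsilon>\<^sup>2 \<le> real E" and mE: "m = E * (\<Lambda> + 1)\<^sup>2 * (\<Lambda> + q + 1)"
  obtains A where "A \<in> sets gaussians" "1 - (1 / 2) ^ q \<le> measure gaussians A"
    "\<And>x. x \<in> A \<Longrightarrow> good_matrix \<epsilon> \<Lambda> x"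
proof -
  have P: "prob_space gaussians" by (rule prob_space_PiM[OF prob_space_std_normal])
  have m_ge: "16384 / \<epsilon>\<^sup>2 * ((real (\<Lambda> + 1))\<^sup>2 * real (\<Lambda> + q + 1)) \<le> real m"
    unfolding mE of_nat_mult of_nat_power mult.assoc using E by (intro mult_right_mono) auto
  \<comment> \<open>The origin of 16384: with tolerance
    \<open>s = \<epsilon> / (16 * (\<Lambda> + 1))\<close> per scale, \<open>s^2 * m / 4\<close> is
    at least \<open>16 * (\<Lambda> + q + 1)\<close>. This covers the
    \<open>11 * \<Lambda> + 10 + Suc q\<close> of the chaining as well as the column events.\<close>
  define n where "n = 16 * (\<Lambda> + q + 1)"
  have n1: "real n \<le> (\<epsilon> / (16 * real (\<Lambda> + 1)))\<^sup>2 * real m / 4"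
  proof -
    have "(\<epsilon> / (16 * a))\<^sup>2 * (16384 / \<epsilon>\<^sup>2 * (a\<^sup>2 * b)) = 64 * b" if "0 < a" for a b :: real
      using \<epsilon> that by (simp add: power_divide power_mult_distrib)
    from this[of "real (\<Lambda> + 1)" "real (\<Lambda> + q + 1)"]
    have "(\<epsilon> / (16 * real (\<Lambda> + 1)))\<^sup>2 * (16384 / \<epsilon>\<^sup>2 * ((real (\<Lambda> + 1))\<^sup>2 * real (\<Lambda> + q + 1))) = 64 * real (\<Lambda> + q + 1)"
      by simp
    with mult_left_mono[OF m_ge, of "(\<epsilon> / (16 * real (\<Lambda> + 1)))\<^sup>2"] show ?thesis
      by (simp add: n_def)
  qed
  have n2: "real n \<le> (\<epsilon> / 16)\<^sup>2 * real m / 4"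
  proof -
    have "\<epsilon> / (16 * real (\<Lambda> + 1)) \<le> \<epsilon> / 16"
      using \<epsilon> by (intro divide_left_mono) auto
    then have "(\<epsilon> / (16 * real (\<Lambda> + 1)))\<^sup>2 \<le> (\<epsilon> / 16)\<^sup>2"
      using \<epsilon> by (intro power_mono) auto
    then have "(\<epsilon> / (16 * real (\<Lambda> + 1)))\<^sup>2 * real m / 4 \<le> (\<epsilon> / 16)\<^sup>2 * real m / 4"
      by (intro divide_right_mono mult_right_mono) auto
    with n1 show ?thesis by linarith
  qed
  have n3: "real n \<le> 1\<^sup>2 * real m / 4"
  proof -
    have "(\<epsilon> / 16)\<^sup>2 \<le> 1" using \<epsilon> by (simp add: power_le_one)
    then have "(\<epsilon> / 16)\<^sup>2 * real m \<le> 1 * real m" by (intro mult_right_mono) auto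
    with n2 show ?thesis by simp
  qed
  obtain A1 where A1: "A1 \<in> sets gaussians" "measure gaussians A1 \<le> 2 ^ Suc \<Lambda> * (1 / 2) ^ n"
    "\<And>x l. x \<in> space gaussians - A1 \<Longrightarrow> l < D \<Longrightarrow> (\<Sum>i | i < m * D \<and> i mod D = l. (x i)\<^sup>2) \<le> (2 * 1)\<^sup>2 * real m"
    by (rule column_event[of "\<lambda>x. x" 1 1 n \<Lambda>]) (use std_normal_moments n3 D2 in auto)
  define T where "T = 8 / \<epsilon>"
  have T: "0 < T" using \<epsilon> by (simp add: T_def)
  have [measurable]: "clip T \<in> borel_measurable borel" unfolding clip_def by measurable
  define c where "c = (\<integral>x. (x - clip T x)\<^sup>2 \<partial>std_normal)"
  have i4: "integrable std_normal (\<lambda>x. x ^ 4 / (16 * T\<^sup>2))"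
    using std_normal_moments(2) by (intro integrable_divide) (simp add: has_bochner_integral_iff)
  have ci: "has_bochner_integral std_normal (\<lambda>x. (x - clip T x)\<^sup>2) c"
    unfolding c_def using clip_tail_le[OF T]
    by (intro has_bochner_integral_integrable Bochner_Integration.integrable_bound[OF i4]) (auto intro: AE_I2)
  \<comment> \<open>The clipping level \<open>T = 8 / \<epsilon>\<close> pays off here: the fourth
    moment 3 gives \<open>3 / (16 * T^2) = 3 * \<epsilon>^2 / 1024\<close>, below
    \<open>(\<epsilon> / 16)^2\<close>.\<close>
  have "c \<le> (\<integral>x. x ^ 4 / (16 * T\<^sup>2) \<partial>std_normal)"
    using ci clip_tail_le[OF T] unfolding c_def by (intro integral_mono i4) (auto simp: has_bochner_integral_iff)
  also have "\<dots> = 3 / (16 * T\<^sup>2)"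
    using std_normal_moments(2) by (simp add: has_bochner_integral_iff)
  also have "\<dots> \<le> (\<epsilon> / 16)\<^sup>2"
    using \<epsilon> by (simp add: T_def power_divide field_simps)
  finally have c: "c \<le> (\<epsilon> / 16)\<^sup>2" .
  obtain A2 where A2: "A2 \<in> sets gaussians" "measure gaussians A2 \<le> 2 ^ Suc \<Lambda> * (1 / 2) ^ n"
    "\<And>x l. x \<in> space gaussians - A2 \<Longrightarrow> l < D \<Longrightarrow>
       (\<Sum>i | i < m * D \<and> i mod D = l. (x i - clip T (x i))\<^sup>2) \<le> (2 * (\<epsilon> / 16))\<^sup>2 * real m"
    by (rule column_event[of "\<lambda>x. x - clip T x" c "\<epsilon> / 16" n \<Lambda>])
       (use ci c n2 D2 \<epsilon> in \<open>auto intro: clip_diff_lipschitz\<close>)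
  obtain A3 where A3: "A3 \<in> sets gaussians" "1 - (1 / 2) ^ Suc q \<le> measure gaussians A3"
    "\<And>x w. x \<in> A3 \<Longrightarrow> dyadic \<Lambda> w \<Longrightarrow> \<bar>mean_abs 0 w x - sqrt (2 / pi) * L2_set w {..<D}\<bar>
       \<le> real (\<Lambda> + 1) * (\<epsilon> / (16 * real (\<Lambda> + 1)))"
  proof (rule mean_abs_dyadic_uniform[OF D2, of "\<epsilon> / (16 * real (\<Lambda> + 1))" "Suc q"])
    have "real (11 * \<Lambda> + 10 + Suc q) \<le> real n" by (simp add: n_def)
    with n1 show "real (11 * \<Lambda> + 10 + Suc q) \<le> (\<epsilon> / (16 * real (\<Lambda> + 1)))\<^sup>2 * real m / 4" by linarith
  qed (use \<epsilon> in auto)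
  \<comment> \<open>The failure budget \<open>2 ^ - q\<close> is split: one half for the grid, one
    quarter for each of the two column events.\<close>
  have small: "2 ^ Suc \<Lambda> * (1 / 2) ^ n \<le> ((1::real) / 2) ^ (q + 2)"
  proof -
    have "((1::real) / 2) ^ n \<le> (1 / 2) ^ (Suc \<Lambda> + (q + 2))"
      by (intro power_decreasing) (auto simp: n_def)
    then have "2 ^ Suc \<Lambda> * (1 / 2) ^ n \<le> (2::real) ^ Suc \<Lambda> * (1 / 2) ^ (Suc \<Lambda> + (q + 2))"
      by (intro mult_left_mono) auto
    also have "\<dots> = (1 / 2) ^ (q + 2)"
      unfolding power_add mult.assoc[symmetric] power_mult_distrib[symmetric] by simp
    finally show ?thesis .
  qed
  show ?thesis
  proof (rule that[of "A3 - (A1 \<union> A2)"])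
    show "A3 - (A1 \<union> A2) \<in> sets gaussians" using A1 A2 A3 by auto
    have "measure gaussians A3 \<le> measure gaussians ((A3 - (A1 \<union> A2)) \<union> (A1 \<union> A2))"
      using A1 A2 A3 by (intro finite_measure.finite_measure_mono[OF prob_space.finite_measure[OF P]]) auto
    also have "\<dots> \<le> measure gaussians (A3 - (A1 \<union> A2)) + measure gaussians (A1 \<union> A2)"
      using A1 A2 A3 by (intro measure_Un_le) auto
    also have "measure gaussians (A1 \<union> A2) \<le> measure gaussians A1 + measure gaussians A2"
      using A1 A2 by (intro measure_Un_le) auto
    finally show "1 - (1 / 2) ^ q \<le> measure gaussians (A3 - (A1 \<union> A2))"
      using A1(2) A2(2) A3(2) small by simp
    fix x assume x: "x \<in> A3 - (A1 \<union> A2)"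
    then have xs: "x \<in> space gaussians" using A3(1) sets.sets_into_space by blast
    have tol: "real (\<Lambda> + 1) * (\<epsilon> / (16 * real (\<Lambda> + 1))) = \<epsilon> / 16"
    proof -
      have "a * (\<epsilon> / (16 * a)) = \<epsilon> / 16" if "a \<noteq> 0" for a :: real using that by simp
      then show ?thesis by (metis of_nat_eq_0_iff add_is_0 one_neq_zero)
    qed
    show "good_matrix \<epsilon> \<Lambda> x"
      using A1(3)[of x] A2(3)[of x] A3(3)[of x, unfolded tol] x xs
      by (auto simp: good_matrix_def T_def simp del: of_nat_add)
  qed
qed

section \<open>From the grid to all vectors\<close>

lemma column_sum_le:
  assumes "\<And>l. l < D \<Longrightarrow> (\<Sum>i | i < m * D \<and> i mod D = l. (y i)\<^sup>2) \<le> K * real m"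
  shows "(\<Sum>i<m * D. (y i * v (i mod D))\<^sup>2) / real m \<le> K * (L2_set v {..<D})\<^sup>2"
proof -
  have "(\<Sum>i<m * D. (y i * v (i mod D))\<^sup>2) = (\<Sum>l<D. \<Sum>i\<in>{i \<in> {..<m * D}. i mod D = l}. (y i * v (i mod D))\<^sup>2)"
    by (rule sum.group[symmetric]) (use D in auto)
  also have "\<dots> = (\<Sum>l<D. (v l)\<^sup>2 * (\<Sum>i | i < m * D \<and> i mod D = l. (y i)\<^sup>2))"
    unfolding sum_distrib_left by (intro sum.cong refl) (auto simp: power_mult_distrib mult.commute)
  also have "\<dots> \<le> (\<Sum>l<D. (v l)\<^sup>2 * (K * real m))"
    by (intro sum_mono mult_left_mono assms) auto
  also have "\<dots> = K * real m * (L2_set v {..<D})\<^sup>2"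
    by (simp add: L2_set_def sum_nonneg sum_distrib_left mult.commute)
  finally show ?thesis using m by (simp add: pos_divide_le_eq ac_simps)
qed

text \<open>Rounding goes towards zero, so that the rounded vector stays in the unit ball.\<close>

lemma dyadic_rounding:
  assumes "L2_set v {..<D} \<le> 1"
  obtains w where "dyadic \<Lambda> w" "L2_set (\<lambda>i. v i - w i) {..<D} \<le> real D / 2 ^ \<Lambda>"
proof -
  define w where "w i = (if i < D then sgn (v i) * real_of_int \<lfloor>\<bar>v i\<bar> * 2 ^ \<Lambda>\<rfloor> / 2 ^ \<Lambda> else 0)" for i
  have le: "\<bar>w i\<bar> \<le> \<bar>v i\<bar>" for i
  proof -
    have "real_of_int \<lfloor>\<bar>v i\<bar> * 2 ^ \<Lambda>\<rfloor> \<le> \<bar>v i\<bar> * 2 ^ \<Lambda>" by simp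
    moreover have "0 \<le> \<lfloor>\<bar>v i\<bar> * 2 ^ \<Lambda>\<rfloor>" by simp
    ultimately show ?thesis
      by (simp add: w_def abs_mult abs_divide sgn_if pos_divide_le_eq)
  qed
  have near: "\<bar>v i - w i\<bar> \<le> 1 / 2 ^ \<Lambda>" if "i < D" for i
  proof -
    have "v i - w i = sgn (v i) * ((\<bar>v i\<bar> * 2 ^ \<Lambda> - real_of_int \<lfloor>\<bar>v i\<bar> * 2 ^ \<Lambda>\<rfloor>) / 2 ^ \<Lambda>)"
      using that by (simp add: w_def diff_divide_distrib right_diff_distrib mult_sgn_abs)
    moreover have "\<bar>\<bar>v i\<bar> * 2 ^ \<Lambda> - real_of_int \<lfloor>\<bar>v i\<bar> * 2 ^ \<Lambda>\<rfloor>\<bar> \<le> 1"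
      by linarith
    ultimately show ?thesis
      by (auto simp: abs_mult abs_divide sgn_if divide_right_mono)
  qed
  have "dyadic \<Lambda> w"
    unfolding dyadic_def
  proof (intro conjI allI impI)
    fix i
    have "w i = real_of_int (if i < D then (if v i < 0 then - 1 else if v i = 0 then 0 else 1) * \<lfloor>\<bar>v i\<bar> * 2 ^ \<Lambda>\<rfloor> else 0) / 2 ^ \<Lambda>"
      by (simp add: w_def sgn_if)
    then show "\<exists>z::int. w i = real_of_int z / 2 ^ \<Lambda>" by blast
  next
    have "(\<Sum>i<D. (w i)\<^sup>2) \<le> (\<Sum>i<D. (v i)\<^sup>2)"
      by (intro sum_mono) (use le in \<open>simp add: abs_le_square_iff[symmetric]\<close>)
    also have "\<dots> \<le> 1"
      using assms by (simp add: L2_set_def)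
    finally show "(\<Sum>i<D. (w i)\<^sup>2) \<le> 1" .
  qed (simp add: w_def)
  moreover have "L2_set (\<lambda>i. v i - w i) {..<D} \<le> real D / 2 ^ \<Lambda>"
  proof -
    have "L2_set (\<lambda>i. v i - w i) {..<D} \<le> (\<Sum>i<D. \<bar>v i - w i\<bar>)"
      by (rule L2_set_le_sum_abs)
    also have "\<dots> \<le> (\<Sum>i<D. 1 / 2 ^ \<Lambda>)"
      by (intro sum_mono near) auto
    finally show ?thesis by simp
  qed
  ultimately show ?thesis by (rule that)
qed

lemma coord_scale: "coord x (\<lambda>i. c * v i) e = c * coord x v e"
  by (simp add: coord_def sum_distrib_left mult.left_commute)

lemma good_matrix_mean_sq:
  assumes good: "good_matrix \<epsilon> \<Lambda> x" and \<epsilon>: "0 < \<epsilon>"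
  shows "(\<Sum>e<m * D. (coord (\<lambda>i. clip (8 / \<epsilon>) (x i)) v e)\<^sup>2) / real (m * D) \<le> 4 * (L2_set v {..<D})\<^sup>2"
proof (rule order_trans[OF mean_sq_le column_sum_le])
  fix l assume l: "l < D"
  have "(\<Sum>i | i < m * D \<and> i mod D = l. (clip (8 / \<epsilon>) (x i))\<^sup>2) \<le> (\<Sum>i | i < m * D \<and> i mod D = l. (x i)\<^sup>2)"
    using \<epsilon> by (intro sum_mono) (simp add: abs_le_square_iff[symmetric] abs_clip_le)
  then show "(\<Sum>i | i < m * D \<and> i mod D = l. (clip (8 / \<epsilon>) (x i))\<^sup>2) \<le> 4 * real m"
    using good l by (force simp: good_matrix_def)
qed

text \<open>By homogeneity the norm may be taken to be 1. In units of
  \<open>\<epsilon> / 64\<close>, clipping costs 8, rounding 2, the grid estimate 4 and the change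
  of the norm by rounding 1, in total 15 of the 16 allowed.\<close>

lemma good_matrix_mean_abs:
  assumes good: "good_matrix \<epsilon> \<Lambda> x" and \<epsilon>: "0 < \<epsilon>" and \<Lambda>: "64 * real D / \<epsilon> \<le> 2 ^ \<Lambda>"
  shows "\<bar>mean_abs 0 v (\<lambda>i. clip (8 / \<epsilon>) (x i)) - sqrt (2 / pi) * L2_set v {..<D}\<bar> \<le> \<epsilon> / 4 * L2_set v {..<D}"
proof (cases "L2_set v {..<D} = 0")
  case True
  then have "v i = 0" if "i < D" for i using that by (simp add: L2_set_eq_0_iff)
  then have "coord y v e = 0" for y e
    using D by (simp add: coord_def)
  then show ?thesis using True by (simp add: mean_abs_def)
next
  case False
  define N where "N = L2_set v {..<D}"
  have N: "0 < N" using False by (simp add: N_def less_le L2_set_nonneg)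
  define u where "u i = v i / N" for i
  let ?xc = "\<lambda>i. clip (8 / \<epsilon>) (x i)"
  have uN: "L2_set u {..<D} = 1"
  proof -
    have "L2_set u {..<D} = 1 / N * L2_set v {..<D}"
      using N by (subst L2_set_right_distrib) (simp_all add: u_def[abs_def])
    then show ?thesis using N by (simp add: N_def)
  qed
  obtain w where w: "dyadic \<Lambda> w" "L2_set (\<lambda>i. u i - w i) {..<D} \<le> real D / 2 ^ \<Lambda>"
    using dyadic_rounding[of u \<Lambda>] uN by auto
  have "real D / 2 ^ \<Lambda> \<le> \<epsilon> / 64"
    using \<Lambda> \<epsilon> by (simp add: field_simps)
  with w(2) have near: "L2_set (\<lambda>i. u i - w i) {..<D} \<le> \<epsilon> / 64" by linarith
  have 1: "\<bar>mean_abs 0 u ?xc - mean_abs 0 u x\<bar> \<le> \<epsilon> / 8"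
  proof -
    have "\<bar>mean_abs 0 u ?xc - mean_abs 0 u x\<bar> \<le> sqrt ((\<Sum>i<m * D. ((?xc i - x i) * u (i mod D))\<^sup>2) / real m)"
      by (rule mean_abs_diff_le) (simp add: coord_def sum_subtractf[symmetric] algebra_simps)
    also have "\<dots> \<le> sqrt ((\<epsilon> / 8)\<^sup>2 * (L2_set u {..<D})\<^sup>2)"
    proof (intro real_sqrt_le_mono column_sum_le)
      fix l assume "l < D"
      then show "(\<Sum>i | i < m * D \<and> i mod D = l. (?xc i - x i)\<^sup>2) \<le> (\<epsilon> / 8)\<^sup>2 * real m"
        using good by (simp add: good_matrix_def power2_commute[of "clip _ _"])
    qed
    finally show ?thesis using \<epsilon> by (simp add: uN)
  qed
  have 2: "\<bar>mean_abs 0 u x - mean_abs 0 w x\<bar> \<le> \<epsilon> / 32"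
  proof -
    have "\<bar>mean_abs 0 u x - mean_abs 0 w x\<bar> \<le> sqrt ((\<Sum>i<m * D. (x i * (u (i mod D) - w (i mod D)))\<^sup>2) / real m)"
      by (rule mean_abs_diff_le) (simp add: coord_def sum_subtractf[symmetric] algebra_simps)
    also have "\<dots> \<le> sqrt (4 * (L2_set (\<lambda>i. u i - w i) {..<D})\<^sup>2)"
      using good column_sum_le[of x 4 "\<lambda>i. u i - w i"] by (intro real_sqrt_le_mono) (simp add: good_matrix_def)
    also have "\<dots> = 2 * L2_set (\<lambda>i. u i - w i) {..<D}"
      by (simp add: real_sqrt_mult)
    finally show ?thesis using near by linarith
  qed
  have 3: "\<bar>mean_abs 0 w x - sqrt (2 / pi) * L2_set w {..<D}\<bar> \<le> \<epsilon> / 16"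
    using good w(1) by (simp add: good_matrix_def)
  have 4: "\<bar>sqrt (2 / pi) * L2_set w {..<D} - sqrt (2 / pi) * L2_set u {..<D}\<bar> \<le> \<epsilon> / 64"
  proof -
    have "L2_set w {..<D} \<le> L2_set u {..<D} + L2_set (\<lambda>i. u i - w i) {..<D}"
      using L2_set_triangle_ineq[of u "\<lambda>i. w i - u i" "{..<D}"] by (simp add: L2_set_def power2_commute)
    moreover have "L2_set u {..<D} \<le> L2_set w {..<D} + L2_set (\<lambda>i. u i - w i) {..<D}"
      using L2_set_triangle_ineq[of w "\<lambda>i. u i - w i" "{..<D}"] by simp
    ultimately have "\<bar>L2_set w {..<D} - L2_set u {..<D}\<bar> \<le> \<epsilon> / 64"
      using near by linarith
    moreover have "sqrt (2 / pi) \<le> 1"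
      using pi_gt3 by simp
    ultimately show ?thesis
      using mult_mono[of "sqrt (2 / pi)" 1 "\<bar>L2_set w {..<D} - L2_set u {..<D}\<bar>" "\<epsilon> / 64"] pi_gt_zero
      by (simp add: right_diff_distrib[symmetric] abs_mult)
  qed
  have "\<bar>mean_abs 0 u ?xc - sqrt (2 / pi)\<bar> \<le> \<epsilon> / 4"
    using 1 2 3 4 \<epsilon> unfolding uN by linarith
  then have "N * \<bar>mean_abs 0 u ?xc - sqrt (2 / pi)\<bar> \<le> N * (\<epsilon> / 4)"
    using N by (intro mult_left_mono) auto
  moreover have "N * mean_abs 0 u ?xc = mean_abs 0 v ?xc"
  proof -
    have "coord ?xc v e = N * coord ?xc u e" for e
      using N coord_scale[of ?xc N u e] by (simp add: u_def)
    then show ?thesis using N by (simp add: mean_abs_def abs_mult sum_distrib_left)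
  qed
  moreover have "N * \<bar>mean_abs 0 u ?xc - sqrt (2 / pi)\<bar> = \<bar>N * mean_abs 0 u ?xc - sqrt (2 / pi) * N\<bar>"
    using N by (simp add: abs_mult[of N, symmetric, unfolded abs_of_pos[OF N]] right_diff_distrib mult.commute)
  ultimately show ?thesis
    by (simp add: N_def[symmetric] mult.commute)
qed

end

section \<open>Sampling coordinates\<close>

abbreviation cell :: "(real \<times> real) measure" where
  "cell \<equiv> std_normal \<Otimes>\<^sub>M uniform_measure lborel {0..1}"

lemma prob_space_cell: "prob_space cell"
  by (intro prob_space_pair prob_space_std_normal prob_space_uniform_measure) auto

lemma tapes_eq: "tapes = Pi\<^sub>M UNIV (\<lambda>_. cell)"
  by (simp add: tapes_def)

lemma prob_space_tapes: "prob_space tapes"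
  unfolding tapes_eq by (rule prob_space_PiM[OF prob_space_cell])

lemma distr_tapes_restrict:
  assumes "finite I"
  shows "distr tapes (Pi\<^sub>M I (\<lambda>_. cell)) (\<lambda>\<omega>. restrict \<omega> I) = Pi\<^sub>M I (\<lambda>_. cell)"
proof -
  interpret C: prob_space cell by (rule prob_space_cell)
  interpret product_prob_space "\<lambda>_::nat. cell" UNIV ..
  show ?thesis
    unfolding tapes_eq by (rule distr_PiM_restrict_finite) (use assms in auto)
qed

lemma distr_cell_fst: "distr cell std_normal fst = std_normal"
proof -
  interpret U: prob_space "uniform_measure lborel {0..1::real}"
    by (rule prob_space_uniform_measure) auto
  show ?thesis
  proof (rule measure_eqI)
    fix A assume "A \<in> sets (distr cell std_normal fst)"
    then have A: "A \<in> sets std_normal" by simp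
    then have "emeasure (distr cell std_normal fst) A = emeasure cell (A \<times> UNIV)"
      by (subst emeasure_distr) (auto simp: space_pair_measure intro!: arg_cong2[where f = emeasure])
    also have "\<dots> = emeasure std_normal A"
      using A U.emeasure_space_1 by (subst U.emeasure_pair_measure_Times) auto
    finally show "emeasure (distr cell std_normal fst) A = emeasure std_normal A" .
  qed simp
qed

lemma distr_tapes_gaussians:
  fixes K :: nat
  shows "distr tapes (Pi\<^sub>M {..<K} (\<lambda>_. std_normal)) (\<lambda>\<omega>. \<lambda>i\<in>{..<K}. fst (\<omega> i)) = Pi\<^sub>M {..<K} (\<lambda>_. std_normal)"
proof -
  have "distr (Pi\<^sub>M {..<K} (\<lambda>_. cell)) (Pi\<^sub>M {..<K} (\<lambda>_. std_normal)) (\<lambda>x. \<lambda>i\<in>{..<K}. fst (x i))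
      = Pi\<^sub>M {..<K} (\<lambda>_. distr cell std_normal fst)"
    using distr_PiM_finite_prob_space'[of "{..<K}" "\<lambda>_. cell" "\<lambda>_. std_normal" "fst"]
    by (simp add: prob_space_cell prob_space_std_normal compose_def[abs_def])
  then have "Pi\<^sub>M {..<K} (\<lambda>_. std_normal) = distr (distr tapes (Pi\<^sub>M {..<K} (\<lambda>_. cell)) (\<lambda>\<omega>. restrict \<omega> {..<K}))
      (Pi\<^sub>M {..<K} (\<lambda>_. std_normal)) (\<lambda>x. \<lambda>i\<in>{..<K}. fst (x i))"
    by (simp add: distr_cell_fst distr_tapes_restrict)
  also have "\<dots> = distr tapes (Pi\<^sub>M {..<K} (\<lambda>_. std_normal)) ((\<lambda>x. \<lambda>i\<in>{..<K}. fst (x i)) \<circ> (\<lambda>\<omega>. restrict \<omega> {..<K}))"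
    unfolding tapes_eq by (rule distr_distr) measurable
  also have "(\<lambda>x. \<lambda>i\<in>{..<K}. fst (x i)) \<circ> (\<lambda>\<omega>. restrict \<omega> {..<K}) = (\<lambda>\<omega>::tape. \<lambda>i\<in>{..<K}. fst (\<omega> i))"
    by (auto simp: fun_eq_iff restrict_def)
  finally show ?thesis ..
qed

lemma gaussian_event_on_tapes:
  assumes A: "A \<in> sets (Pi\<^sub>M {..<K} (\<lambda>_. std_normal))"
  obtains B where "B \<in> sets tapes" "measure tapes B = measure (Pi\<^sub>M {..<K} (\<lambda>_. std_normal)) A"
    "\<And>\<omega>. \<omega> \<in> B \<Longrightarrow> (\<lambda>i\<in>{..<K}. fst (\<omega> i)) \<in> A"
proof -
  let ?f = "\<lambda>\<omega>::tape. \<lambda>i\<in>{..<K}. fst (\<omega> i)"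
  have m: "?f \<in> measurable tapes (Pi\<^sub>M {..<K} (\<lambda>_. std_normal))"
    unfolding tapes_eq by measurable
  show ?thesis
  proof (rule that[of "?f -` A \<inter> space tapes"])
    show "?f -` A \<inter> space tapes \<in> sets tapes" using m A by (rule measurable_sets)
    show "measure tapes (?f -` A \<inter> space tapes) = measure (Pi\<^sub>M {..<K} (\<lambda>_. std_normal)) A"
      using measure_distr[OF m, of A] A by (simp add: distr_tapes_gaussians)
  qed auto
qed

lemma index_of_less: "0 < M \<Longrightarrow> index_of M u < M"
proof -
  assume "0 < M"
  then have "real M * frac u < real M * 1"
    by (intro mult_strict_left_mono) (auto simp: frac_lt_1)
  then have "\<lfloor>real M * frac u\<rfloor> < int M" by (simp add: floor_less_iff)
  then show ?thesis
    using \<open>0 < M\<close> by (simp add: index_of_def nat_less_iff)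
qed

lemma measurable_index_of [measurable]: "index_of M \<in> measurable borel (count_space UNIV)"
  unfolding index_of_def frac_def by measurable

text \<open>On the unit interval the level sets of \<open>index_of M\<close> are intervals of length
  \<open>1 / M\<close>, apart from the endpoint 1, whose fractional part is 0; hence the argument up
  to a null set.\<close>

lemma nn_integral_index_of:
  assumes M: "0 < M"
  shows "(\<integral>\<^sup>+u. ennreal (f (index_of M u)) \<partial>uniform_measure lborel {0..1}) = (\<Sum>e<M. ennreal (f e)) / ennreal (real M)"
proof -
  have len: "emeasure lborel ({0..1} \<inter> index_of M -` {e}) = ennreal (1 / real M)" if e: "e < M" for e
  proof -
    have iff: "index_of M u = e \<longleftrightarrow> real e / real M \<le> u \<and> u < real (Suc e) / real M" if u: "0 \<le> u" "u < 1" for u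
    proof -
      have "frac u = u" using u by (simp add: frac_eq)
      then have "index_of M u = e \<longleftrightarrow> \<lfloor>real M * u\<rfloor> = int e"
        using u M by (auto simp: index_of_def nat_eq_iff)
      also have "\<dots> \<longleftrightarrow> real e \<le> real M * u \<and> real M * u < real e + 1"
        by (simp add: floor_eq_iff)
      finally show ?thesis using M by (simp add: field_simps)
    qed
    have bound: "real (Suc e) / real M \<le> 1" using e by simp
    have "emeasure lborel ({0..1} \<inter> index_of M -` {e}) = emeasure lborel {real e / real M..<real (Suc e) / real M}"
    proof (rule emeasure_eq_AE)
      have "AE u in lborel. u \<noteq> (1::real)" by (rule AE_lborel_singleton)
      then show "AE u in lborel. u \<in> {0..1} \<inter> index_of M -` {e} \<longleftrightarrow> u \<in> {real e / real M..<real (Suc e) / real M}"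
      proof eventually_elim
        case (elim u)
        have "0 \<le> real e / real M" by simp
        then have "0 \<le> u \<and> u < 1" if "real e / real M \<le> u \<and> u < real (Suc e) / real M"
          using that bound by linarith
        then show ?case
          using iff[of u] elim by (auto simp del: of_nat_Suc)
      qed
    qed (use measurable_sets[OF measurable_index_of[of M], of "{e}"] in auto)
    also have "\<dots> = ennreal (1 / real M)"
      using M by (simp add: diff_divide_distrib[symmetric] divide_right_mono)
    finally show ?thesis .
  qed
  have "(\<integral>\<^sup>+u. ennreal (f (index_of M u)) \<partial>uniform_measure lborel {0..1})
      = (\<integral>\<^sup>+u. (\<Sum>e<M. ennreal (f e) * indicator (index_of M -` {e}) u) \<partial>uniform_measure lborel {0..1})"
  proof (intro nn_integral_cong)
    fix u
    have "(\<Sum>e<M. ennreal (f e) * indicator (index_of M -` {e}) u) = (\<Sum>e\<in>{index_of M u}. ennreal (f e))"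
      by (rule sum.mono_neutral_cong_right) (use index_of_less[OF M, of u] in \<open>auto simp: indicator_def\<close>)
    then show "ennreal (f (index_of M u)) = (\<Sum>e<M. ennreal (f e) * indicator (index_of M -` {e}) u)"
      by simp
  qed
  also have "\<dots> = (\<Sum>e<M. ennreal (f e) * emeasure (uniform_measure lborel {0..1}) (index_of M -` {e}))"
  proof -
    have "index_of M -` {e} \<in> sets borel" for e
      using measurable_sets[OF measurable_index_of[of M], of "{e}"] by simp
    then show ?thesis by (subst nn_integral_sum) (auto simp: nn_integral_cmult)
  qed
  also have "\<dots> = (\<Sum>e<M. ennreal (f e) * ennreal (1 / real M))"
  proof (intro sum.cong refl arg_cong2[where f = "(*)"])
    fix e assume "e \<in> {..<M}"
    moreover have "index_of M -` {e} \<in> sets borel"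
      using measurable_sets[OF measurable_index_of[of M], of "{e}"] by simp
    ultimately show "emeasure (uniform_measure lborel {0..1}) (index_of M -` {e}) = ennreal (1 / real M)"
      using len[of e] divide_ennreal[of "1 / real M" 1] by (simp add: emeasure_uniform_measure)
  qed
  also have "\<dots> = (\<Sum>e<M. ennreal (f e)) / ennreal (real M)"
    using M by (simp add: sum_distrib_right[symmetric] divide_ennreal_def inverse_ennreal inverse_eq_divide)
  finally show ?thesis .
qed

text \<open>Independence of the samples in the form that exponential moments need: distinct samples
  read distinct cells, so the integral factorizes once the tape is restricted to its first
  \<open>k\<close> cells.\<close>

lemma nn_integral_sample_prod:
  assumes M: "0 < M" and f: "\<And>e. 0 \<le> f e"
  shows "(\<integral>\<^sup>+\<omega>. (\<Prod>t<k. ennreal (f (index_of M (snd (\<omega> t))))) \<partial>tapes) = ennreal (((\<Sum>e<M. f e) / real M) ^ k)"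
proof -
  interpret C: prob_space cell by (rule prob_space_cell)
  interpret S: product_sigma_finite "\<lambda>_::nat. cell" by standard
  interpret U: prob_space "uniform_measure lborel {0..1::real}"
    by (rule prob_space_uniform_measure) auto
  let ?g = "\<lambda>c :: real \<times> real. ennreal (f (index_of M (snd c)))"
  have mg [measurable]: "?g \<in> borel_measurable cell"
    by measurable
  have one: "(\<integral>\<^sup>+c. ?g c \<partial>cell) = ennreal ((\<Sum>e<M. f e) / real M)"
  proof -
    have "(\<integral>\<^sup>+c. ?g c \<partial>cell) = (\<integral>\<^sup>+x. \<integral>\<^sup>+u. ennreal (f (index_of M u)) \<partial>uniform_measure lborel {0..1} \<partial>std_normal)"
      by (subst U.nn_integral_fst[symmetric]) simp_all
    also have "\<dots> = (\<Sum>e<M. ennreal (f e)) / ennreal (real M)"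
      by (simp add: nn_integral_index_of[OF M])
    finally show ?thesis
      using M f by (simp add: sum_ennreal divide_ennreal sum_nonneg)
  qed
  have "(\<integral>\<^sup>+\<omega>. (\<Prod>t<k. ?g (\<omega> t)) \<partial>tapes) = (\<integral>\<^sup>+\<omega>. (\<Prod>t<k. ?g (restrict \<omega> {..<k} t)) \<partial>tapes)"
    by (intro nn_integral_cong prod.cong) auto
  also have "\<dots> = (\<integral>\<^sup>+x. (\<Prod>t<k. ?g (x t)) \<partial>distr tapes (Pi\<^sub>M {..<k} (\<lambda>_. cell)) (\<lambda>\<omega>. restrict \<omega> {..<k}))"
    unfolding tapes_eq by (intro nn_integral_distr[symmetric] measurable_restrict_subset) auto
  also have "\<dots> = (\<Prod>t<k. (\<integral>\<^sup>+c. ?g c \<partial>cell))"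
    unfolding distr_tapes_restrict[OF finite_lessThan] by (rule S.product_nn_integral_prod) auto
  finally show ?thesis
    using f by (simp add: one ennreal_power sum_nonneg divide_nonneg_nonneg)
qed

section \<open>A Bernstein bound for sampled means\<close>

lemma exp_le_quadratic:
  fixes x :: real
  assumes "\<bar>x\<bar> \<le> 1"
  shows "exp x \<le> 1 + x + x\<^sup>2"
proof (cases "0 \<le> x")
  case True
  then show ?thesis using assms exp_bound[of x] by simp
next
  case False
  define y where "y = - x"
  have y: "0 \<le> y" using False by (simp add: y_def)
  \<comment> \<open>The claimed bound times the quadratic Taylor polynomial of \<open>exp y\<close>
    is at least 1, because only nonnegative terms remain in the expansion.\<close>
  have "(1 - y + y\<^sup>2) * (1 + y + y\<^sup>2 / 2) = 1 + (y\<^sup>2 + y ^ 3 + y ^ 4) / 2"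
    by (simp add: field_simps eval_nat_numeral)
  then have "1 \<le> (1 - y + y\<^sup>2) * (1 + y + y\<^sup>2 / 2)"
    using y by simp
  also have "\<dots> \<le> (1 - y + y\<^sup>2) * exp y"
  proof (intro mult_left_mono exp_lower_Taylor_quadratic y)
    show "0 \<le> 1 - y + y\<^sup>2"
      using zero_le_power2[of "y - 1"] y by (simp add: power2_diff)
  qed
  finally have "exp (- y) \<le> 1 - y + y\<^sup>2"
    by (simp add: exp_minus inverse_eq_divide pos_divide_le_eq)
  then show ?thesis by (simp add: y_def)
qed

text \<open>Chernoff's bound with the parameter \<open>c\<close> left free: a positive
  \<open>c\<close> bounds the sample mean from above, a negative one from below. The condition
  \<open>\<bar>c\<bar> * b \<le> 1\<close> keeps \<open>exp\<close> below its quadratic bound, so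
  that only the mean and the second moment enter.\<close>

lemma sample_mean_tail:
  fixes X :: "nat \<Rightarrow> real"
  assumes M: "0 < M" and X: "\<And>e. e < M \<Longrightarrow> 0 \<le> X e" "\<And>e. e < M \<Longrightarrow> X e \<le> b" and c: "\<bar>c\<bar> * b \<le> 1"
    and mean: "(\<Sum>e<M. X e) / real M = \<mu>" and sq: "(\<Sum>e<M. (X e)\<^sup>2) / real M \<le> v"
    and exponent: "c\<^sup>2 * v - r \<le> - x"
  obtains A where "A \<in> sets tapes" "measure tapes A \<le> exp (- real k * x)"
    "\<And>\<omega>. \<omega> \<in> space tapes - A \<Longrightarrow> c * (\<Sum>t<k. X (index_of M (snd (\<omega> t)))) \<le> real k * (c * \<mu> + r)"
proof -
  let ?J = "\<lambda>\<omega> t. index_of M (snd (\<omega> t))"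
  define S where "S \<omega> = (\<Sum>t<k. X (?J \<omega> t))" for \<omega> :: tape
  have [measurable]: "S \<in> borel_measurable tapes"
    unfolding S_def tapes_eq by measurable
  have "(\<Sum>e<M. exp (c * X e)) / real M \<le> (\<Sum>e<M. 1 + c * X e + c\<^sup>2 * (X e)\<^sup>2) / real M"
  proof (intro divide_right_mono sum_mono)
    fix e assume "e \<in> {..<M}"
    then have "\<bar>c * X e\<bar> \<le> \<bar>c\<bar> * b"
      using X[of e] by (simp add: abs_mult mult_left_mono)
    then show "exp (c * X e) \<le> 1 + c * X e + c\<^sup>2 * (X e)\<^sup>2"
      using exp_le_quadratic[of "c * X e"] c by (simp add: power_mult_distrib)
  qed simp
  also have "\<dots> = 1 + c * ((\<Sum>e<M. X e) / real M) + c\<^sup>2 * ((\<Sum>e<M. (X e)\<^sup>2) / real M)"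
    using M by (simp add: sum.distrib sum_distrib_left[symmetric] add_divide_distrib)
  also have "\<dots> \<le> 1 + c * \<mu> + c\<^sup>2 * v"
    using mult_left_mono[OF sq, of "c\<^sup>2"] by (simp add: mean)
  also have "\<dots> \<le> exp (c * \<mu> + c\<^sup>2 * v)"
    using exp_ge_add_one_self[of "c * \<mu> + c\<^sup>2 * v"] by (simp only: add.assoc)
  finally have mgf1: "(\<Sum>e<M. exp (c * X e)) / real M \<le> exp (c * \<mu> + c\<^sup>2 * v)" .
  have mgf: "(\<integral>\<^sup>+\<omega>. exp (c * S \<omega>) \<partial>tapes) \<le> exp (real k * (c * \<mu> + c\<^sup>2 * v))"
  proof -
    have "(\<integral>\<^sup>+\<omega>. exp (c * S \<omega>) \<partial>tapes) = (\<integral>\<^sup>+\<omega>. (\<Prod>t<k. ennreal (exp (c * X (?J \<omega> t)))) \<partial>tapes)"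
      by (intro nn_integral_cong) (simp add: S_def sum_distrib_left exp_sum prod_ennreal)
    also have "\<dots> = ennreal (((\<Sum>e<M. exp (c * X e)) / real M) ^ k)"
      by (rule nn_integral_sample_prod[OF M]) simp
    also have "\<dots> \<le> ennreal (exp (c * \<mu> + c\<^sup>2 * v) ^ k)"
      by (intro ennreal_leI power_mono mgf1 divide_nonneg_nonneg sum_nonneg) auto
    finally show ?thesis by (simp add: exp_of_nat_mult)
  qed
  let ?A = "{\<omega> \<in> space tapes. real k * (c * \<mu> + r) < c * S \<omega>}"
  show ?thesis
  proof (rule that[of ?A])
    have "emeasure tapes ?A \<le> (\<integral>\<^sup>+\<omega>. ennreal (exp (- real k * (c * \<mu> + r))) * exp (c * S \<omega>) \<partial>tapes)"
    proof (subst nn_integral_indicator[symmetric], simp, intro nn_integral_mono)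
      fix \<omega>
      have "1 \<le> exp (- real k * (c * \<mu> + r)) * exp (c * S \<omega>)" if "real k * (c * \<mu> + r) < c * S \<omega>"
        using that by (simp add: exp_add[symmetric])
      then show "indicator ?A \<omega> \<le> ennreal (exp (- real k * (c * \<mu> + r))) * ennreal (exp (c * S \<omega>))"
        by (auto simp: indicator_def ennreal_mult'[symmetric] simp del: ennreal_1 simp flip: ennreal_1)
    qed
    also have "\<dots> \<le> ennreal (exp (- real k * (c * \<mu> + r))) * ennreal (exp (real k * (c * \<mu> + c\<^sup>2 * v)))"
      by (subst nn_integral_cmult) (auto intro!: mult_left_mono mgf)
    also have "\<dots> = ennreal (exp (real k * (c\<^sup>2 * v - r)))"
      by (simp add: ennreal_mult'[symmetric] exp_add[symmetric] algebra_simps)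
    also have "\<dots> \<le> ennreal (exp (- real k * x))"
      using mult_left_mono[OF exponent, of "real k"] by (intro ennreal_leI) simp
    finally show "measure tapes ?A \<le> exp (- real k * x)"
      by (simp add: finite_measure.emeasure_eq_measure prob_space.finite_measure[OF prob_space_tapes])
    show "?A \<in> sets tapes" by measurable
  qed (auto simp: S_def not_less)
qed


section \<open>Iterated truncation\<close>

text \<open>The truncation level is \<open>32 / \<epsilon>\<close> times the previous mean. A mean
  of at least \<open>N / 4\<close> thus gives a level of at least \<open>8 / \<epsilon> * N\<close>,
  and a mean of at most \<open>2 * 2 ^ j * N\<close> a level of at most
  \<open>64 * 2 ^ j / \<epsilon> * N\<close>.\<close>

primrec robust_sum :: "real \<Rightarrow> nat \<Rightarrow> (nat \<Rightarrow> real) \<Rightarrow> nat \<Rightarrow> real" where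
  "robust_sum \<epsilon> k a 0 = (\<Sum>t<k. a t)"
| "robust_sum \<epsilon> k a (Suc i) = (\<Sum>t<k. min (a t) (32 * robust_sum \<epsilon> k a i / (real k * \<epsilon>)))"

text \<open>
  Each round of truncation at a multiple of the current estimate halves the guaranteed upper bound of
  the truncation level, until it is of order \<open>N / \<epsilon>\<close>.
\<close>

lemma robust_sum_estimate:
  fixes N \<mu> \<epsilon> :: real
  assumes \<epsilon>: "0 < \<epsilon>" "\<epsilon> < 1 / 2" and N: "0 < N" and k: "0 < k"
    and bound: "\<And>t. t < k \<Longrightarrow> 0 \<le> a t \<and> a t \<le> 64 * 2 ^ p / \<epsilon> * N"
    and mean: "\<bar>\<mu> - sqrt (2 / pi) * N\<bar> \<le> \<epsilon> / 4 * N"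
    and upper: "\<And>i. i \<le> p \<Longrightarrow> (\<Sum>t<k. min (a t) (64 * 2 ^ i / \<epsilon> * N)) \<le> real k * (\<mu> + 2 ^ i * \<epsilon> / 8 * N)"
    and lower: "real k * (\<mu> - \<epsilon> / 4 * N) \<le> (\<Sum>t<k. min (a t) (8 / \<epsilon> * N))"
  shows "(1 - \<epsilon>) * N \<le> sqrt (pi / 2) * robust_sum \<epsilon> k a p / real k"
    and "sqrt (pi / 2) * robust_sum \<epsilon> k a p / real k \<le> (1 + \<epsilon>) * N"
proof -
  let ?s = "robust_sum \<epsilon> k a"
  define c where "c = sqrt (2 / pi)"
  have c: "1 / 2 \<le> c" "c \<le> 1"
  proof -
    have "(1 / 2)\<^sup>2 \<le> 2 / pi" using pi_less_4 by (simp add: power2_eq_square field_simps)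
    then show "1 / 2 \<le> c" unfolding c_def by (rule real_le_rsqrt)
    show "c \<le> 1" using pi_gt3 by (simp add: c_def)
  qed
  have cN: "c * N - \<epsilon> / 4 * N \<le> \<mu>" "\<mu> \<le> c * N + \<epsilon> / 4 * N"
    using mean unfolding c_def by linarith+
  have cN2: "N / 2 \<le> c * N" "c * N \<le> N"
    using c N mult_right_mono[of "1 / 2" c N] mult_right_mono[of c 1 N] by auto
  have eN: "\<epsilon> * N \<le> N / 2" using \<epsilon> N mult_right_mono[of \<epsilon> "1 / 2" N] by simp
  \<comment> \<open>The two bounds travel together: the lower one keeps the next level above
    \<open>8 / \<epsilon> * N\<close>, where truncation introduces little bias, and the upper one
    keeps it below the level at which the sampling error is half as large.\<close>
  have low: "real k * (\<mu> - \<epsilon> / 4 * N) \<le> ?s i" and upp: "?s i \<le> real k * (\<mu> + 2 ^ (p - i) * \<epsilon> / 8 * N)"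
    if "i \<le> p" for i
    using that
  proof (induction i)
    case 0
    {
      case 1
      have "(\<Sum>t<k. min (a t) (8 / \<epsilon> * N)) \<le> (\<Sum>t<k. a t)" by (intro sum_mono) auto
      with lower show ?case by simp
    next
      case 2
      have "(\<Sum>t<k. min (a t) (64 * 2 ^ p / \<epsilon> * N)) = (\<Sum>t<k. a t)"
        using bound by (intro sum.cong) auto
      then show ?case using upper[of p] by simp
    }
  next
    case (Suc i)
    define \<tau> where "\<tau> = 32 * ?s i / (real k * \<epsilon>)"
    have s: "?s (Suc i) = (\<Sum>t<k. min (a t) \<tau>)" by (simp add: \<tau>_def)
    {
      case 1
      have "N / 4 \<le> \<mu> - \<epsilon> / 4 * N" using cN cN2 eN by linarith
      then have "real k * (N / 4) \<le> ?s i"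
        using Suc.IH(1) 1 by (meson Suc_leD mult_left_mono of_nat_0_le_iff order_trans)
      then have "8 / \<epsilon> * N \<le> \<tau>"
        using \<epsilon> k by (simp add: \<tau>_def field_simps)
      then have "(\<Sum>t<k. min (a t) (8 / \<epsilon> * N)) \<le> (\<Sum>t<k. min (a t) \<tau>)"
        by (intro sum_mono) auto
      with lower show ?case by (simp only: s)
    next
      case 2
      define j where "j = p - Suc i"
      have j: "p - i = Suc j" using 2 by (simp add: j_def)
      have two: "(1::real) \<le> 2 ^ j" by simp
      define P where "P = N * 2 ^ j"
      have "\<epsilon> * N * 2 ^ j \<le> N / 2 * 2 ^ j" using eN by (intro mult_right_mono) auto
      then have p1: "\<epsilon> * N * 2 ^ j \<le> P / 2" by (simp add: P_def)
      have p2: "N \<le> P" using N two mult_left_mono[of 1 "2 ^ j" N] by (simp add: P_def)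
      \<comment> \<open>As \<open>\<epsilon> < 1 / 2\<close>, the error term is at most
        \<open>2 ^ j * N / 8\<close> and \<open>\<mu>\<close> is at most \<open>9 / 8 * N\<close>,
        so the sum is well below \<open>2 * 2 ^ j * N\<close>.\<close>
      have "\<mu> + 2 ^ (p - i) * \<epsilon> / 8 * N \<le> 2 * 2 ^ j * N"
      proof -
        have "2 ^ (p - i) * \<epsilon> / 8 * N = (\<epsilon> * N * 2 ^ j) / 4" by (simp add: j)
        moreover have "\<mu> \<le> N + N / 8" using cN cN2 eN by linarith
        moreover have "2 * 2 ^ j * N = 2 * P" by (simp add: P_def)
        ultimately show ?thesis using p1 p2 N by linarith
      qed
      then have "?s i \<le> real k * (2 * 2 ^ j * N)"
        using Suc.IH(2) 2 by (meson Suc_leD mult_left_mono of_nat_0_le_iff order_trans)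
      then have "\<tau> \<le> 64 * 2 ^ j / \<epsilon> * N"
        using \<epsilon> k by (simp add: \<tau>_def field_simps)
      then have "(\<Sum>t<k. min (a t) \<tau>) \<le> (\<Sum>t<k. min (a t) (64 * 2 ^ j / \<epsilon> * N))"
        by (intro sum_mono) auto
      also have "\<dots> \<le> real k * (\<mu> + 2 ^ j * \<epsilon> / 8 * N)"
        by (rule upper) (simp add: j_def)
      finally show ?case by (simp only: s j_def)
    }
  qed
  define r where "r = ?s p / real k"
  have r: "c * N - \<epsilon> / 2 * N \<le> r" "r \<le> c * N + \<epsilon> / 2 * N"
  proof -
    have "\<mu> - \<epsilon> / 4 * N \<le> r" "r \<le> \<mu> + \<epsilon> / 8 * N"
      using low[of p] upp[of p] k by (simp_all add: r_def pos_le_divide_eq pos_divide_le_eq mult.commute)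
    then show "c * N - \<epsilon> / 2 * N \<le> r" "r \<le> c * N + \<epsilon> / 2 * N"
      using cN \<epsilon> N by (auto simp: field_simps)
  qed
  have inv: "sqrt (pi / 2) * c = 1"
    by (simp add: c_def real_sqrt_mult[symmetric])
  \<comment> \<open>The mean is known up to \<open>\<epsilon> / 2 * N\<close>; rescaling by
    \<open>sqrt (pi / 2)\<close>, which is at most 2, makes this at most
    \<open>\<epsilon> * N\<close>.\<close>
  have inv2: "0 < sqrt (pi / 2)" "sqrt (pi / 2) \<le> 2"
    using pi_less_4 by (auto intro!: real_le_lsqrt simp: power2_eq_square)
  have eq: "sqrt (pi / 2) * ?s p / real k = sqrt (pi / 2) * r" by (simp add: r_def)
  have e2: "sqrt (pi / 2) * (\<epsilon> / 2 * N) \<le> \<epsilon> * N"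
    using mult_right_mono[OF inv2(2), of "\<epsilon> / 2 * N"] \<epsilon> N by simp
  have "sqrt (pi / 2) * (c * N - \<epsilon> / 2 * N) \<le> sqrt (pi / 2) * r" "sqrt (pi / 2) * r \<le> sqrt (pi / 2) * (c * N + \<epsilon> / 2 * N)"
    using r inv2 by (auto intro: mult_left_mono)
  moreover have "sqrt (pi / 2) * (c * N) = N" using inv by (simp add: mult.assoc[symmetric])
  ultimately show "(1 - \<epsilon>) * N \<le> sqrt (pi / 2) * ?s p / real k" "sqrt (pi / 2) * ?s p / real k \<le> (1 + \<epsilon>) * N"
    unfolding eq using e2 by (simp_all add: right_diff_distrib distrib_left distrib_right left_diff_distrib)
qed

text \<open>The levels used by \<open>robust_sum\<close> are random, but truncation is monotone in
  the level, so it is enough to control fixed ones: \<open>p + 1\<close> levels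
  \<open>64 * 2 ^ i / \<epsilon> * N\<close> from above and the level
  \<open>8 / \<epsilon> * N\<close> from below, which makes \<open>p + 2\<close> events.\<close>

lemma robust_sum_event:
  fixes a :: "nat \<Rightarrow> real"
  assumes M: "0 < M" and \<epsilon>: "0 < \<epsilon>" "\<epsilon> < 1 / 2" and N: "0 \<le> N" and k: "0 < k"
    and bound: "\<And>e. e < M \<Longrightarrow> 0 \<le> a e \<and> a e \<le> 64 * 2 ^ p / \<epsilon> * N"
    and mean: "\<bar>(\<Sum>e<M. a e) / real M - sqrt (2 / pi) * N\<bar> \<le> \<epsilon> / 4 * N"
    and sq: "(\<Sum>e<M. (a e)\<^sup>2) / real M \<le> 4 * N\<^sup>2"
  obtains A where "A \<in> sets tapes" "measure tapes A \<le> real (p + 2) * exp (- real k * (\<epsilon>\<^sup>2 / 1024))"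
    "\<And>\<omega>. \<omega> \<in> space tapes - A \<Longrightarrow>
       (1 - \<epsilon>) * N \<le> sqrt (pi / 2) * robust_sum \<epsilon> k (\<lambda>t. a (index_of M (snd (\<omega> t)))) p / real k \<and>
       sqrt (pi / 2) * robust_sum \<epsilon> k (\<lambda>t. a (index_of M (snd (\<omega> t)))) p / real k \<le> (1 + \<epsilon>) * N"
proof (cases "N = 0")
  case True
  have a0: "a (index_of M u) = 0" for u
    using bound[OF index_of_less[OF M, of u]] True by simp
  have "robust_sum \<epsilon> k (\<lambda>t. 0) i = 0" for i by (induction i) auto
  then show ?thesis
    using that[of "{}"] True by (simp add: a0)
next
  case False
  then have N: "0 < N" using N by simp
  define \<mu> where "\<mu> = (\<Sum>e<M. a e) / real M"
  let ?J = "\<lambda>\<omega> t. index_of M (snd (\<omega> t))"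
  have min_sq: "(\<Sum>e<M. (min (a e) b)\<^sup>2) / real M \<le> 4 * N\<^sup>2" if "0 \<le> b" for b
  proof (rule order_trans[OF divide_right_mono[OF sum_mono] sq])
    fix e assume "e \<in> {..<M}"
    then show "(min (a e) b)\<^sup>2 \<le> (a e)\<^sup>2"
      using bound[of e] that by (intro power_mono) auto
  qed simp
  have "\<exists>A. A \<in> sets tapes \<and> measure tapes A \<le> exp (- real k * (\<epsilon>\<^sup>2 / 1024)) \<and>
      (\<forall>\<omega>\<in>space tapes - A. (\<Sum>t<k. min (a (?J \<omega> t)) (64 * 2 ^ i / \<epsilon> * N)) \<le> real k * (\<mu> + 2 ^ i * \<epsilon> / 8 * N))" for i
  proof -
    define b where "b = 64 * 2 ^ i / \<epsilon> * N"
    have b: "0 < b" using \<epsilon> N by (simp add: b_def)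
    define \<mu>' where "\<mu>' = (\<Sum>e<M. min (a e) b) / real M"
    have le: "\<mu>' \<le> \<mu>"
      unfolding \<mu>_def \<mu>'_def by (intro divide_right_mono sum_mono) auto
    \<comment> \<open>With \<open>c = 1 / b\<close> the variance term is at most
      \<open>\<epsilon>^2 / 1024\<close>. The slack \<open>\<epsilon>^2 / 512\<close> leaves as much
      in the exponent, and multiplied by \<open>b\<close> it is the allowed error
      \<open>2 ^ i * \<epsilon> / 8 * N\<close>.\<close>
    have "(1 / b)\<^sup>2 * (4 * N\<^sup>2) \<le> \<epsilon>\<^sup>2 / 1024"
    proof -
      have "(1 / b)\<^sup>2 * (4 * N\<^sup>2) = \<epsilon>\<^sup>2 / 1024 * (1 / 2 ^ i)\<^sup>2"
        using N \<epsilon> by (simp add: b_def power_divide power_mult_distrib)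
      also have "\<dots> \<le> \<epsilon>\<^sup>2 / 1024 * 1"
        by (intro mult_left_mono power_le_one) auto
      finally show ?thesis by simp
    qed
    then have ex: "(1 / b)\<^sup>2 * (4 * N\<^sup>2) - \<epsilon>\<^sup>2 / 512 \<le> - (\<epsilon>\<^sup>2 / 1024)" by linarith
    obtain A where A: "A \<in> sets tapes" "measure tapes A \<le> exp (- real k * (\<epsilon>\<^sup>2 / 1024))"
      "\<And>\<omega>. \<omega> \<in> space tapes - A \<Longrightarrow> 1 / b * (\<Sum>t<k. min (a (?J \<omega> t)) b) \<le> real k * (1 / b * \<mu>' + \<epsilon>\<^sup>2 / 512)"
      by (rule sample_mean_tail[OF M _ _ _ \<mu>'_def[symmetric] min_sq ex]) (use b bound in auto)
    have "(\<Sum>t<k. min (a (?J \<omega> t)) b) \<le> real k * (\<mu> + 2 ^ i * \<epsilon> / 8 * N)" if "\<omega> \<in> space tapes - A" for \<omega>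
    proof -
      have "(\<Sum>t<k. min (a (?J \<omega> t)) b) = b * (1 / b * (\<Sum>t<k. min (a (?J \<omega> t)) b))"
        using b by simp
      also have "\<dots> \<le> b * (real k * (1 / b * \<mu>' + \<epsilon>\<^sup>2 / 512))"
        using A(3)[OF that] b by (intro mult_left_mono) auto
      also have "\<dots> = real k * (\<mu>' + b * \<epsilon>\<^sup>2 / 512)"
        using b by (simp add: field_simps)
      also have "b * \<epsilon>\<^sup>2 / 512 = 2 ^ i * \<epsilon> / 8 * N"
        using \<epsilon> by (simp add: b_def power2_eq_square)
      also have "real k * (\<mu>' + 2 ^ i * \<epsilon> / 8 * N) \<le> real k * (\<mu> + 2 ^ i * \<epsilon> / 8 * N)"
        using le by (intro mult_left_mono) auto
      finally show ?thesis .
    qed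
    then show ?thesis using A(1,2) unfolding b_def by blast
  qed
  then obtain U where U: "\<And>i. U i \<in> sets tapes" "\<And>i. measure tapes (U i) \<le> exp (- real k * (\<epsilon>\<^sup>2 / 1024))"
    "\<And>i \<omega>. \<omega> \<in> space tapes - U i \<Longrightarrow> (\<Sum>t<k. min (a (?J \<omega> t)) (64 * 2 ^ i / \<epsilon> * N)) \<le> real k * (\<mu> + 2 ^ i * \<epsilon> / 8 * N)"
    by metis
  obtain L where L: "L \<in> sets tapes" "measure tapes L \<le> exp (- real k * (\<epsilon>\<^sup>2 / 1024))"
    "\<And>\<omega>. \<omega> \<in> space tapes - L \<Longrightarrow> real k * (\<mu> - \<epsilon> / 4 * N) \<le> (\<Sum>t<k. min (a (?J \<omega> t)) (8 / \<epsilon> * N))"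
  proof -
    define b where "b = 8 / \<epsilon> * N"
    have b: "0 < b" using \<epsilon> N by (simp add: b_def)
    define \<mu>' where "\<mu>' = (\<Sum>e<M. min (a e) b) / real M"
    have "\<mu> - \<mu>' = (\<Sum>e<M. a e - min (a e) b) / real M"
      by (simp add: \<mu>_def \<mu>'_def sum_subtractf diff_divide_distrib)
    \<comment> \<open>The truncation bias: \<open>a - b \<le> a^2 / (4 * b)\<close>, and the second
      moment \<open>4 * N^2\<close> bounds the mean of the right-hand side by
      \<open>\<epsilon> / 8 * N\<close>.\<close>
    also have "\<dots> \<le> (\<Sum>e<M. (a e)\<^sup>2 * (\<epsilon> / (32 * N))) / real M"
    proof (intro divide_right_mono sum_mono)
      fix e
      have "4 * b * (a e - b) \<le> (a e)\<^sup>2"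
        using zero_le_power2[of "a e - 2 * b"] by (simp add: power2_diff power2_eq_square algebra_simps)
      then have "a e - b \<le> (a e)\<^sup>2 / (4 * b)"
        using b by (simp add: pos_le_divide_eq mult.commute)
      also have "\<dots> = (a e)\<^sup>2 * (\<epsilon> / (32 * N))" using \<epsilon> N by (simp add: b_def)
      moreover have "0 \<le> (a e)\<^sup>2 * (\<epsilon> / (32 * N))" using \<epsilon> N by simp
      ultimately show "a e - min (a e) b \<le> (a e)\<^sup>2 * (\<epsilon> / (32 * N))" by (simp add: min_def)
    qed simp
    also have "\<dots> = (\<Sum>e<M. (a e)\<^sup>2) / real M * (\<epsilon> / (32 * N))"
      unfolding sum_distrib_right[symmetric] by simp
    also have "\<dots> \<le> 4 * N\<^sup>2 * (\<epsilon> / (32 * N))"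
      using sq \<epsilon> N by (intro mult_right_mono) auto
    also have "\<dots> = \<epsilon> / 8 * N" using N by (simp add: power2_eq_square)
    finally have le: "\<mu> - \<epsilon> / 8 * N \<le> \<mu>'" by simp
    \<comment> \<open>Chosen so that the variance term is again \<open>\<epsilon>^2 / 1024\<close>.
      The slack divided by \<open>c\<close> is \<open>\<epsilon> / 8 * N\<close>, which together
      with the bias makes \<open>\<epsilon> / 4 * N\<close>.\<close>
    define c where "c = \<epsilon> / (64 * N)"
    have c: "0 < c" using \<epsilon> N by (simp add: c_def)
    have ex: "(- c)\<^sup>2 * (4 * N\<^sup>2) - \<epsilon>\<^sup>2 / 512 \<le> - (\<epsilon>\<^sup>2 / 1024)"
      using N by (simp add: c_def power_divide power_mult_distrib)
    obtain A where A: "A \<in> sets tapes" "measure tapes A \<le> exp (- real k * (\<epsilon>\<^sup>2 / 1024))"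
      "\<And>\<omega>. \<omega> \<in> space tapes - A \<Longrightarrow> - c * (\<Sum>t<k. min (a (?J \<omega> t)) b) \<le> real k * (- c * \<mu>' + \<epsilon>\<^sup>2 / 512)"
    proof (rule sample_mean_tail[OF M _ _ _ \<mu>'_def[symmetric] min_sq ex])
      show "\<bar>- c\<bar> * b \<le> 1" using \<epsilon> N by (simp add: c_def b_def)
    qed (use b bound in auto)
    show ?thesis
    proof (rule that[OF A(1,2)])
      fix \<omega> assume "\<omega> \<in> space tapes - A"
      let ?S = "\<Sum>t<k. min (a (?J \<omega> t)) b"
      have "c * (real k * (\<mu>' - \<epsilon> / 8 * N)) = real k * (c * \<mu>' - \<epsilon>\<^sup>2 / 512)"
        using N by (simp add: c_def power2_eq_square field_simps)
      also have "\<dots> \<le> c * ?S"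
        using A(3)[OF \<open>\<omega> \<in> space tapes - A\<close>] by (simp add: algebra_simps)
      finally have "real k * (\<mu>' - \<epsilon> / 8 * N) \<le> ?S" using c by simp
      moreover have "real k * (\<mu> - \<epsilon> / 4 * N) \<le> real k * (\<mu>' - \<epsilon> / 8 * N)"
        using le by (intro mult_left_mono) auto
      ultimately show "real k * (\<mu> - \<epsilon> / 4 * N) \<le> (\<Sum>t<k. min (a (?J \<omega> t)) (8 / \<epsilon> * N))"
        by (simp add: b_def)
    qed
  qed
  show ?thesis
  proof (rule that[of "L \<union> (\<Union>i\<le>p. U i)"])
    have "measure tapes (L \<union> (\<Union>i\<le>p. U i)) \<le> measure tapes L + measure tapes (\<Union>i\<le>p. U i)"
      using L U by (intro measure_Un_le) auto
    also have "measure tapes (\<Union>i\<le>p. U i) \<le> (\<Sum>i\<le>p. measure tapes (U i))"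
      using U by (intro measure_UNION_le) auto
    also have "\<dots> \<le> (\<Sum>i\<le>p. exp (- real k * (\<epsilon>\<^sup>2 / 1024)))"
      by (intro sum_mono U)
    finally show "measure tapes (L \<union> (\<Union>i\<le>p. U i)) \<le> real (p + 2) * exp (- real k * (\<epsilon>\<^sup>2 / 1024))"
      using L(2) by (simp add: algebra_simps)
    fix \<omega> assume \<omega>: "\<omega> \<in> space tapes - (L \<union> (\<Union>i\<le>p. U i))"
    have J: "0 \<le> a (?J \<omega> t) \<and> a (?J \<omega> t) \<le> 64 * 2 ^ p / \<epsilon> * N" for t
      by (rule bound[OF index_of_less[OF M]])
    from \<omega> robust_sum_estimate[of \<epsilon> N k "\<lambda>t. a (?J \<omega> t)" p \<mu>, OF \<epsilon> N k J]
    show "(1 - \<epsilon>) * N \<le> sqrt (pi / 2) * robust_sum \<epsilon> k (\<lambda>t. a (?J \<omega> t)) p / real k \<and>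
       sqrt (pi / 2) * robust_sum \<epsilon> k (\<lambda>t. a (?J \<omega> t)) p / real k \<le> (1 + \<epsilon>) * N"
      using mean L(3)[of \<omega>] U(3)[of \<omega>] by (simp add: \<mu>_def)
  qed (use L U in auto)
qed

section \<open>The fast transform\<close>

text \<open>The constant-geometry form of a Walsh-Hadamard round: neighbours are combined, sums go
  to the first half and differences to the second. Every round is the same map, so the program needs
  no strides depending on the round.\<close>

definition butterfly :: "nat \<Rightarrow> (nat \<Rightarrow> real) \<Rightarrow> nat \<Rightarrow> real" where
  "butterfly h z i = (if i < h then z (2 * i) + z (2 * i + 1) else z (2 * (i - h)) - z (2 * (i - h) + 1))"

lemma butterfly_cong:
  "(\<And>l. l < 2 * h \<Longrightarrow> z l = w l) \<Longrightarrow> i < 2 * h \<Longrightarrow> butterfly h z i = butterfly h w i"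
  by (simp add: butterfly_def)

lemma butterfly_pow_cong:
  assumes "\<And>l. l < 2 * h \<Longrightarrow> z l = w l" and "i < 2 * h"
  shows "(butterfly h ^^ q) z i = (butterfly h ^^ q) w i"
  using assms(2)
proof (induction q arbitrary: i)
  case (Suc q)
  then show ?case by (auto intro: butterfly_cong)
qed (use assms(1) in simp)

lemma butterfly_pow_sum:
  "(butterfly h ^^ q) (\<lambda>l. \<Sum>k\<in>K. c k * z k l) i = (\<Sum>k\<in>K. c k * (butterfly h ^^ q) (z k) i)"
  by (induction q arbitrary: i)
     (simp_all add: butterfly_def sum.distrib[symmetric] sum_subtractf[symmetric] algebra_simps)

lemma butterfly_pow_diff:
  "(butterfly h ^^ q) (\<lambda>l. z l - w l) i = (butterfly h ^^ q) z i - (butterfly h ^^ q) w i"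
  by (induction q arbitrary: i) (simp_all add: butterfly_def algebra_simps)

lemma sum_even_odd: "(\<Sum>l<2 * h. f l) = (\<Sum>i<h. f (2 * i) + f (2 * i + 1))" for f :: "nat \<Rightarrow> real"
  by (induction h) simp_all

text \<open>The parallelogram identity on each pair of neighbours; up to the factor
  \<open>sqrt 2\<close> a round is orthogonal.\<close>

lemma sum_butterfly_sq: "(\<Sum>i<2 * h. (butterfly h z i)\<^sup>2) = 2 * (\<Sum>l<2 * h. (z l)\<^sup>2)"
proof -
  have "(\<Sum>i<2 * h. (butterfly h z i)\<^sup>2) = (\<Sum>i<h. (butterfly h z i)\<^sup>2) + (\<Sum>i<h. (butterfly h z (i + h))\<^sup>2)"
    using sum.atLeastLessThan_concat[of 0 h "2 * h" "\<lambda>i. (butterfly h z i)\<^sup>2"]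
      sum.shift_bounds_nat_ivl[of "\<lambda>i. (butterfly h z i)\<^sup>2" 0 h h]
    by (simp add: lessThan_atLeast0 mult_2)
  also have "\<dots> = (\<Sum>i<h. 2 * (z (2 * i))\<^sup>2 + 2 * (z (2 * i + 1))\<^sup>2)"
    unfolding sum.distrib[symmetric]
    by (intro sum.cong refl) (simp add: butterfly_def power2_sum power2_diff)
  also have "\<dots> = 2 * (\<Sum>l<2 * h. (z l)\<^sup>2)"
    by (simp add: sum_even_odd sum_distrib_left distrib_left)
  finally show ?thesis .
qed

lemma sum_butterfly_pow_sq: "(\<Sum>i<2 * h. ((butterfly h ^^ q) z i)\<^sup>2) = 2 ^ q * (\<Sum>l<2 * h. (z l)\<^sup>2)"
  by (induction q) (simp_all add: sum_butterfly_sq)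

abbreviation unit_vec :: "nat \<Rightarrow> nat \<Rightarrow> real" where
  "unit_vec l i \<equiv> (if i = l then 1 else 0)"

text \<open>
  After \<open>q\<close> rounds every entry is a signed sum of the input over one block of length \<open>2 ^ q\<close>.
\<close>

lemma abs_butterfly_pow_unit:
  assumes h: "h = 2 ^ p" and l: "l < 2 * h"
  shows "q \<le> Suc p \<Longrightarrow> i < 2 * h \<Longrightarrow>
    \<bar>(butterfly h ^^ q) (unit_vec l) i\<bar> = (if l div 2 ^ q = i mod 2 ^ (Suc p - q) then 1 else 0)"
proof (induction q arbitrary: i)
  case 0
  then show ?case using h by auto
next
  case (Suc q)
  define u where "u = (butterfly h ^^ q) (unit_vec l)"
  define i' where "i' = (if i < h then i else i - h)"
  define r where "r = p - q"
  define L where "L = l div 2 ^ q"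
  have i': "i' < h" "2 * i' < 2 * h" "2 * i' + 1 < 2 * h" using Suc.prems by (auto simp: i'_def)
  have r: "Suc p - q = Suc r" "Suc p - Suc q = r" "r \<le> p" using Suc.prems by (auto simp: r_def)
  have "h = 2 ^ r * 2 ^ (p - r)"
    using r(3) by (simp add: h power_add[symmetric])
  moreover have "i = i' \<or> i = i' + h" by (auto simp: i'_def)
  ultimately have mod: "i' mod 2 ^ r = i mod 2 ^ r" by auto
  have u: "\<bar>u (2 * i')\<bar> = (if L = 2 * (i' mod 2 ^ r) then 1 else 0)"
      "\<bar>u (2 * i' + 1)\<bar> = (if L = 2 * (i' mod 2 ^ r) + 1 then 1 else 0)"
  proof -
    have "2 * i' mod 2 ^ Suc r = 2 * (i' mod 2 ^ r)" "(2 * i' + 1) mod 2 ^ Suc r = 2 * (i' mod 2 ^ r) + 1"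
      by (simp_all only: power_Suc mod_mult2_eq) simp_all
    then show "\<bar>u (2 * i')\<bar> = (if L = 2 * (i' mod 2 ^ r) then 1 else 0)"
      "\<bar>u (2 * i' + 1)\<bar> = (if L = 2 * (i' mod 2 ^ r) + 1 then 1 else 0)"
      using Suc.IH[OF _ i'(2)] Suc.IH[OF _ i'(3)] Suc.prems unfolding u_def L_def r(1)
      by (simp_all del: power_Suc)
  qed
  \<comment> \<open>At most one of the two neighbours is nonzero, so nothing cancels and the
    absolute values add.\<close>
  have "\<bar>butterfly h u i\<bar> = \<bar>u (2 * i')\<bar> + \<bar>u (2 * i' + 1)\<bar>"
  proof -
    have "butterfly h u i = u (2 * i') + u (2 * i' + 1) \<or> butterfly h u i = u (2 * i') - u (2 * i' + 1)"
      by (simp add: butterfly_def i'_def)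
    moreover have "u (2 * i') = 0 \<or> u (2 * i' + 1) = 0"
      using u by (cases "L = 2 * (i' mod 2 ^ r)") simp_all
    ultimately show ?thesis by (elim disjE) simp_all
  qed
  also have "\<dots> = (if L div 2 = i' mod 2 ^ r then 1 else 0)"
    unfolding u by (cases "L = 2 * (i' mod 2 ^ r)"; cases "L = 2 * (i' mod 2 ^ r) + 1"; simp; presburger)
  also have "L div 2 = l div 2 ^ Suc q"
    unfolding L_def power_Suc2 div_mult2_eq ..
  finally show ?case unfolding r(2) mod by (simp add: u_def)
qed

lemma sum_blocks: "(\<Sum>e<m * D. f e) = (\<Sum>j<m. \<Sum>a<D. f (j * D + a))" for f :: "nat \<Rightarrow> real"
proof -
  have "(\<Sum>e<m * D. f e) = (\<Sum>j<m. sum f {j * D..<j * D + D})"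
    by (rule sum.nat_group[symmetric])
  also have "\<dots> = (\<Sum>j<m. \<Sum>a<D. f (j * D + a))"
  proof (rule sum.cong[OF refl])
    fix j
    show "sum f {j * D..<j * D + D} = (\<Sum>a<D. f (j * D + a))"
      using sum.shift_bounds_nat_ivl[of f 0 "j * D" D] by (simp add: lessThan_atLeast0 add.commute)
  qed
  finally show ?thesis .
qed

definition transform_entry :: "nat \<Rightarrow> nat \<Rightarrow> nat \<Rightarrow> real" where
  "transform_entry p i l = (butterfly (2 ^ p) ^^ Suc p) (unit_vec l) i"

lemma transform_entry_sq:
  assumes "i < 2 ^ Suc p" "l < 2 ^ Suc p"
  shows "(transform_entry p i l)\<^sup>2 = 1" and "\<bar>transform_entry p i l\<bar> = 1"
proof -
  show abs: "\<bar>transform_entry p i l\<bar> = 1"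
    unfolding transform_entry_def using abs_butterfly_pow_unit[of "2 ^ p" p l "Suc p" i] assms by simp
  show "(transform_entry p i l)\<^sup>2 = 1"
    using arg_cong[OF abs, of "\<lambda>x. x\<^sup>2"] by simp
qed

lemma butterfly_transform:
  assumes "i < 2 ^ Suc p"
  shows "(butterfly (2 ^ p) ^^ Suc p) z i = (\<Sum>l<2 ^ Suc p. transform_entry p i l * z l)"
proof -
  have "(butterfly (2 ^ p) ^^ Suc p) z i = (butterfly (2 ^ p) ^^ Suc p) (\<lambda>l. \<Sum>k<2 ^ Suc p. z k * unit_vec k l) i"
    using assms by (intro butterfly_pow_cong) (simp_all add: if_distrib[of "\<lambda>x. _ * x"] cong: if_cong)
  also have "\<dots> = (\<Sum>k<2 ^ Suc p. z k * transform_entry p i k)"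
    by (subst butterfly_pow_sum) (simp add: transform_entry_def)
  finally show ?thesis by (simp add: mult.commute)
qed

section \<open>The block transform as a Gaussian sketch, uniformly in the vector\<close>

definition block_entry :: "nat \<Rightarrow> nat \<Rightarrow> nat \<Rightarrow> real" where
  "block_entry p e i = (if i div 2 ^ Suc p = e div 2 ^ Suc p
     then transform_entry p (e mod 2 ^ Suc p) (i mod 2 ^ Suc p) else 0)"

lemma block_sum:
  assumes "e < m * 2 ^ Suc p"
  shows "(\<Sum>i<m * 2 ^ Suc p. block_entry p e i * z i) =
    (\<Sum>l<2 ^ Suc p. transform_entry p (e mod 2 ^ Suc p) l * z (e div 2 ^ Suc p * 2 ^ Suc p + l))"
proof -
  let ?D = "2 ^ Suc p :: nat"
  have "(\<Sum>i<m * ?D. block_entry p e i * z i) = (\<Sum>j<m. \<Sum>l<?D. block_entry p e (j * ?D + l) * z (j * ?D + l))"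
    by (rule sum_blocks)
  also have "\<dots> = (\<Sum>j<m. if j = e div ?D then \<Sum>l<?D. transform_entry p (e mod ?D) l * z (j * ?D + l) else 0)"
    by (intro sum.cong refl) (auto simp: block_entry_def simp del: power_Suc)
  also have "\<dots> = (\<Sum>l<?D. transform_entry p (e mod ?D) l * z (e div ?D * ?D + l))"
    using less_mult_imp_div_less[OF assms] by simp
  finally show ?thesis .
qed

text \<open>A row meets each residue class modulo \<open>D\<close> in exactly one index of its own
  block, with entry 1 or -1, whence \<open>col\<close>. Each block multiplies squared norms by
  exactly \<open>D\<close>, whence \<open>op\<close>.\<close>

lemma gaussian_sketch_block_entry:
  assumes "0 < m"
  shows "gaussian_sketch m (2 ^ Suc p) (block_entry p)"
proof
  let ?D = "2 ^ Suc p :: nat"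
  show "0 < m" "0 < ?D" using assms by auto
  fix e l :: nat assume e: "e < m * ?D" and l: "l < ?D"
  define i0 where "i0 = e div ?D * ?D + l"
  have i0: "i0 < m * ?D" "i0 mod ?D = l" "i0 div ?D = e div ?D"
  proof -
    have "Suc (e div ?D) * ?D \<le> m * ?D"
      using less_mult_imp_div_less[OF e] by (intro mult_right_mono) auto
    then show "i0 < m * ?D" using l by (simp add: i0_def del: power_Suc)
  qed (use l in \<open>auto simp: i0_def simp del: power_Suc\<close>)
  have "(\<Sum>i | i < m * ?D \<and> i mod ?D = l. (block_entry p e i)\<^sup>2) = (\<Sum>i\<in>{i0}. (block_entry p e i)\<^sup>2)"
  proof (rule sum.mono_neutral_right)
    show "\<forall>i\<in>{i. i < m * ?D \<and> i mod ?D = l} - {i0}. (block_entry p e i)\<^sup>2 = 0"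
    proof
      fix i assume i: "i \<in> {i. i < m * ?D \<and> i mod ?D = l} - {i0}"
      then have "i div ?D \<noteq> e div ?D"
        using div_mult_mod_eq[of i ?D] by (auto simp: i0_def simp del: power_Suc)
      then show "(block_entry p e i)\<^sup>2 = 0" by (simp add: block_entry_def del: power_Suc)
    qed
  qed (use i0 in auto)
  also have "\<dots> = 1"
    using i0 l by (simp add: block_entry_def transform_entry_sq del: power_Suc)
  finally show "(\<Sum>i | i < m * ?D \<and> i mod ?D = l. (block_entry p e i)\<^sup>2) = 1" .
next
  let ?D = "2 ^ Suc p :: nat"
  fix z :: "nat \<Rightarrow> real"
  have "(\<Sum>e<m * ?D. (\<Sum>i<m * ?D. block_entry p e i * z i)\<^sup>2) =
      (\<Sum>j<m. \<Sum>a<?D. (\<Sum>i<m * ?D. block_entry p (j * ?D + a) i * z i)\<^sup>2)"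
    by (rule sum_blocks)
  also have "\<dots> = (\<Sum>j<m. \<Sum>a<?D. ((butterfly (2 ^ p) ^^ Suc p) (\<lambda>l. z (j * ?D + l)) a)\<^sup>2)"
  proof (intro sum.cong refl arg_cong[where f = "\<lambda>x. x\<^sup>2"])
    fix j a assume j: "j \<in> {..<m}" and a: "a \<in> {..<?D}"
    have "Suc j * ?D \<le> m * ?D" using j by (intro mult_right_mono) auto
    then have "j * ?D + a < m * ?D" using a by (simp del: power_Suc)
    then show "(\<Sum>i<m * ?D. block_entry p (j * ?D + a) i * z i) = (butterfly (2 ^ p) ^^ Suc p) (\<lambda>l. z (j * ?D + l)) a"
      using a by (subst block_sum) (simp_all add: butterfly_transform del: power_Suc funpow.simps)
  qed
  also have "\<dots> = (\<Sum>j<m. real ?D * (\<Sum>a<?D. (z (j * ?D + a))\<^sup>2))"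
    using sum_butterfly_pow_sq[where h = "2 ^ p" and q = "Suc p"] by (simp del: funpow.simps)
  also have "\<dots> = real ?D * (\<Sum>i<m * ?D. (z i)\<^sup>2)"
    by (simp add: sum_blocks sum_distrib_left del: power_Suc)
  finally show "(\<Sum>e<m * ?D. (\<Sum>i<m * ?D. block_entry p e i * z i)\<^sup>2) \<le> real ?D * (\<Sum>i<m * ?D. (z i)\<^sup>2)"
    by simp
qed

text \<open>
  \<open>sketch_coord p g v e\<close> is coordinate \<open>e\<close> of the sketch of \<open>v\<close>: the copy \<open>e div D\<close> of the transform,
  with \<open>D = 2 ^ Suc p\<close>, is applied to \<open>v\<close> multiplied by the corresponding block of \<open>g\<close>.
\<close>

definition sketch_coord :: "nat \<Rightarrow> (nat \<Rightarrow> real) \<Rightarrow> (nat \<Rightarrow> real) \<Rightarrow> nat \<Rightarrow> real" where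
  "sketch_coord p g v e = (butterfly (2 ^ p) ^^ Suc p) (\<lambda>l. g (e div 2 ^ Suc p * 2 ^ Suc p + l) * v l) (e mod 2 ^ Suc p)"

lemma sketch_coord_diff: "sketch_coord p g v e - sketch_coord p g w e = sketch_coord p g (\<lambda>l. v l - w l) e"
  by (simp add: sketch_coord_def butterfly_pow_diff[symmetric] right_diff_distrib del: funpow.simps)

lemma sketch_coord_eq_coord:
  assumes "0 < m" "e < m * 2 ^ Suc p"
  shows "gaussian_sketch.coord m (2 ^ Suc p) (block_entry p) g v e = sketch_coord p g v e"
proof -
  interpret gaussian_sketch m "2 ^ Suc p" "block_entry p"
    by (rule gaussian_sketch_block_entry[OF assms(1)])
  let ?D = "2 ^ Suc p :: nat"
  show ?thesis
    unfolding coord_def sketch_coord_def block_sum[OF assms(2)]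
    by (subst butterfly_transform) (auto intro!: sum.cong simp del: power_Suc funpow.simps)
qed

text \<open>The interface between the two sources of randomness. It concerns \<open>g\<close> alone
  and quantifies over all \<open>v\<close>, so it survives every adaptive choice of queries and
  points; its three clauses are what sampling for a fixed \<open>v\<close> requires.\<close>

definition good_sketch :: "nat \<Rightarrow> nat \<Rightarrow> real \<Rightarrow> (nat \<Rightarrow> real) \<Rightarrow> bool" where
  "good_sketch p m \<epsilon> g \<longleftrightarrow> (\<forall>v N. N = L2_set v {..<2 ^ Suc p} \<longrightarrow>
     (\<forall>e<m * 2 ^ Suc p. \<bar>sketch_coord p g v e\<bar> \<le> 64 * 2 ^ Suc p / \<epsilon> * N) \<and>
     \<bar>(\<Sum>e<m * 2 ^ Suc p. \<bar>sketch_coord p g v e\<bar>) / real (m * 2 ^ Suc p) - sqrt (2 / pi) * N\<bar> \<le> \<epsilon> / 4 * N \<and>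
     (\<Sum>e<m * 2 ^ Suc p. (sketch_coord p g v e)\<^sup>2) / real (m * 2 ^ Suc p) \<le> 4 * N\<^sup>2)"

lemma good_sketch_event:
  assumes \<epsilon>: "0 < \<epsilon>" "\<epsilon> < 1" and \<Lambda>: "64 * 2 ^ Suc p / \<epsilon> \<le> 2 ^ \<Lambda>"
    and E: "16384 / \<epsilon>\<^sup>2 \<le> real E" and mE: "m = E * (\<Lambda> + 1)\<^sup>2 * (\<Lambda> + q + 1)"
  shows "with_prob (1 - (1 / 2) ^ q) (\<lambda>\<omega>. good_sketch p m \<epsilon> (\<lambda>i. clip (8 / \<epsilon>) (fst (\<omega> i))))"
proof -
  let ?D = "2 ^ Suc p :: nat"
  have "0 < E" using E \<epsilon> by (cases "E = 0") (auto simp: field_simps)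
  then have m: "0 < m" by (simp add: mE)
  interpret gaussian_sketch m ?D "block_entry p"
    by (rule gaussian_sketch_block_entry[OF m])
  have "real ?D \<le> 64 * 2 ^ Suc p / \<epsilon>"
    using \<epsilon> by (simp add: field_simps)
  with \<Lambda> have "real ?D \<le> real (2 ^ \<Lambda>)" by simp
  then have D2: "?D \<le> 2 ^ \<Lambda>" by (simp only: of_nat_le_iff)
  obtain A where A: "A \<in> sets gaussians" "1 - (1 / 2) ^ q \<le> measure gaussians A" "\<And>x. x \<in> A \<Longrightarrow> good_matrix \<epsilon> \<Lambda> x"
    using good_matrix_event[OF \<epsilon> D2 E mE] by blast
  obtain B where B: "B \<in> sets tapes" "measure tapes B = measure gaussians A"
    "\<And>\<omega>. \<omega> \<in> B \<Longrightarrow> (\<lambda>i\<in>{..<m * ?D}. fst (\<omega> i)) \<in> A"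
    using gaussian_event_on_tapes[OF A(1)] by blast
  have "good_sketch p m \<epsilon> (\<lambda>i. clip (8 / \<epsilon>) (fst (\<omega> i)))" if "\<omega> \<in> B" for \<omega>
    unfolding good_sketch_def
  proof (intro allI impI)
    fix v N assume N: "N = L2_set v {..<?D}"
    let ?g = "\<lambda>i. clip (8 / \<epsilon>) (fst (\<omega> i))"
    define x where "x = (\<lambda>i\<in>{..<m * ?D}. fst (\<omega> i))"
    have good: "good_matrix \<epsilon> \<Lambda> x" using A(3) B(3)[OF that] by (simp add: x_def)
    have coord: "coord (\<lambda>i. clip (8 / \<epsilon>) (x i)) v e = sketch_coord p ?g v e" if "e < m * ?D" for e
    proof -
      have "coord (\<lambda>i. clip (8 / \<epsilon>) (x i)) v e = coord ?g v e"
        unfolding coord_def by (intro sum.cong) (simp_all add: x_def del: power_Suc)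
      then show ?thesis using sketch_coord_eq_coord[OF m that, of ?g v] by simp
    qed
    have N0: "0 \<le> N" by (simp add: N L2_set_nonneg)
    \<comment> \<open>Crude, but valid for every outcome: \<open>D\<close> terms with signs, each at
      most \<open>8 / \<epsilon> * N\<close> by clipping. The factor is weakened to 64 to fit the
      first truncation level.\<close>
    have "\<bar>sketch_coord p ?g v e\<bar> \<le> 64 * 2 ^ Suc p / \<epsilon> * N" if "e < m * ?D" for e
    proof -
      have "\<bar>sketch_coord p ?g v e\<bar> \<le> (\<Sum>l<?D. \<bar>transform_entry p (e mod ?D) l * (?g (e div ?D * ?D + l) * v l)\<bar>)"
        unfolding sketch_coord_def by (subst butterfly_transform) (simp_all del: power_Suc funpow.simps)
      also have "\<dots> \<le> (\<Sum>l<?D. 8 / \<epsilon> * N)"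
      proof (rule sum_mono)
        fix l assume l: "l \<in> {..<?D}"
        have "\<bar>v l\<bar> \<le> N"
          unfolding N using l member_le_L2_set[of "{..<?D}" l "\<lambda>i. \<bar>v i\<bar>"] by (simp add: L2_set_def del: power_Suc)
        then have "\<bar>?g (e div ?D * ?D + l)\<bar> * \<bar>v l\<bar> \<le> 8 / \<epsilon> * N"
          using \<epsilon> by (intro mult_mono abs_clip_le) auto
        then show "\<bar>transform_entry p (e mod ?D) l * (?g (e div ?D * ?D + l) * v l)\<bar> \<le> 8 / \<epsilon> * N"
          using l by (simp add: abs_mult transform_entry_sq del: power_Suc)
      qed
      also have "\<dots> = 8 * 2 ^ Suc p / \<epsilon> * N" by simp
      also have "\<dots> \<le> 64 * 2 ^ Suc p / \<epsilon> * N"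
        using \<epsilon> N0 by (intro mult_right_mono divide_right_mono) auto
      finally show ?thesis .
    qed
    moreover have f1: "(\<Sum>e<m * ?D. \<bar>sketch_coord p ?g v e\<bar>) / real (m * ?D) = mean_abs 0 v (\<lambda>i. clip (8 / \<epsilon>) (x i))"
      unfolding mean_abs_def by (simp add: coord del: power_Suc)
    moreover have f2: "(\<Sum>e<m * ?D. (sketch_coord p ?g v e)\<^sup>2) / real (m * ?D) =
        (\<Sum>e<m * ?D. (coord (\<lambda>i. clip (8 / \<epsilon>) (x i)) v e)\<^sup>2) / real (m * ?D)"
      by (simp add: coord del: power_Suc)
    ultimately show "(\<forall>e<m * ?D. \<bar>sketch_coord p ?g v e\<bar> \<le> 64 * 2 ^ Suc p / \<epsilon> * N) \<and>
     \<bar>(\<Sum>e<m * ?D. \<bar>sketch_coord p ?g v e\<bar>) / real (m * ?D) - sqrt (2 / pi) * N\<bar> \<le> \<epsilon> / 4 * N \<and>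
     (\<Sum>e<m * ?D. (sketch_coord p ?g v e)\<^sup>2) / real (m * ?D) \<le> 4 * N\<^sup>2"
      unfolding f1 f2 N[symmetric]
      using good_matrix_mean_sq[OF good \<epsilon>(1), of v, folded N] good_matrix_mean_abs[OF good \<epsilon>(1), of v, folded N] \<Lambda>
      by (simp only: of_nat_power of_nat_numeral) blast
  qed
  then show ?thesis
    unfolding with_prob_def using A(2) B by (intro bexI[of _ B]) auto
qed

text \<open>The sampled coordinates are shared by all points of the database, so their failures are only added up.\<close>

lemma good_sketch_query:
  assumes good: "good_sketch p m \<epsilon> g" and \<epsilon>: "0 < \<epsilon>" "\<epsilon> < 1 / 2" and m: "0 < m" and k: "0 < k"
    and fail: "real n * (real (p + 3) * exp (- real k * (\<epsilon>\<^sup>2 / 1024))) \<le> \<delta>"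
  shows "with_prob (1 - \<delta>) (\<lambda>\<omega>. \<forall>i<n.
    let r = sqrt (pi / 2) * robust_sum \<epsilon> k (\<lambda>t. \<bar>sketch_coord p g (v i) (index_of (m * 2 ^ Suc p) (snd (\<omega> t)))\<bar>) (Suc p) / real k;
        N = L2_set (v i) {..<2 ^ Suc p}
    in (1 - \<epsilon>) * N \<le> r \<and> r \<le> (1 + \<epsilon>) * N)"
proof -
  let ?M = "m * 2 ^ Suc p"
  have M: "0 < ?M" using m by simp
  define ok where "ok i \<omega> \<longleftrightarrow>
    (1 - \<epsilon>) * L2_set (v i) {..<2 ^ Suc p} \<le> sqrt (pi / 2) * robust_sum \<epsilon> k (\<lambda>t. \<bar>sketch_coord p g (v i) (index_of ?M (snd (\<omega> t)))\<bar>) (Suc p) / real k \<and>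
    sqrt (pi / 2) * robust_sum \<epsilon> k (\<lambda>t. \<bar>sketch_coord p g (v i) (index_of ?M (snd (\<omega> t)))\<bar>) (Suc p) / real k \<le> (1 + \<epsilon>) * L2_set (v i) {..<2 ^ Suc p}" for i and \<omega> :: tape
  have "\<exists>A. A \<in> sets tapes \<and> measure tapes A \<le> real (p + 3) * exp (- real k * (\<epsilon>\<^sup>2 / 1024)) \<and> (\<forall>\<omega>\<in>space tapes - A. ok i \<omega>)" for i
  proof -
    let ?a = "\<lambda>e. \<bar>sketch_coord p g (v i) e\<bar>"
    have g: "(\<forall>e<?M. ?a e \<le> 64 * 2 ^ Suc p / \<epsilon> * L2_set (v i) {..<2 ^ Suc p}) \<and>
       \<bar>(\<Sum>e<?M. ?a e) / real ?M - sqrt (2 / pi) * L2_set (v i) {..<2 ^ Suc p}\<bar> \<le> \<epsilon> / 4 * L2_set (v i) {..<2 ^ Suc p} \<and>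
       (\<Sum>e<?M. (?a e)\<^sup>2) / real ?M \<le> 4 * (L2_set (v i) {..<2 ^ Suc p})\<^sup>2"
      using good unfolding good_sketch_def power2_abs by blast
    \<comment> \<open>\<open>Suc p\<close> rounds match the a priori bound
      \<open>64 * 2 ^ Suc p / \<epsilon> * N\<close>, hence \<open>Suc p + 2\<close> events per
      point.\<close>
    obtain A where "A \<in> sets tapes" "measure tapes A \<le> real (Suc p + 2) * exp (- real k * (\<epsilon>\<^sup>2 / 1024))"
      "\<And>\<omega>. \<omega> \<in> space tapes - A \<Longrightarrow> ok i \<omega>"
      unfolding ok_def
      by (rule robust_sum_event[OF M \<epsilon> L2_set_nonneg[of "v i" "{..<2 ^ Suc p}"] k, of ?a "Suc p"])
        (use g in \<open>auto simp del: power_Suc\<close>)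
    then show ?thesis by (intro exI[of _ A]) (simp add: numeral_3_eq_3)
  qed
  then obtain A where A: "\<And>i. A i \<in> sets tapes" "\<And>i. measure tapes (A i) \<le> real (p + 3) * exp (- real k * (\<epsilon>\<^sup>2 / 1024))"
    "\<And>i \<omega>. \<omega> \<in> space tapes - A i \<Longrightarrow> ok i \<omega>"
    by metis
  have "measure tapes (\<Union>i<n. A i) \<le> (\<Sum>i<n. measure tapes (A i))"
    using A by (intro measure_UNION_le) auto
  also have "\<dots> \<le> (\<Sum>i<n. real (p + 3) * exp (- real k * (\<epsilon>\<^sup>2 / 1024)))"
    by (intro sum_mono A)
  also have "\<dots> \<le> \<delta>" using fail by simp
  finally have "1 - \<delta> \<le> measure tapes (space tapes - (\<Union>i<n. A i))"
    using A prob_space.prob_compl[OF prob_space_tapes, of "\<Union>i<n. A i"] by auto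
  moreover have "\<forall>i<n. ok i \<omega>" if "\<omega> \<in> space tapes - (\<Union>i<n. A i)" for \<omega>
    using A(3) that by auto
  ultimately show ?thesis
    unfolding with_prob_def Let_def ok_def using A(1)
    by (intro bexI[of _ "space tapes - (\<Union>i<n. A i)"]) auto
qed

section \<open>Reasoning about programs\<close>

text \<open>A total-correctness triple with a time budget, for one fixed tape. The postcondition
  also sees the position of the head, so that samples can be identified with cells of the
  tape.\<close>

definition completes :: "tape \<Rightarrow> com \<Rightarrow> mem \<Rightarrow> nat \<Rightarrow> nat \<Rightarrow> (mem \<Rightarrow> nat \<Rightarrow> bool) \<Rightarrow> bool" where
  "completes \<omega> c s p T Q \<longleftrightarrow> (\<exists>t s' p'. exec \<omega> c (s, p) t (s', p') \<and> t \<le> T \<and> Q s' p')"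

lemma completes_mono:
  "completes \<omega> c s p T Q \<Longrightarrow> T \<le> T' \<Longrightarrow> (\<And>s' p'. Q s' p' \<Longrightarrow> Q' s' p') \<Longrightarrow> completes \<omega> c s p T' Q'"
  unfolding completes_def by (meson order_trans)

lemma completes_seq:
  assumes "completes \<omega> c s p T R" and "\<And>s' p'. R s' p' \<Longrightarrow> completes \<omega> c' s' p' T' Q"
  shows "completes \<omega> (Seq c c') s p (T + T') Q"
proof -
  obtain t s' p' where 1: "exec \<omega> c (s, p) t (s', p')" "t \<le> T" "R s' p'"
    using assms(1) by (auto simp: completes_def)
  obtain t' s'' p'' where 2: "exec \<omega> c' (s', p') t' (s'', p'')" "t' \<le> T'" "Q s'' p''"
    using assms(2)[OF 1(3)] by (auto simp: completes_def)
  show ?thesis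
    unfolding completes_def using exec.Seq[OF 1(1) 2(1)] 1(2) 2(2,3) by (meson add_mono)
qed

primrec loop_free :: "com \<Rightarrow> bool" where
  "loop_free Skip = True"
| "loop_free (NAssign a i e) = True"
| "loop_free (RAssign a i e) = True"
| "loop_free (SampleNormal a i) = True"
| "loop_free (SampleIndex a i e) = True"
| "loop_free (Seq c c') = (loop_free c \<and> loop_free c')"
| "loop_free (Cond b c c') = (loop_free c \<and> loop_free c')"
| "loop_free (While b c) = False"

primrec com_cost :: "com \<Rightarrow> nat" where
  "com_cost Skip = 1"
| "com_cost (NAssign a i e) = 1 + ncost i + ncost e"
| "com_cost (RAssign a i e) = 1 + ncost i + rcost e"
| "com_cost (SampleNormal a i) = 1 + ncost i"
| "com_cost (SampleIndex a i e) = 1 + ncost i + ncost e"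
| "com_cost (Seq c c') = com_cost c + com_cost c'"
| "com_cost (Cond b c c') = 1 + bcost b + (com_cost c + com_cost c')"
| "com_cost (While b c) = 0"

text \<open>Meaningful for loop-free programs only; the value at a loop is irrelevant.\<close>

primrec effect :: "tape \<Rightarrow> com \<Rightarrow> mem \<times> nat \<Rightarrow> mem \<times> nat" where
  "effect \<omega> Skip u = u"
| "effect \<omega> (NAssign a i e) u = (set_nat a (nval i (fst u)) (nval e (fst u)) (fst u), snd u)"
| "effect \<omega> (RAssign a i e) u = (set_real a (nval i (fst u)) (rval e (fst u)) (fst u), snd u)"
| "effect \<omega> (SampleNormal a i) u = (set_real a (nval i (fst u)) (fst (\<omega> (snd u))) (fst u), Suc (snd u))"
| "effect \<omega> (SampleIndex a i e) u =
     (set_nat a (nval i (fst u)) (index_of (nval e (fst u)) (snd (\<omega> (snd u)))) (fst u), Suc (snd u))"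
| "effect \<omega> (Seq c c') u = effect \<omega> c' (effect \<omega> c u)"
| "effect \<omega> (Cond b c c') u = (if bval b (fst u) then effect \<omega> c u else effect \<omega> c' u)"
| "effect \<omega> (While b c) u = u"

lemma exec_effect:
  "loop_free c \<Longrightarrow> \<exists>t. exec \<omega> c u t (effect \<omega> c u) \<and> t \<le> com_cost c"
proof (induction c arbitrary: u)
  case (Seq c c')
  then obtain t t' where "exec \<omega> c u t (effect \<omega> c u)" "t \<le> com_cost c"
    "exec \<omega> c' (effect \<omega> c u) t' (effect \<omega> c' (effect \<omega> c u))" "t' \<le> com_cost c'"
    by (meson loop_free.simps)
  then show ?case by (auto intro!: exI[of _ "t + t'"] exec.Seq)
next
  case (Cond b c c')
  obtain s p where u: "u = (s, p)" by (cases u)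
  obtain t t' where "exec \<omega> c u t (effect \<omega> c u)" "t \<le> com_cost c"
    "exec \<omega> c' u t' (effect \<omega> c' u)" "t' \<le> com_cost c'"
    using Cond by (meson loop_free.simps)
  then have "exec \<omega> (Cond b c c') u (1 + bcost b + (if bval b s then t else t')) (effect \<omega> (Cond b c c') u)"
    using exec.CondTrue[of b s \<omega> c p t] exec.CondFalse[of b s \<omega> c' p t'] by (simp add: u)
  moreover have "1 + bcost b + (if bval b s then t else t') \<le> com_cost (Cond b c c')"
    using \<open>t \<le> com_cost c\<close> \<open>t' \<le> com_cost c'\<close> by simp
  ultimately show ?case by blast
next
  case Skip
  show ?case using exec.Skip[of \<omega> "fst u" "snd u"] by fastforce
next
  case (NAssign a i e)
  show ?case using exec.NAssign[of \<omega> a i e "fst u" "snd u"] by fastforce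
next
  case (RAssign a i e)
  show ?case using exec.RAssign[of \<omega> a i e "fst u" "snd u"] by fastforce
next
  case (SampleNormal a i)
  show ?case using exec.SampleNormal[of \<omega> a i "fst u" "snd u"] by fastforce
next
  case (SampleIndex a i e)
  show ?case using exec.SampleIndex[of \<omega> a i e "fst u" "snd u"] by fastforce
qed simp

text \<open>Reduces straight-line code to simplification. For a conditional, \<open>com_cost\<close>
  adds both branches, which overestimates the time by a constant only.\<close>

lemma completes_loop_free:
  assumes "loop_free c" "com_cost c \<le> T" "Q (fst (effect \<omega> c (s, p))) (snd (effect \<omega> c (s, p)))"
  shows "completes \<omega> c s p T Q"
  using exec_effect[OF assms(1), of \<omega> "(s, p)"] assms(2,3)
  unfolding completes_def by (metis order_trans prod.collapse)

lemma completes_while: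
  assumes init: "Inv 0 s p"
    and body: "\<And>k s p. k < N \<Longrightarrow> Inv k s p \<Longrightarrow> bval b s \<and> completes \<omega> c s p T (Inv (Suc k))"
    and exit: "\<And>s p. Inv N s p \<Longrightarrow> \<not> bval b s"
  shows "completes \<omega> (While b c) s p (N * (T + bcost b + 1) + bcost b + 1) (Inv N)"
proof -
  have "completes \<omega> (While b c) s p (j * (T + bcost b + 1) + bcost b + 1) (Inv N)"
    if "j \<le> N" "Inv (N - j) s p" for j s p
    using that
  proof (induction j arbitrary: s p)
    case 0
    then show ?case
      using exec.WhileFalse[of b s \<omega> c p] exit[of s p] unfolding completes_def by fastforce
  next
    case (Suc j)
    have "N - Suc j < N" and eq: "Suc (N - Suc j) = N - j" using Suc.prems by auto
    then have "bval b s" and "completes \<omega> c s p T (Inv (N - j))"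
      using body[of "N - Suc j" s p] Suc.prems by auto
    then obtain t s' p' where 1: "exec \<omega> c (s, p) t (s', p')" "t \<le> T" "Inv (N - j) s' p'"
      by (auto simp: completes_def)
    obtain t' s'' p'' where 2: "exec \<omega> (While b c) (s', p') t' (s'', p'')"
      "t' \<le> j * (T + bcost b + 1) + bcost b + 1" "Inv N s'' p''"
      using Suc.IH[OF _ 1(3)] Suc.prems by (auto simp: completes_def)
    have "exec \<omega> (While b c) (s, p) (1 + bcost b + t + t') (s'', p'')"
      by (rule exec.WhileTrue[OF \<open>bval b s\<close> 1(1) 2(1)])
    moreover have "1 + bcost b + t + t' \<le> Suc j * (T + bcost b + 1) + bcost b + 1"
      using 1(2) 2(2) by simp
    ultimately show ?case unfolding completes_def using 2(3) by blast
  qed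
  from this[of N s p] init show ?thesis by simp
qed

lemma nats_set_nat [simp]: "nats (set_nat a i v s) b j = (if b = a \<and> j = i then v else nats s b j)"
  and reals_set_nat [simp]: "reals (set_nat a i v s) = reals s"
  and nats_set_real [simp]: "nats (set_real a i x s) = nats s"
  and reals_set_real [simp]: "reals (set_real a i x s) b j = (if b = a \<and> j = i then x else reals s b j)"
  by (auto simp: set_nat_def set_real_def)

definition frame :: "name set \<Rightarrow> name set \<Rightarrow> mem \<Rightarrow> mem \<Rightarrow> bool" where
  "frame N R s s' \<longleftrightarrow> (\<forall>a. a \<notin> N \<longrightarrow> nats s' a = nats s a) \<and> (\<forall>a. a \<notin> R \<longrightarrow> reals s' a = reals s a)"

lemma frame_refl [simp]: "frame N R s s"
  by (simp add: frame_def)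

lemma frame_nats: "frame N R s s' \<Longrightarrow> a \<notin> N \<Longrightarrow> nats s' a = nats s a"
  and frame_reals: "frame N R s s' \<Longrightarrow> a \<notin> R \<Longrightarrow> reals s' a = reals s a"
  by (auto simp: frame_def)

lemma frame_set_nat [simp]: "a \<in> N \<Longrightarrow> frame N R s (set_nat a i v s') \<longleftrightarrow> frame N R s s'"
  and frame_set_real [simp]: "a \<in> R \<Longrightarrow> frame N R s (set_real a i x s') \<longleftrightarrow> frame N R s s'"
  by (auto simp: frame_def set_nat_def set_real_def)

lemma frame_trans: "frame N R s s' \<Longrightarrow> frame N' R' s' s'' \<Longrightarrow> N \<subseteq> N'' \<Longrightarrow> N' \<subseteq> N'' \<Longrightarrow> R \<subseteq> R'' \<Longrightarrow> R' \<subseteq> R''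
    \<Longrightarrow> frame N'' R'' s s''"
  unfolding frame_def by (metis subsetD)

abbreviation seq_com (infixr ";;" 60) where "c ;; c' \<equiv> Seq c c'"
abbreviation NV :: "name \<Rightarrow> nexp" where "NV a \<equiv> NCell a (NConst 0)"
abbreviation RV :: "name \<Rightarrow> rexp" where "RV a \<equiv> RCell a (NConst 0)"
abbreviation setN :: "name \<Rightarrow> nexp \<Rightarrow> com" where "setN a e \<equiv> NAssign a (NConst 0) e"
abbreviation setR :: "name \<Rightarrow> rexp \<Rightarrow> com" where "setR a e \<equiv> RAssign a (NConst 0) e"

definition for_loop :: "name \<Rightarrow> name \<Rightarrow> com \<Rightarrow> com" where
  "for_loop i n c = setN i (NConst 0) ;; While (NLess (NV i) (NV n)) (c ;; setN i (NAdd (NV i) (NConst 1)))"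

text \<open>The body has to preserve the counter; the invariant must not depend on it.\<close>

lemma completes_for:
  assumes init: "Inv 0 (set_nat i 0 0 s) p" and i: "i \<noteq> n"
    and bound: "\<And>k s p. Inv k s p \<Longrightarrow> nats s n 0 = N"
    and body: "\<And>k s p. k < N \<Longrightarrow> Inv k s p \<Longrightarrow> nats s i 0 = k \<Longrightarrow>
      completes \<omega> c s p T (\<lambda>s' p'. nats s' i 0 = k \<and> Inv (Suc k) (set_nat i 0 (Suc k) s') p')"
    and post: "\<And>s p. Inv N s p \<Longrightarrow> Q s p"
  shows "completes \<omega> (for_loop i n c) s p (N * (T + 15) + 15) Q"
proof -
  have "completes \<omega> (for_loop i n c) s p (3 + (N * ((T + 6) + 5 + 1) + 5 + 1)) Q"
    unfolding for_loop_def
  proof (rule completes_seq[of _ _ _ _ _ "\<lambda>s p. nats s i 0 = 0 \<and> Inv 0 s p"])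
    show "completes \<omega> (setN i (NConst 0)) s p 3 (\<lambda>s p. nats s i 0 = 0 \<and> Inv 0 s p)"
      by (rule completes_loop_free) (use init in simp_all)
    fix s p assume "nats s i 0 = 0 \<and> Inv 0 s p"
    then have "completes \<omega> (While (NLess (NV i) (NV n)) (c ;; setN i (NAdd (NV i) (NConst 1)))) s p
      (N * ((T + 6) + bcost (NLess (NV i) (NV n)) + 1) + bcost (NLess (NV i) (NV n)) + 1) (\<lambda>s p. nats s i 0 = N \<and> Inv N s p)"
    proof (rule completes_while[where Inv = "\<lambda>k s p. nats s i 0 = k \<and> Inv k s p"])
      fix k s p assume k: "k < N" and inv: "nats s i 0 = k \<and> Inv k s p"
      have "completes \<omega> (c ;; setN i (NAdd (NV i) (NConst 1))) s p (T + 6) (\<lambda>s p. nats s i 0 = Suc k \<and> Inv (Suc k) s p)"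
      proof (rule completes_seq[OF body[OF k]])
        fix s' p' assume "nats s' i 0 = k \<and> Inv (Suc k) (set_nat i 0 (Suc k) s') p'"
        then show "completes \<omega> (setN i (NAdd (NV i) (NConst 1))) s' p' 6 (\<lambda>s p. nats s i 0 = Suc k \<and> Inv (Suc k) s p)"
          by (intro completes_loop_free) simp_all
      qed (use inv in auto)
      then show "bval (NLess (NV i) (NV n)) s \<and> completes \<omega> (c ;; setN i (NAdd (NV i) (NConst 1))) s p (T + 6)
          (\<lambda>s p. nats s i 0 = Suc k \<and> Inv (Suc k) s p)"
        using k inv bound by auto
    qed (use bound in auto)
    then show "completes \<omega> (While (NLess (NV i) (NV n)) (c ;; setN i (NAdd (NV i) (NConst 1)))) s p (N * ((T + 6) + 5 + 1) + 5 + 1) Q"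
      by (rule completes_mono) (use post in auto)
  qed
  then show ?thesis
    by (rule completes_mono) (simp_all add: algebra_simps)
qed

section \<open>Arithmetic that the machine does not provide\<close>

text \<open>Naturals can only be added, so the time is linear in the second factor \<open>z\<close>,
  whatever the size of the first; the order of the factors matters.\<close>

definition mult_prog :: "name \<Rightarrow> name \<Rightarrow> name \<Rightarrow> com" where
  "mult_prog x y z = setN x (NConst 0) ;; for_loop ''c'' z (setN x (NAdd (NV x) (NV y)))"

lemma completes_mult:
  assumes "distinct [x, y, ''c'']" "x \<noteq> z" "z \<noteq> ''c''" "nats s y 0 = a" "nats s z 0 = b"
  shows "completes \<omega> (mult_prog x y z) s p (b * 25 + 20)
    (\<lambda>s' p'. p' = p \<and> nats s' x 0 = a * b \<and> frame {x, ''c''} {} s s')"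
proof -
  have ne: "y \<noteq> x" "''c'' \<noteq> x" "x \<noteq> ''c''" "y \<noteq> ''c''" using assms by auto
  have "completes \<omega> (mult_prog x y z) s p (3 + (b * (7 + 15) + 15))
    (\<lambda>s' p'. p' = p \<and> nats s' x 0 = a * b \<and> frame {x, ''c''} {} s s')"
    unfolding mult_prog_def
  proof (rule completes_seq[of _ _ _ _ _ "\<lambda>s' p'. s' = set_nat x 0 0 s \<and> p' = p"])
    fix s' p' assume s': "s' = set_nat x 0 0 s \<and> p' = p"
    show "completes \<omega> (for_loop ''c'' z (setN x (NAdd (NV x) (NV y)))) s' p' (b * (7 + 15) + 15)
        (\<lambda>s' p'. p' = p \<and> nats s' x 0 = a * b \<and> frame {x, ''c''} {} s s')"
    proof (rule completes_for[where Inv = "\<lambda>k s' p'. p' = p \<and> nats s' x 0 = a * k \<and> frame {x, ''c''} {} s s'"])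
      fix k s' p' assume inv: "p' = p \<and> nats s' x 0 = a * k \<and> frame {x, ''c''} {} s s'"
      then show "nats s' z 0 = b" using frame_nats[of _ _ s s' z] assms by auto
      assume "nats s' ''c'' 0 = k"
      with inv show "completes \<omega> (setN x (NAdd (NV x) (NV y))) s' p' 7 (\<lambda>s' p'. nats s' ''c'' 0 = k \<and>
          (p' = p \<and> nats (set_nat ''c'' 0 (Suc k) s') x 0 = a * Suc k \<and> frame {x, ''c''} {} s (set_nat ''c'' 0 (Suc k) s')))"
        using frame_nats[of "{x, ''c''}" "{}" s s' y] ne assms(4) by (intro completes_loop_free) simp_all
    qed (use assms s' in auto)
  qed (rule completes_loop_free; simp)
  then show ?thesis by (rule completes_mono) auto
qed

text \<open>The rounded-up logarithm of \<open>b / a\<close> to base 2, stated as the comparison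
  that a program can test while doubling.\<close>

definition clog2 :: "real \<Rightarrow> real \<Rightarrow> nat" where
  "clog2 a b = (LEAST k. b \<le> 2 ^ k * a)"

lemma clog2_exists: "0 < a \<Longrightarrow> \<exists>k. b \<le> 2 ^ k * a" for a :: real
proof -
  assume "0 < a"
  obtain k where "b / a < 2 ^ k" using real_arch_pow[of 2 "b / a"] by auto
  then show ?thesis using \<open>0 < a\<close> by (intro exI[of _ k]) (simp add: field_simps)
qed

lemma clog2: "0 < a \<Longrightarrow> b \<le> 2 ^ clog2 a b * a"
  unfolding clog2_def using clog2_exists by (rule LeastI_ex)

lemma less_clog2: "k < clog2 a b \<Longrightarrow> 2 ^ k * a < b"
  unfolding clog2_def using not_less_Least by force

text \<open>Counting in steps of \<open>e\<close> instead of 1 yields the multiple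
  \<open>clog2 a b * v\<close> without a separate multiplication; a query uses this for its number
  of samples.\<close>

definition log_prog :: "name \<Rightarrow> nexp \<Rightarrow> rexp \<Rightarrow> rexp \<Rightarrow> com" where
  "log_prog x e A B = setR ''y'' (RConst 1) ;; setN x (NConst 0) ;;
     While (RLess (RMul (RV ''y'') A) B) (setR ''y'' (RMul (RConst 2) (RV ''y'')) ;; setN x (NAdd (NV x) e))"

lemma completes_log:
  assumes A: "\<And>s'. frame {x} {''y''} s s' \<Longrightarrow> rval A s' = a" and a: "0 < a"
    and B: "\<And>s'. frame {x} {''y''} s s' \<Longrightarrow> rval B s' = b"
    and e: "\<And>s'. frame {x} {''y''} s s' \<Longrightarrow> nval e s' = v"
    and cost: "rcost A + rcost B + ncost e \<le> 30"
  shows "completes \<omega> (log_prog x e A B) s p (clog2 a b * 100 + 100)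
    (\<lambda>s' p'. p' = p \<and> nats s' x 0 = clog2 a b * v \<and> frame {x} {''y''} s s')"
proof -
  let ?Inv = "\<lambda>k s' p'. p' = p \<and> reals s' ''y'' 0 = 2 ^ k \<and> nats s' x 0 = k * v \<and> frame {x} {''y''} s s'"
  let ?b = "RLess (RMul (RV ''y'') A) B"
  have "completes \<omega> (log_prog x e A B) s p (3 + (3 + (clog2 a b * (50 + bcost ?b + 1) + bcost ?b + 1))) (?Inv (clog2 a b))"
    unfolding log_prog_def
  proof (intro completes_seq)
    show "completes \<omega> (setR ''y'' (RConst 1)) s p 3 (\<lambda>s' p'. s' = set_real ''y'' 0 1 s \<and> p' = p)"
      by (rule completes_loop_free) simp_all
    fix s' p' assume "s' = set_real ''y'' 0 1 s \<and> p' = p"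
    then show "completes \<omega> (setN x (NConst 0)) s' p' 3 (?Inv 0)"
      by (intro completes_loop_free) simp_all
  next
    fix s' p' assume "?Inv 0 s' p'"
    then show "completes \<omega> (While ?b (setR ''y'' (RMul (RConst 2) (RV ''y'')) ;; setN x (NAdd (NV x) e))) s' p'
      (clog2 a b * (50 + bcost ?b + 1) + bcost ?b + 1) (?Inv (clog2 a b))"
    proof (rule completes_while)
      fix k s' p' assume k: "k < clog2 a b" and inv: "?Inv k s' p'"
      have "rval A s' = a" "rval B s' = b" "nval e (set_real ''y'' 0 (2 * 2 ^ k) s') = v"
        using inv by (simp_all add: A B e)
      then show "bval ?b s' \<and> completes \<omega> (setR ''y'' (RMul (RConst 2) (RV ''y'')) ;; setN x (NAdd (NV x) e)) s' p' 50 (?Inv (Suc k))"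
        using less_clog2[OF k] inv cost by (auto intro!: completes_loop_free)
    next
      fix s' p' assume "?Inv (clog2 a b) s' p'"
      then show "\<not> bval ?b s'"
        using clog2[OF a, of b] by (simp add: A B not_less)
    qed
  qed
  then show ?thesis
  proof (rule completes_mono)
    have "bcost ?b + 50 + 1 \<le> 100" using cost by simp
    then have "clog2 a b * (bcost ?b + 50 + 1) \<le> clog2 a b * 100" by (rule mult_left_mono) simp
    then show "3 + (3 + (clog2 a b * (50 + bcost ?b + 1) + bcost ?b + 1)) \<le> clog2 a b * 100 + 100"
      using cost by (simp add: algebra_simps)
  qed auto
qed

section \<open>The sketching program\<close>

definition load_prog :: com where
  "load_prog = for_loop ''l'' ''D'' (Cond (NLess (NV ''l'') (NV ''d''))
     (RAssign ''b'' (NV ''l'') (RMul (RCell ''g'' (NAdd (NV ''jo'') (NV ''l''))) (RCell ''in'' (NAdd (NV ''off'') (NV ''l'')))))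
     (RAssign ''b'' (NV ''l'') (RConst 0)))"

lemma completes_load:
  assumes "nats s ''D'' 0 = D"
  shows "completes \<omega> load_prog s p (D * 41 + 15) (\<lambda>s' p'. p' = p \<and> frame {''l''} {''b''} s s' \<and>
    (\<forall>l<D. reals s' ''b'' l = (if l < nats s ''d'' 0
       then reals s ''g'' (nats s ''jo'' 0 + l) * reals s ''in'' (nats s ''off'' 0 + l) else 0)))"
proof -
  let ?v = "\<lambda>l. if l < nats s ''d'' 0
       then reals s ''g'' (nats s ''jo'' 0 + l) * reals s ''in'' (nats s ''off'' 0 + l) else 0"
  let ?Inv = "\<lambda>k s' p'. p' = p \<and> frame {''l''} {''b''} s s' \<and> (\<forall>l<k. reals s' ''b'' l = ?v l)"
  have "completes \<omega> load_prog s p (D * (26 + 15) + 15) (?Inv D)"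
    unfolding load_prog_def
  proof (rule completes_for[where Inv = ?Inv])
    fix k s' p' assume inv: "?Inv k s' p'"
    then have fr: "frame {''l''} {''b''} s s'" by blast
    note frs = frame_nats[OF fr] frame_reals[OF fr]
    show "nats s' ''D'' 0 = D" using assms by (simp add: frs)
    assume "nats s' ''l'' 0 = k"
    then show "completes \<omega> (Cond (NLess (NV ''l'') (NV ''d''))
     (RAssign ''b'' (NV ''l'') (RMul (RCell ''g'' (NAdd (NV ''jo'') (NV ''l''))) (RCell ''in'' (NAdd (NV ''off'') (NV ''l'')))))
     (RAssign ''b'' (NV ''l'') (RConst 0))) s' p' 26 (\<lambda>s' p'. nats s' ''l'' 0 = k \<and> ?Inv (Suc k) (set_nat ''l'' 0 (Suc k) s') p')"
      using inv by (intro completes_loop_free) (simp_all add: frs less_Suc_eq)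
  qed auto
  then show ?thesis by simp
qed

text \<open>A round cannot be done in place, since the cells \<open>i\<close> and
  \<open>i + h\<close> still hold inputs of other pairs; the results are collected in the real array
  \<open>c\<close> and copied back. The counter \<open>i2\<close> keeps
  \<open>2 * i\<close>.\<close>

definition stage_prog :: com where
  "stage_prog = setN ''i2'' (NConst 0) ;;
     for_loop ''i'' ''h''
       (RAssign ''c'' (NV ''i'') (RAdd (RCell ''b'' (NV ''i2'')) (RCell ''b'' (NAdd (NV ''i2'') (NConst 1)))) ;;
        RAssign ''c'' (NAdd (NV ''i'') (NV ''h'')) (RSub (RCell ''b'' (NV ''i2'')) (RCell ''b'' (NAdd (NV ''i2'') (NConst 1)))) ;;
        setN ''i2'' (NAdd (NV ''i2'') (NConst 2))) ;;
     for_loop ''i'' ''D'' (RAssign ''b'' (NV ''i'') (RCell ''c'' (NV ''i'')))"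

lemma completes_stage:
  assumes "nats s ''h'' 0 = h" "nats s ''D'' 0 = 2 * h"
  shows "completes \<omega> stage_prog s p (h * 100 + 40) (\<lambda>s' p'. p' = p \<and> frame {''i'', ''i2''} {''b'', ''c''} s s' \<and>
    (\<forall>i<2 * h. reals s' ''b'' i = butterfly h (reals s ''b'') i))"
proof -
  let ?fr = "frame {''i'', ''i2''} {''b'', ''c''} s"
  let ?b = "reals s ''b''"
  let ?Inv = "\<lambda>k s' p'. p' = p \<and> frame {''i'', ''i2''} {''c''} s s' \<and> nats s' ''i2'' 0 = 2 * k \<and>
    (\<forall>i<k. reals s' ''c'' i = ?b (2 * i) + ?b (2 * i + 1) \<and> reals s' ''c'' (i + h) = ?b (2 * i) - ?b (2 * i + 1))"
  let ?Inv2 = "\<lambda>k s' p'. p' = p \<and> ?fr s' \<and> (\<forall>i<2 * h. reals s' ''c'' i = butterfly h ?b i) \<and>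
    (\<forall>i<k. reals s' ''b'' i = butterfly h ?b i)"
  have "completes \<omega> stage_prog s p (3 + ((h * (40 + 15) + 15) + (2 * h * (6 + 15) + 15))) (?Inv2 (2 * h))"
    unfolding stage_prog_def
  proof (intro completes_seq)
    show "completes \<omega> (setN ''i2'' (NConst 0)) s p 3 (\<lambda>s' p'. s' = set_nat ''i2'' 0 0 s \<and> p' = p)"
      by (rule completes_loop_free) simp_all
  next
    fix s' p' assume s': "s' = set_nat ''i2'' 0 0 s \<and> p' = p"
    show "completes \<omega> (for_loop ''i'' ''h''
       (RAssign ''c'' (NV ''i'') (RAdd (RCell ''b'' (NV ''i2'')) (RCell ''b'' (NAdd (NV ''i2'') (NConst 1)))) ;;
        RAssign ''c'' (NAdd (NV ''i'') (NV ''h'')) (RSub (RCell ''b'' (NV ''i2'')) (RCell ''b'' (NAdd (NV ''i2'') (NConst 1)))) ;;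
        setN ''i2'' (NAdd (NV ''i2'') (NConst 2)))) s' p' (h * (40 + 15) + 15) (?Inv2 0)"
    proof (rule completes_for[where Inv = "\<lambda>k s' p'. k \<le> h \<and> ?Inv k s' p'"])
      fix k s' p' assume inv: "k \<le> h \<and> ?Inv k s' p'"
      then have fr: "frame {''i'', ''i2''} {''c''} s s'" by blast
      note frs = frame_nats[OF fr] frame_reals[OF fr]
      show "nats s' ''h'' 0 = h" using assms by (simp add: frs)
      assume "k < h" "nats s' ''i'' 0 = k"
      then show "completes \<omega> (RAssign ''c'' (NV ''i'') (RAdd (RCell ''b'' (NV ''i2'')) (RCell ''b'' (NAdd (NV ''i2'') (NConst 1)))) ;;
        RAssign ''c'' (NAdd (NV ''i'') (NV ''h'')) (RSub (RCell ''b'' (NV ''i2'')) (RCell ''b'' (NAdd (NV ''i2'') (NConst 1)))) ;;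
        setN ''i2'' (NAdd (NV ''i2'') (NConst 2))) s' p' 40
          (\<lambda>s' p'. nats s' ''i'' 0 = k \<and> (Suc k \<le> h \<and> ?Inv (Suc k) (set_nat ''i'' 0 (Suc k) s') p'))"
        using inv assms(1) by (intro completes_loop_free) (auto simp add: frs less_Suc_eq)
    next
      fix s' p' assume inv: "h \<le> h \<and> ?Inv h s' p'"
      have "reals s' ''c'' i = butterfly h ?b i" if i: "i < 2 * h" for i
      proof (cases "i < h")
        case True
        then show ?thesis using inv by (simp add: butterfly_def)
      next
        case False
        then have "reals s' ''c'' ((i - h) + h) = ?b (2 * (i - h)) - ?b (2 * (i - h) + 1)"
          using inv i by (metis add_less_cancel_right less_diff_conv2 mult_2 not_less)
        then show ?thesis using False by (simp add: butterfly_def)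
      qed
      moreover have "?fr s'"
        using inv frame_trans[OF frame_refl[of "{}" "{}" s], of "{''i'', ''i2''}" "{''c''}" s' "{''i'', ''i2''}" "{''b'', ''c''}"]
        by blast
      ultimately show "?Inv2 0 s' p'" using inv by simp
    qed (use s' in auto)
  next
    fix s' p' assume inv: "?Inv2 0 s' p'"
    show "completes \<omega> (for_loop ''i'' ''D'' (RAssign ''b'' (NV ''i'') (RCell ''c'' (NV ''i'')))) s' p' (2 * h * (6 + 15) + 15) (?Inv2 (2 * h))"
    proof (rule completes_for[where Inv = "\<lambda>k s' p'. k \<le> 2 * h \<and> ?Inv2 k s' p'"])
      fix k s' p' assume inv: "k \<le> 2 * h \<and> ?Inv2 k s' p'"
      then have fr: "?fr s'" by blast
      note frs = frame_nats[OF fr] frame_reals[OF fr]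
      show "nats s' ''D'' 0 = 2 * h" using assms by (simp add: frs)
      assume "k < 2 * h" "nats s' ''i'' 0 = k"
      then show "completes \<omega> (RAssign ''b'' (NV ''i'') (RCell ''c'' (NV ''i''))) s' p' 6
          (\<lambda>s' p'. nats s' ''i'' 0 = k \<and> (Suc k \<le> 2 * h \<and> ?Inv2 (Suc k) (set_nat ''i'' 0 (Suc k) s') p'))"
        using inv by (intro completes_loop_free) (auto simp add: less_Suc_eq)
    qed (use inv in auto)
  qed
  then show ?thesis by (rule completes_mono) auto
qed

definition transform_prog :: com where
  "transform_prog = for_loop ''r'' ''p'' stage_prog"

lemma completes_transform:
  assumes "nats s ''h'' 0 = h" "nats s ''D'' 0 = 2 * h" "nats s ''p'' 0 = P"
  shows "completes \<omega> transform_prog s p (P * (h * 100 + 55) + 15) (\<lambda>s' p'. p' = p \<and> frame {''i'', ''i2'', ''r''} {''b'', ''c''} s s' \<and>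
    (\<forall>i<2 * h. reals s' ''b'' i = (butterfly h ^^ P) (reals s ''b'') i))"
proof -
  let ?Inv = "\<lambda>k s' p'. p' = p \<and> frame {''i'', ''i2'', ''r''} {''b'', ''c''} s s' \<and>
    (\<forall>i<2 * h. reals s' ''b'' i = (butterfly h ^^ k) (reals s ''b'') i)"
  have "completes \<omega> transform_prog s p (P * ((h * 100 + 40) + 15) + 15) (?Inv P)"
    unfolding transform_prog_def
  proof (rule completes_for[where Inv = ?Inv])
    fix k s' p' assume inv: "?Inv k s' p'"
    then have fr: "frame {''i'', ''i2'', ''r''} {''b'', ''c''} s s'" by blast
    note frs = frame_nats[OF fr] frame_reals[OF fr]
    show "nats s' ''p'' 0 = P" using assms by (simp add: frs)
    assume k: "nats s' ''r'' 0 = k"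
    have "nats s' ''h'' 0 = h" "nats s' ''D'' 0 = 2 * h" using assms by (simp_all add: frs)
    then show "completes \<omega> stage_prog s' p' (h * 100 + 40) (\<lambda>s' p'. nats s' ''r'' 0 = k \<and> ?Inv (Suc k) (set_nat ''r'' 0 (Suc k) s') p')"
    proof (rule completes_mono[OF completes_stage])
      fix s'' p''
      assume post: "p'' = p' \<and> frame {''i'', ''i2''} {''b'', ''c''} s' s'' \<and> (\<forall>i<2 * h. reals s'' ''b'' i = butterfly h (reals s' ''b'') i)"
      then have fr2: "frame {''i'', ''i2''} {''b'', ''c''} s' s''" by blast
      have "frame {''i'', ''i2'', ''r''} {''b'', ''c''} s s''"
        by (rule frame_trans[OF fr fr2]) auto
      moreover have "butterfly h (reals s' ''b'') i = (butterfly h ^^ Suc k) (reals s ''b'') i" if "i < 2 * h" for i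
        using butterfly_cong[of h "reals s' ''b''" "(butterfly h ^^ k) (reals s ''b'')" i] inv that by simp
      ultimately show "nats s'' ''r'' 0 = k \<and> ?Inv (Suc k) (set_nat ''r'' 0 (Suc k) s'') p''"
        using post inv k frame_nats[OF fr2] by simp
    qed simp
  qed auto
  then show ?thesis by (rule completes_mono) simp_all
qed

definition store_prog :: com where
  "store_prog = for_loop ''i'' ''D'' (RAssign ''S'' (NAdd (NV ''pos'') (NAdd (NV ''jo'') (NV ''i''))) (RCell ''b'' (NV ''i'')))"

lemma completes_store:
  assumes "nats s ''D'' 0 = D"
  defines "st \<equiv> nats s ''pos'' 0 + nats s ''jo'' 0"
  shows "completes \<omega> store_prog s p (D * 27 + 15) (\<lambda>s' p'. p' = p \<and> frame {''i''} {''S''} s s' \<and>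
    (\<forall>x. reals s' ''S'' x = (if st \<le> x \<and> x < st + D then reals s ''b'' (x - st) else reals s ''S'' x)))"
proof -
  let ?Inv = "\<lambda>k s' p'. p' = p \<and> frame {''i''} {''S''} s s' \<and>
    (\<forall>x. reals s' ''S'' x = (if st \<le> x \<and> x < st + k then reals s ''b'' (x - st) else reals s ''S'' x))"
  have "completes \<omega> store_prog s p (D * (12 + 15) + 15) (?Inv D)"
    unfolding store_prog_def
  proof (rule completes_for[where Inv = ?Inv])
    fix k s' p' assume inv: "?Inv k s' p'"
    then have fr: "frame {''i''} {''S''} s s'" by blast
    note frs = frame_nats[OF fr] frame_reals[OF fr]
    show "nats s' ''D'' 0 = D" using assms by (simp add: frs)
    assume "nats s' ''i'' 0 = k"
    then show "completes \<omega> (RAssign ''S'' (NAdd (NV ''pos'') (NAdd (NV ''jo'') (NV ''i''))) (RCell ''b'' (NV ''i''))) s' p' 12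
      (\<lambda>s' p'. nats s' ''i'' 0 = k \<and> ?Inv (Suc k) (set_nat ''i'' 0 (Suc k) s') p')"
      using inv by (intro completes_loop_free) (auto simp add: frs st_def)
  qed auto
  then show ?thesis by simp
qed

text \<open>Shared by all three operations: \<open>off\<close> is the start of the point within
  \<open>in\<close>, \<open>pos\<close> the start of the row of \<open>S\<close> that receives its
  sketch, and \<open>jo\<close> the start of the current copy.\<close>

definition sketch_prog :: com where
  "sketch_prog = setN ''jo'' (NConst 0) ;;
     for_loop ''j'' ''m'' (load_prog ;; transform_prog ;; store_prog ;; setN ''jo'' (NAdd (NV ''jo'') (NV ''D'')))"

abbreviation sketch_nats :: "name set" where
  "sketch_nats \<equiv> {''l'', ''i'', ''i2'', ''r'', ''j'', ''jo''}"

abbreviation sketch_reals :: "name set" where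
  "sketch_reals \<equiv> {''b'', ''c'', ''S''}"

lemma completes_sketch:
  assumes "nats s ''h'' 0 = 2 ^ P" "nats s ''D'' 0 = 2 ^ Suc P" "nats s ''p'' 0 = Suc P" "nats s ''m'' 0 = m"
  defines "v \<equiv> \<lambda>l. if l < nats s ''d'' 0 then reals s ''in'' (nats s ''off'' 0 + l) else 0"
  shows "completes \<omega> sketch_prog s p (m * (2 ^ Suc P * (Suc P * 105 + 68) + 67) + 18) (\<lambda>s' p'. p' = p \<and>
    frame sketch_nats sketch_reals s s' \<and>
    (\<forall>x<nats s ''pos'' 0. reals s' ''S'' x = reals s ''S'' x) \<and>
    (\<forall>e<m * 2 ^ Suc P. reals s' ''S'' (nats s ''pos'' 0 + e) = sketch_coord P (reals s ''g'') v e))"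
proof -
  define D where "D = (2::nat) ^ Suc P"
  define h where "h = (2::nat) ^ P"
  define st where "st = nats s ''pos'' 0"
  have Dh: "D = 2 * h" by (simp add: D_def h_def)
  have D0: "0 < D" by (simp add: D_def)
  let ?fr = "frame sketch_nats sketch_reals s"
  let ?Inv = "\<lambda>k s' p'. p' = p \<and> ?fr s' \<and> nats s' ''jo'' 0 = k * D \<and>
    (\<forall>x<st. reals s' ''S'' x = reals s ''S'' x) \<and>
    (\<forall>e<k * D. reals s' ''S'' (st + e) = sketch_coord P (reals s ''g'') v e)"
  let ?T = "(D * 41 + 15) + ((Suc P * (h * 100 + 55) + 15) + ((D * 27 + 15) + 7))"
  have "completes \<omega> sketch_prog s p (3 + (m * (?T + 15) + 15)) (?Inv m)"
    unfolding sketch_prog_def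
  proof (rule completes_seq)
    show "completes \<omega> (setN ''jo'' (NConst 0)) s p 3 (\<lambda>s' p'. s' = set_nat ''jo'' 0 0 s \<and> p' = p)"
      by (rule completes_loop_free) simp_all
    fix s' p' assume s': "s' = set_nat ''jo'' 0 0 s \<and> p' = p"
    show "completes \<omega> (for_loop ''j'' ''m'' (load_prog ;; transform_prog ;; store_prog ;; setN ''jo'' (NAdd (NV ''jo'') (NV ''D''))))
      s' p' (m * (?T + 15) + 15) (?Inv m)"
    proof (rule completes_for[where Inv = ?Inv])
      fix k s1 p1 assume inv: "?Inv k s1 p1"
      then have fr: "?fr s1" by blast
      note frs = frame_nats[OF fr] frame_reals[OF fr]
      show "nats s1 ''m'' 0 = m" using assms by (simp add: frs)
      assume j: "nats s1 ''j'' 0 = k"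
      show "completes \<omega> (load_prog ;; transform_prog ;; store_prog ;; setN ''jo'' (NAdd (NV ''jo'') (NV ''D''))) s1 p1 ?T
        (\<lambda>s' p'. nats s' ''j'' 0 = k \<and> ?Inv (Suc k) (set_nat ''j'' 0 (Suc k) s') p')"
      proof (rule completes_seq[OF completes_load])
        show "nats s1 ''D'' 0 = D" using assms by (simp add: frs D_def)
        fix s2 p2 assume post2: "p2 = p1 \<and> frame {''l''} {''b''} s1 s2 \<and>
          (\<forall>l<D. reals s2 ''b'' l = (if l < nats s1 ''d'' 0
             then reals s1 ''g'' (nats s1 ''jo'' 0 + l) * reals s1 ''in'' (nats s1 ''off'' 0 + l) else 0))"
        have fr2: "frame sketch_nats {''b'', ''c''} s1 s2"
          by (rule frame_trans[OF frame_refl[of "{}" "{}"] conjunct1[OF conjunct2[OF post2]]]) auto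
        note frs2 = frame_nats[OF fr2] frame_reals[OF fr2]
        have frs2': "a \<noteq> ''l'' \<Longrightarrow> nats s2 a = nats s1 a" for a
          using post2 by (simp add: frame_def)
        have b2: "reals s2 ''b'' l = reals s ''g'' (k * D + l) * v l" if "l < D" for l
          using post2 inv that by (simp add: frs v_def)
        show "completes \<omega> (transform_prog ;; store_prog ;; setN ''jo'' (NAdd (NV ''jo'') (NV ''D''))) s2 p2
          ((Suc P * (h * 100 + 55) + 15) + ((D * 27 + 15) + 7))
          (\<lambda>s' p'. nats s' ''j'' 0 = k \<and> ?Inv (Suc k) (set_nat ''j'' 0 (Suc k) s') p')"
        proof (rule completes_seq[OF completes_transform])
          show "nats s2 ''h'' 0 = h" "nats s2 ''D'' 0 = 2 * h" "nats s2 ''p'' 0 = Suc P"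
            using assms by (simp_all add: frs frs2 h_def)
          fix s3 p3 assume post3: "p3 = p2 \<and> frame {''i'', ''i2'', ''r''} {''b'', ''c''} s2 s3 \<and>
            (\<forall>i<2 * h. reals s3 ''b'' i = (butterfly h ^^ Suc P) (reals s2 ''b'') i)"
          have fr3: "frame {''i'', ''i2'', ''r''} {''b'', ''c''} s2 s3" using post3 by blast
          note frs3 = frame_nats[OF fr3] frame_reals[OF fr3]
          have b3: "reals s3 ''b'' i = sketch_coord P (reals s ''g'') v (k * D + i)" if "i < D" for i
          proof -
            have "reals s3 ''b'' i = (butterfly h ^^ Suc P) (reals s2 ''b'') i"
              using post3 that by (simp add: Dh)
            \<comment> \<open>Loading determines only the first \<open>2 * h\<close> cells of
              \<open>b\<close>, and the transform reads no others.\<close>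
            also have "\<dots> = (butterfly h ^^ Suc P) (\<lambda>l. reals s ''g'' (k * D + l) * v l) i"
              by (rule butterfly_pow_cong) (use b2 that in \<open>auto simp: Dh\<close>)
            also have "\<dots> = sketch_coord P (reals s ''g'') v (k * D + i)"
              using that unfolding sketch_coord_def D_def[symmetric] h_def[symmetric] by simp
            finally show ?thesis .
          qed
          show "completes \<omega> (store_prog ;; setN ''jo'' (NAdd (NV ''jo'') (NV ''D''))) s3 p3 ((D * 27 + 15) + 7)
            (\<lambda>s' p'. nats s' ''j'' 0 = k \<and> ?Inv (Suc k) (set_nat ''j'' 0 (Suc k) s') p')"
          proof (rule completes_seq[OF completes_store])
            show D3: "nats s3 ''D'' 0 = D" using assms by (simp add: frs frs2 frs3 D_def)
            have pos3: "nats s3 ''pos'' 0 + nats s3 ''jo'' 0 = st + k * D"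
              using inv by (simp add: frs frs2 frs2' frs3 st_def)
            fix s4 p4 assume "p4 = p3 \<and> frame {''i''} {''S''} s3 s4 \<and> (\<forall>x. reals s4 ''S'' x =
               (if nats s3 ''pos'' 0 + nats s3 ''jo'' 0 \<le> x \<and> x < nats s3 ''pos'' 0 + nats s3 ''jo'' 0 + D
                then reals s3 ''b'' (x - (nats s3 ''pos'' 0 + nats s3 ''jo'' 0)) else reals s3 ''S'' x))"
            then have p4: "p4 = p" and fr4: "frame {''i''} {''S''} s3 s4" and
              S4: "\<And>x. reals s4 ''S'' x = (if st + k * D \<le> x \<and> x < st + k * D + D
                then reals s3 ''b'' (x - (st + k * D)) else reals s1 ''S'' x)"
              using inv post2 post3 unfolding pos3 by (auto simp: frs2 frs3)
            note frs4 = frame_nats[OF fr4] frame_reals[OF fr4]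
            have nats4: "nats s4 ''j'' 0 = k" "nats s4 ''jo'' 0 = k * D" "nats s4 ''D'' 0 = D"
              using j inv D3 frs2'[of "''j''"] frs2'[of "''jo''"] by (simp_all add: frs4 frs3)
            have "frame sketch_nats sketch_reals s s2" by (rule frame_trans[OF fr fr2]) auto
            then have "frame sketch_nats sketch_reals s s3" by (rule frame_trans[OF _ fr3]) auto
            then have fr': "?fr s4" by (rule frame_trans[OF _ fr4]) auto
            have "reals s4 ''S'' (st + e) = sketch_coord P (reals s ''g'') v e" if "e < Suc k * D" for e
              using S4[of "st + e"] b3[of "e - k * D"] inv that by (cases "e < k * D") auto
            moreover have "reals s4 ''S'' x = reals s ''S'' x" if "x < st" for x
              using S4[of x] inv that by auto
            ultimately show "completes \<omega> (setN ''jo'' (NAdd (NV ''jo'') (NV ''D''))) s4 p4 7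
              (\<lambda>s' p'. nats s' ''j'' 0 = k \<and> ?Inv (Suc k) (set_nat ''j'' 0 (Suc k) s') p')"
              using nats4 fr' p4 by (intro completes_loop_free) simp_all
          qed
        qed
      qed
    qed (use s' in auto)
  qed
  then show ?thesis
  proof (rule completes_mono)
    have "?T + 15 \<le> 2 ^ Suc P * (Suc P * 105 + 68) + 67"
    proof -
      have "Suc P * 55 \<le> Suc P * (55 * h)" by (intro mult_left_mono) (simp_all add: h_def)
      then show ?thesis unfolding D_def[symmetric] Dh by (simp add: algebra_simps)
    qed
    then have "m * (?T + 15) \<le> m * (2 ^ Suc P * (Suc P * 105 + 68) + 67)" by (rule mult_left_mono) simp
    then show "3 + (m * (?T + 15) + 15) \<le> m * (2 ^ Suc P * (Suc P * 105 + 68) + 67) + 18" by simp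
  qed (auto simp: D_def st_def)
qed

section \<open>Queries and insertions\<close>

text \<open>\<open>base\<close> is the row of a stored point and \<open>pos\<close> the row of the
  query. Since sketching is linear, the difference of the two entries is a coordinate of the sketch
  of the difference vector.\<close>

definition diff_prog :: com where
  "diff_prog = setR ''s'' (RConst 0) ;; for_loop ''t'' ''k''
     (RAssign ''a'' (NV ''t'') (RSub (RCell ''S'' (NAdd (NV ''base'') (NCell ''J'' (NV ''t''))))
        (RCell ''S'' (NAdd (NV ''pos'') (NCell ''J'' (NV ''t''))))) ;;
      Cond (RLess (RCell ''a'' (NV ''t'')) (RConst 0)) (RAssign ''a'' (NV ''t'') (RSub (RConst 0) (RCell ''a'' (NV ''t'')))) Skip ;;
      setR ''s'' (RAdd (RV ''s'') (RCell ''a'' (NV ''t''))))"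

lemma completes_diff:
  assumes k: "nats s ''k'' 0 = K"
  defines "a \<equiv> \<lambda>t. \<bar>reals s ''S'' (nats s ''base'' 0 + nats s ''J'' t) - reals s ''S'' (nats s ''pos'' 0 + nats s ''J'' t)\<bar>"
  shows "completes \<omega> diff_prog s p (K * 75 + 20) (\<lambda>s' p'. p' = p \<and> frame {''t''} {''a'', ''s''} s s' \<and>
    (\<forall>t<K. reals s' ''a'' t = a t) \<and> reals s' ''s'' 0 = (\<Sum>t<K. a t))"
proof -
  let ?Inv = "\<lambda>k s' p'. p' = p \<and> frame {''t''} {''a'', ''s''} s s' \<and>
    (\<forall>t<k. reals s' ''a'' t = a t) \<and> reals s' ''s'' 0 = (\<Sum>t<k. a t)"
  have "completes \<omega> diff_prog s p (3 + (K * (60 + 15) + 15)) (?Inv K)"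
    unfolding diff_prog_def
  proof (rule completes_seq)
    show "completes \<omega> (setR ''s'' (RConst 0)) s p 3 (\<lambda>s' p'. s' = set_real ''s'' 0 0 s \<and> p' = p)"
      by (rule completes_loop_free) simp_all
    fix s' p' assume s': "s' = set_real ''s'' 0 0 s \<and> p' = p"
    show "completes \<omega> (for_loop ''t'' ''k''
     (RAssign ''a'' (NV ''t'') (RSub (RCell ''S'' (NAdd (NV ''base'') (NCell ''J'' (NV ''t''))))
        (RCell ''S'' (NAdd (NV ''pos'') (NCell ''J'' (NV ''t''))))) ;;
      Cond (RLess (RCell ''a'' (NV ''t'')) (RConst 0)) (RAssign ''a'' (NV ''t'') (RSub (RConst 0) (RCell ''a'' (NV ''t'')))) Skip ;;
      setR ''s'' (RAdd (RV ''s'') (RCell ''a'' (NV ''t''))))) s' p' (K * (60 + 15) + 15) (?Inv K)"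
    proof (rule completes_for[where Inv = ?Inv])
      fix j s' p' assume inv: "?Inv j s' p'"
      then have fr: "frame {''t''} {''a'', ''s''} s s'" by blast
      note frs = frame_nats[OF fr] frame_reals[OF fr]
      show "nats s' ''k'' 0 = K" using k by (simp add: frs)
      assume "nats s' ''t'' 0 = j"
      then show "completes \<omega> (RAssign ''a'' (NV ''t'') (RSub (RCell ''S'' (NAdd (NV ''base'') (NCell ''J'' (NV ''t''))))
        (RCell ''S'' (NAdd (NV ''pos'') (NCell ''J'' (NV ''t''))))) ;;
        Cond (RLess (RCell ''a'' (NV ''t'')) (RConst 0)) (RAssign ''a'' (NV ''t'') (RSub (RConst 0) (RCell ''a'' (NV ''t'')))) Skip ;;
        setR ''s'' (RAdd (RV ''s'') (RCell ''a'' (NV ''t'')))) s' p' 60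
        (\<lambda>s' p'. nats s' ''t'' 0 = j \<and> ?Inv (Suc j) (set_nat ''t'' 0 (Suc j) s') p')"
        using inv by (intro completes_loop_free) (simp_all add: frs less_Suc_eq a_def abs_if)
    qed (use s' in auto)
  qed
  then show ?thesis by (rule completes_mono) simp_all
qed

definition round_prog :: com where
  "round_prog = setR ''tau'' (RDiv (RMul (RConst 32) (RV ''s'')) (RMul (RNat (NV ''k'')) (RV ''eps''))) ;;
     setR ''s'' (RConst 0) ;; for_loop ''t'' ''k''
     (Cond (RLess (RCell ''a'' (NV ''t'')) (RV ''tau'')) (setR ''s'' (RAdd (RV ''s'') (RCell ''a'' (NV ''t''))))
        (setR ''s'' (RAdd (RV ''s'') (RV ''tau''))))"

lemma completes_round:
  assumes k: "nats s ''k'' 0 = K"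
  defines "\<tau> \<equiv> 32 * reals s ''s'' 0 / (real K * reals s ''eps'' 0)"
  shows "completes \<omega> round_prog s p (K * 75 + 40) (\<lambda>s' p'. p' = p \<and> frame {''t''} {''s'', ''tau''} s s' \<and>
    reals s' ''s'' 0 = (\<Sum>t<K. min (reals s ''a'' t) \<tau>))"
proof -
  let ?Inv = "\<lambda>k s' p'. p' = p \<and> frame {''t''} {''s'', ''tau''} s s' \<and> reals s' ''tau'' 0 = \<tau> \<and>
    reals s' ''s'' 0 = (\<Sum>t<k. min (reals s ''a'' t) \<tau>)"
  have "completes \<omega> round_prog s p (20 + (3 + (K * (60 + 15) + 15))) (?Inv K)"
    unfolding round_prog_def
  proof (intro completes_seq)
    show "completes \<omega> (setR ''tau'' (RDiv (RMul (RConst 32) (RV ''s'')) (RMul (RNat (NV ''k'')) (RV ''eps'')))) s p 20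
      (\<lambda>s' p'. s' = set_real ''tau'' 0 \<tau> s \<and> p' = p)"
      using k by (intro completes_loop_free) (simp_all add: \<tau>_def)
  next
    fix s' p' assume "s' = set_real ''tau'' 0 \<tau> s \<and> p' = p"
    then show "completes \<omega> (setR ''s'' (RConst 0)) s' p' 3 (\<lambda>s' p'. s' = set_real ''s'' 0 0 (set_real ''tau'' 0 \<tau> s) \<and> p' = p)"
      by (intro completes_loop_free) simp_all
  next
    fix s' p' assume s': "s' = set_real ''s'' 0 0 (set_real ''tau'' 0 \<tau> s) \<and> p' = p"
    show "completes \<omega> (for_loop ''t'' ''k''
     (Cond (RLess (RCell ''a'' (NV ''t'')) (RV ''tau'')) (setR ''s'' (RAdd (RV ''s'') (RCell ''a'' (NV ''t''))))
        (setR ''s'' (RAdd (RV ''s'') (RV ''tau''))))) s' p' (K * (60 + 15) + 15) (?Inv K)"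
    proof (rule completes_for[where Inv = ?Inv])
      fix j s' p' assume inv: "?Inv j s' p'"
      then have fr: "frame {''t''} {''s'', ''tau''} s s'" by blast
      note frs = frame_nats[OF fr] frame_reals[OF fr]
      show "nats s' ''k'' 0 = K" using k by (simp add: frs)
      assume "nats s' ''t'' 0 = j"
      then show "completes \<omega> (Cond (RLess (RCell ''a'' (NV ''t'')) (RV ''tau'')) (setR ''s'' (RAdd (RV ''s'') (RCell ''a'' (NV ''t''))))
        (setR ''s'' (RAdd (RV ''s'') (RV ''tau'')))) s' p' 60
        (\<lambda>s' p'. nats s' ''t'' 0 = j \<and> ?Inv (Suc j) (set_nat ''t'' 0 (Suc j) s') p')"
        using inv by (intro completes_loop_free) (simp_all add: frs min_def)
    qed (use s' in auto)
  qed
  then show ?thesis by (rule completes_mono) auto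
qed

definition estimate_prog :: com where
  "estimate_prog = diff_prog ;; for_loop ''it'' ''p'' round_prog"

lemma completes_estimate:
  assumes k: "nats s ''k'' 0 = K" and P: "nats s ''p'' 0 = P"
  defines "a \<equiv> \<lambda>t. \<bar>reals s ''S'' (nats s ''base'' 0 + nats s ''J'' t) - reals s ''S'' (nats s ''pos'' 0 + nats s ''J'' t)\<bar>"
  shows "completes \<omega> estimate_prog s p ((P + 1) * (K * 75 + 55)) (\<lambda>s' p'. p' = p \<and>
    frame {''t'', ''it''} {''a'', ''s'', ''tau''} s s' \<and> reals s' ''s'' 0 = robust_sum (reals s ''eps'' 0) K a P)"
proof -
  let ?\<epsilon> = "reals s ''eps'' 0"
  let ?Inv = "\<lambda>k s' p'. p' = p \<and> frame {''t'', ''it''} {''a'', ''s'', ''tau''} s s' \<and>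
    (\<forall>t<K. reals s' ''a'' t = a t) \<and> reals s' ''s'' 0 = robust_sum ?\<epsilon> K a k"
  have "completes \<omega> estimate_prog s p ((K * 75 + 20) + (P * ((K * 75 + 40) + 15) + 15)) (?Inv P)"
    unfolding estimate_prog_def
  proof (rule completes_seq)
    show "completes \<omega> diff_prog s p (K * 75 + 20) (?Inv 0)"
    proof (rule completes_mono[OF completes_diff[OF k]])
      fix s' p'
      assume post: "p' = p \<and> frame {''t''} {''a'', ''s''} s s' \<and>
        (\<forall>t<K. reals s' ''a'' t = \<bar>reals s ''S'' (nats s ''base'' 0 + nats s ''J'' t) - reals s ''S'' (nats s ''pos'' 0 + nats s ''J'' t)\<bar>) \<and>
        reals s' ''s'' 0 = (\<Sum>t<K. \<bar>reals s ''S'' (nats s ''base'' 0 + nats s ''J'' t) - reals s ''S'' (nats s ''pos'' 0 + nats s ''J'' t)\<bar>)"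
      have "frame {''t'', ''it''} {''a'', ''s'', ''tau''} s s'"
        by (rule frame_trans[OF frame_refl[of "{}" "{}"] conjunct1[OF conjunct2[OF post]]]) auto
      then show "?Inv 0 s' p'" using post by (simp add: a_def)
    qed simp
    fix s' p' assume inv: "?Inv 0 s' p'"
    show "completes \<omega> (for_loop ''it'' ''p'' round_prog) s' p' (P * ((K * 75 + 40) + 15) + 15) (?Inv P)"
    proof (rule completes_for[where Inv = ?Inv])
      fix j s1 p1 assume inv: "?Inv j s1 p1"
      then have fr: "frame {''t'', ''it''} {''a'', ''s'', ''tau''} s s1" by blast
      note frs = frame_nats[OF fr] frame_reals[OF fr]
      show "nats s1 ''p'' 0 = P" using P by (simp add: frs)
      assume it: "nats s1 ''it'' 0 = j"
      have "nats s1 ''k'' 0 = K" using k by (simp add: frs)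
      then show "completes \<omega> round_prog s1 p1 (K * 75 + 40) (\<lambda>s' p'. nats s' ''it'' 0 = j \<and> ?Inv (Suc j) (set_nat ''it'' 0 (Suc j) s') p')"
      proof (rule completes_mono[OF completes_round])
        fix s2 p2 assume post: "p2 = p1 \<and> frame {''t''} {''s'', ''tau''} s1 s2 \<and> reals s2 ''s'' 0 =
          (\<Sum>t<K. min (reals s1 ''a'' t) (32 * reals s1 ''s'' 0 / (real K * reals s1 ''eps'' 0)))"
        then have fr2: "frame {''t''} {''s'', ''tau''} s1 s2" by blast
        have "frame {''t'', ''it''} {''a'', ''s'', ''tau''} s s2"
          by (rule frame_trans[OF fr fr2]) auto
        then show "nats s2 ''it'' 0 = j \<and> ?Inv (Suc j) (set_nat ''it'' 0 (Suc j) s2) p2"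
          using post inv it frame_nats[OF fr2] frame_reals[OF fr2] by (simp add: frs)
      qed simp
    qed (use inv in auto)
  qed
  then show ?thesis by (rule completes_mono) (simp_all add: algebra_simps)
qed

definition sketch_argument_prog :: com where
  "sketch_argument_prog = setN ''off'' (NConst 0) ;; sketch_prog"

text \<open>The query is sketched into the first free row without advancing \<open>pos\<close>, so
  the rows of the database are untouched and the next operation overwrites this row. The number of
  samples is \<open>E\<close> times the logarithm of \<open>2 * n * D / \<delta>\<close>, and the
  same indices serve all points.\<close>

definition query_program :: com where
  "query_program = sketch_argument_prog ;;
     log_prog ''k'' (NV ''E'') (RV ''delta'') (RMul (RConst 2) (RMul (RNat (NV ''n'')) (RNat (NV ''D'')))) ;;
     for_loop ''t'' ''k'' (SampleIndex ''J'' (NV ''t'') (NV ''M'')) ;;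
     setN ''base'' (NConst 0) ;;
     for_loop ''u'' ''n'' (estimate_prog ;;
       RAssign ''out'' (NV ''u'') (RDiv (RMul (RConst (sqrt (pi / 2))) (RV ''s'')) (RNat (NV ''k''))) ;;
       setN ''base'' (NAdd (NV ''base'') (NV ''M'')))"

definition add_program :: com where
  "add_program = sketch_argument_prog ;;
     setN ''pos'' (NAdd (NV ''pos'') (NV ''M'')) ;; setN ''n'' (NAdd (NV ''n'') (NConst 1))"

text \<open>
  \<open>stored\<close> is the memory layout between two operations: row \<open>i\<close> of the array \<open>S\<close>, of length
  \<open>M = m * 2 ^ Suc P\<close>, is the sketch of point \<open>i\<close>, and \<open>pos\<close> is the first free cell.
\<close>

definition stored :: "nat \<Rightarrow> real \<Rightarrow> real \<Rightarrow> nat \<Rightarrow> nat \<Rightarrow> nat \<Rightarrow> (nat \<Rightarrow> real) \<Rightarrow> point list \<Rightarrow> mem \<Rightarrow> bool" where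
  "stored d \<epsilon> \<delta> P m E g Y s \<longleftrightarrow>
     nats s ''d'' 0 = d \<and> nats s ''h'' 0 = 2 ^ P \<and> nats s ''D'' 0 = 2 ^ Suc P \<and> nats s ''p'' 0 = Suc P \<and>
     nats s ''m'' 0 = m \<and> nats s ''M'' 0 = m * 2 ^ Suc P \<and> nats s ''E'' 0 = E \<and>
     nats s ''n'' 0 = length Y \<and> nats s ''pos'' 0 = length Y * (m * 2 ^ Suc P) \<and>
     reals s ''eps'' 0 = \<epsilon> \<and> reals s ''delta'' 0 = \<delta> \<and> reals s ''g'' = g \<and>
     (\<forall>i<length Y. \<forall>e<m * 2 ^ Suc P. reals s ''S'' (i * (m * 2 ^ Suc P) + e) = sketch_coord P g (as_array (Y ! i)) e)"

lemma nats_feed [simp]: "nats (feed x s) = nats s"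
  and reals_feed: "reals (feed x s) a = (if a = ''in'' then as_array x else reals s a)"
  by (auto simp: feed_def)

lemma stored_feed: "stored d \<epsilon> \<delta> P m E g Y s \<Longrightarrow> stored d \<epsilon> \<delta> P m E g Y (feed x s)"
  by (simp add: stored_def reals_feed)

definition sketch_time :: "nat \<Rightarrow> nat \<Rightarrow> nat" where
  "sketch_time P m = m * (2 ^ Suc P * (Suc P * 105 + 68) + 67) + 18"

lemma mult_add_less: "i < (n::nat) \<Longrightarrow> e < M \<Longrightarrow> i * M + e < n * M"
proof -
  assume "i < n" "e < M"
  then have "i * M + e < Suc i * M" "Suc i * M \<le> n * M"
    by (simp, intro mult_le_mono1 Suc_leI)
  then show ?thesis by linarith
qed

lemma completes_sketch_argument:
  assumes st: "stored d \<epsilon> \<delta> P m E g Y s" and len: "length x = d"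
  shows "completes \<omega> sketch_argument_prog (feed x s) p (3 + sketch_time P m) (\<lambda>s' p'. p' = p \<and>
    stored d \<epsilon> \<delta> P m E g Y s' \<and>
    (\<forall>e<m * 2 ^ Suc P. reals s' ''S'' (length Y * (m * 2 ^ Suc P) + e) = sketch_coord P g (as_array x) e))"
  unfolding sketch_argument_prog_def
proof (rule completes_seq)
  let ?s = "set_nat ''off'' 0 0 (feed x s)"
  show "completes \<omega> (setN ''off'' (NConst 0)) (feed x s) p 3 (\<lambda>s' p'. s' = ?s \<and> p' = p)"
    by (rule completes_loop_free) simp_all
  have st': "stored d \<epsilon> \<delta> P m E g Y ?s" using stored_feed[OF st] by (simp add: stored_def)
  fix s' p' assume s': "s' = ?s \<and> p' = p"
  have v: "(\<lambda>l. if l < nats ?s ''d'' 0 then reals ?s ''in'' (nats ?s ''off'' 0 + l) else 0) = as_array x"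
    using st len by (auto simp: stored_def reals_feed as_array_def)
  have "completes \<omega> sketch_prog ?s p (sketch_time P m) (\<lambda>s' p'. p' = p \<and>
    frame sketch_nats sketch_reals ?s s' \<and>
    (\<forall>x<nats ?s ''pos'' 0. reals s' ''S'' x = reals ?s ''S'' x) \<and>
    (\<forall>e<m * 2 ^ Suc P. reals s' ''S'' (nats ?s ''pos'' 0 + e) = sketch_coord P (reals ?s ''g'')
      (\<lambda>l. if l < nats ?s ''d'' 0 then reals ?s ''in'' (nats ?s ''off'' 0 + l) else 0) e))"
    unfolding sketch_time_def by (rule completes_sketch) (use st' in \<open>simp_all only: stored_def\<close>)
  then have "completes \<omega> sketch_prog ?s p (sketch_time P m) (\<lambda>s' p'. p' = p \<and>
    stored d \<epsilon> \<delta> P m E g Y s' \<and>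
    (\<forall>e<m * 2 ^ Suc P. reals s' ''S'' (length Y * (m * 2 ^ Suc P) + e) = sketch_coord P g (as_array x) e))"
    unfolding v
  proof (rule completes_mono)
    fix s' p' assume post: "p' = p \<and> frame sketch_nats sketch_reals ?s s' \<and>
      (\<forall>x<nats ?s ''pos'' 0. reals s' ''S'' x = reals ?s ''S'' x) \<and>
      (\<forall>e<m * 2 ^ Suc P. reals s' ''S'' (nats ?s ''pos'' 0 + e) = sketch_coord P (reals ?s ''g'') (as_array x) e)"
    then have fr: "frame sketch_nats sketch_reals ?s s'" by blast
    note frs = frame_nats[OF fr] frame_reals[OF fr]
    have "stored d \<epsilon> \<delta> P m E g Y s'"
      using st' post mult_add_less unfolding stored_def by (simp add: frs del: power_Suc)
    then show "p' = p \<and> stored d \<epsilon> \<delta> P m E g Y s' \<and>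
      (\<forall>e<m * 2 ^ Suc P. reals s' ''S'' (length Y * (m * 2 ^ Suc P) + e) = sketch_coord P g (as_array x) e)"
      using st' post unfolding stored_def by (simp del: power_Suc)
  qed simp
  then show "completes \<omega> sketch_prog s' p' (sketch_time P m) (\<lambda>s' p'. p' = p \<and>
    stored d \<epsilon> \<delta> P m E g Y s' \<and>
    (\<forall>e<m * 2 ^ Suc P. reals s' ''S'' (length Y * (m * 2 ^ Suc P) + e) = sketch_coord P g (as_array x) e))"
    using s' by simp
qed

lemma completes_add:
  assumes st: "stored d \<epsilon> \<delta> P m E g Y s" and len: "length x = d"
  shows "completes \<omega> add_program (feed x s) p (sketch_time P m + 20) (\<lambda>s' p'. stored d \<epsilon> \<delta> P m E g (Y @ [x]) s')"
proof -
  have "completes \<omega> (sketch_argument_prog ;; setN ''pos'' (NAdd (NV ''pos'') (NV ''M'')) ;; setN ''n'' (NAdd (NV ''n'') (NConst 1))) (feed x s) p ((3 + sketch_time P m) + 17)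
     (\<lambda>s' p'. stored d \<epsilon> \<delta> P m E g (Y @ [x]) s')"
  proof (rule completes_seq[OF completes_sketch_argument[OF st len]])
    fix s' p' assume "p' = p \<and> stored d \<epsilon> \<delta> P m E g Y s' \<and>
      (\<forall>e<m * 2 ^ Suc P. reals s' ''S'' (length Y * (m * 2 ^ Suc P) + e) = sketch_coord P g (as_array x) e)"
    then show "completes \<omega> (setN ''pos'' (NAdd (NV ''pos'') (NV ''M'')) ;; setN ''n'' (NAdd (NV ''n'') (NConst 1))) s' p' 17
      (\<lambda>s' p'. stored d \<epsilon> \<delta> P m E g (Y @ [x]) s')"
      by (intro completes_loop_free) (auto simp: stored_def nth_append less_Suc_eq simp del: power_Suc)
  qed
  then show ?thesis
    unfolding add_program_def by (rule completes_mono) auto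
qed

lemma completes_query:
  assumes st: "stored d \<epsilon> \<delta> P m E g Y s" and len: "length q = d" and m: "0 < m" and \<delta>: "0 < \<delta>"
  defines "K \<equiv> clog2 \<delta> (2 * (real (length Y) * real (2 ^ Suc P))) * E"
  shows "completes \<omega> query_program (feed q s) 0
    (sketch_time P m + clog2 \<delta> (2 * (real (length Y) * real (2 ^ Suc P))) * 100 + K * 25 + length Y * ((P + 2) * (K * 75 + 55) + 40) + 200)
    (\<lambda>s' p'. stored d \<epsilon> \<delta> P m E g Y s' \<and> (\<forall>u<length Y. reals s' ''out'' u = sqrt (pi / 2) *
      robust_sum \<epsilon> K (\<lambda>t. \<bar>sketch_coord P g (\<lambda>l. as_array (Y ! u) l - as_array q l) (index_of (m * 2 ^ Suc P) (snd (\<omega> t)))\<bar>) (Suc P) / real K))"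
proof -
  define M where "M = m * 2 ^ Suc P"
  have M: "0 < M" using m by (simp add: M_def)
  define J where "J t = index_of M (snd (\<omega> t))" for t
  have JM: "J t < M" for t unfolding J_def by (rule index_of_less[OF M])
  define L where "L = clog2 \<delta> (2 * (real (length Y) * real (2 ^ Suc P)))"
  have KL: "K = L * E" by (simp add: K_def L_def)
  let ?st = "stored d \<epsilon> \<delta> P m E g Y"
  let ?row = "\<lambda>s. \<forall>e<M. reals s ''S'' (length Y * M + e) = sketch_coord P g (as_array q) e"
  let ?val = "\<lambda>u. sqrt (pi / 2) * robust_sum \<epsilon> K (\<lambda>t. \<bar>sketch_coord P g (\<lambda>l. as_array (Y ! u) l - as_array q l) (J t)\<bar>) (Suc P) / real K"
  let ?R1 = "\<lambda>s (p::nat). p = 0 \<and> ?st s \<and> ?row s"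
  let ?R2 = "\<lambda>s (p::nat). p = 0 \<and> ?st s \<and> ?row s \<and> nats s ''k'' 0 = K"
  \<comment> \<open>The head position belongs to the invariant: a query starts at cell 0 and samples
    nothing before this loop, so sample \<open>t\<close> reads cell \<open>t\<close>.\<close>
  let ?R3 = "\<lambda>k s (p::nat). p = k \<and> ?st s \<and> ?row s \<and> nats s ''k'' 0 = K \<and> (\<forall>t<k. nats s ''J'' t = J t)"
  let ?R4 = "\<lambda>j s (p::nat). ?st s \<and> ?row s \<and> nats s ''k'' 0 = K \<and> (\<forall>t<K. nats s ''J'' t = J t) \<and>
    nats s ''base'' 0 = j * M \<and> (\<forall>u<j. reals s ''out'' u = ?val u)"
  let ?T = "(P + 2) * (K * 75 + 55) + 20"
  let ?out = "RAssign ''out'' (NV ''u'') (RDiv (RMul (RConst (sqrt (pi / 2))) (RV ''s'')) (RNat (NV ''k'')))"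
  have "completes \<omega> (sketch_argument_prog ;;
     log_prog ''k'' (NV ''E'') (RV ''delta'') (RMul (RConst 2) (RMul (RNat (NV ''n'')) (RNat (NV ''D'')))) ;;
     for_loop ''t'' ''k'' (SampleIndex ''J'' (NV ''t'') (NV ''M'')) ;;
     setN ''base'' (NConst 0) ;;
     for_loop ''u'' ''n'' (estimate_prog ;; ?out ;; setN ''base'' (NAdd (NV ''base'') (NV ''M''))))
     (feed q s) 0 ((3 + sketch_time P m) + ((L * 100 + 100) + ((K * (10 + 15) + 15) + (3 + (length Y * (?T + 15) + 15))))) (?R4 (length Y))"
  proof (intro completes_seq)
    show "completes \<omega> sketch_argument_prog (feed q s) 0 (3 + sketch_time P m) ?R1"
      unfolding M_def by (rule completes_sketch_argument[OF st len])
  next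
    fix s p assume R1: "?R1 s p"
    have "completes \<omega> (log_prog ''k'' (NV ''E'') (RV ''delta'') (RMul (RConst 2) (RMul (RNat (NV ''n'')) (RNat (NV ''D''))))) s p
      (L * 100 + 100) (\<lambda>s' p'. p' = p \<and> nats s' ''k'' 0 = L * E \<and> frame {''k''} {''y''} s s')"
      unfolding L_def
    proof (rule completes_log[OF _ \<delta>])
      fix s' assume fr: "frame {''k''} {''y''} s s'"
      show "rval (RV ''delta'') s' = \<delta>" "nval (NV ''E'') s' = E"
        "rval (RMul (RConst 2) (RMul (RNat (NV ''n'')) (RNat (NV ''D'')))) s' = 2 * (real (length Y) * real (2 ^ Suc P))"
        using R1 by (simp_all add: frame_nats[OF fr] frame_reals[OF fr] stored_def)
    qed simp
    then show "completes \<omega> (log_prog ''k'' (NV ''E'') (RV ''delta'') (RMul (RConst 2) (RMul (RNat (NV ''n'')) (RNat (NV ''D''))))) s p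
      (L * 100 + 100) ?R2"
    proof (rule completes_mono)
      fix s' p' assume post: "p' = p \<and> nats s' ''k'' 0 = L * E \<and> frame {''k''} {''y''} s s'"
      then have fr: "frame {''k''} {''y''} s s'" by blast
      show "?R2 s' p'"
        using R1 post unfolding stored_def KL by (simp add: frame_nats[OF fr] frame_reals[OF fr] del: power_Suc)
    qed simp
  next
    fix s p assume R2: "?R2 s p"
    show "completes \<omega> (for_loop ''t'' ''k'' (SampleIndex ''J'' (NV ''t'') (NV ''M''))) s p (K * (10 + 15) + 15) (?R3 K)"
    proof (rule completes_for[where Inv = ?R3])
      fix k s p assume "?R3 k s p" "nats s ''t'' 0 = k"
      then show "completes \<omega> (SampleIndex ''J'' (NV ''t'') (NV ''M'')) s p 10
        (\<lambda>s' p'. nats s' ''t'' 0 = k \<and> ?R3 (Suc k) (set_nat ''t'' 0 (Suc k) s') p')"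
        by (intro completes_loop_free) (auto simp: stored_def less_Suc_eq J_def M_def simp del: power_Suc)
    qed (use R2 in \<open>auto simp: stored_def simp del: power_Suc\<close>)
  next
    fix s p assume "?R3 K s p"
    then show "completes \<omega> (setN ''base'' (NConst 0)) s p 3 (?R4 0)"
      by (intro completes_loop_free) (auto simp: stored_def simp del: power_Suc)
  next
    fix s p assume R4: "?R4 0 s p"
    show "completes \<omega> (for_loop ''u'' ''n'' (estimate_prog ;; ?out ;; setN ''base'' (NAdd (NV ''base'') (NV ''M'')))) s p
      (length Y * (?T + 15) + 15) (?R4 (length Y))"
    proof (rule completes_for[where Inv = ?R4])
      fix j s p assume inv: "?R4 j s p"
      then show "nats s ''n'' 0 = length Y" by (simp add: stored_def)
      assume j: "j < length Y" and u: "nats s ''u'' 0 = j"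
      define a where "a t = \<bar>reals s ''S'' (nats s ''base'' 0 + nats s ''J'' t) - reals s ''S'' (nats s ''pos'' 0 + nats s ''J'' t)\<bar>" for t
      \<comment> \<open>Linearity of the sketch, applied to the row of point \<open>j\<close> and
        the row of the query; \<open>J t < M\<close> keeps both addresses within their rows.\<close>
      have a: "a t = \<bar>sketch_coord P g (\<lambda>l. as_array (Y ! j) l - as_array q l) (J t)\<bar>" if "t < K" for t
        using inv j that JM[of t] unfolding a_def sketch_coord_diff[symmetric] stored_def M_def
        by (simp del: power_Suc)
      have rs: "robust_sum \<epsilon> K a i = robust_sum \<epsilon> K (\<lambda>t. \<bar>sketch_coord P g (\<lambda>l. as_array (Y ! j) l - as_array q l) (J t)\<bar>) i" for i
        by (induction i) (simp_all add: a)
      have "completes \<omega> (estimate_prog ;; ?out ;; setN ''base'' (NAdd (NV ''base'') (NV ''M''))) s p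
        ((Suc P + 1) * (K * 75 + 55) + 20)
        (\<lambda>s' p'. nats s' ''u'' 0 = j \<and> ?R4 (Suc j) (set_nat ''u'' 0 (Suc j) s') p')"
      proof (rule completes_seq[OF completes_estimate])
        show "nats s ''k'' 0 = K" "nats s ''p'' 0 = Suc P" using inv by (simp_all add: stored_def)
        fix s' p' assume "p' = p \<and> frame {''t'', ''it''} {''a'', ''s'', ''tau''} s s' \<and> reals s' ''s'' 0 = robust_sum (reals s ''eps'' 0) K
          (\<lambda>t. \<bar>reals s ''S'' (nats s ''base'' 0 + nats s ''J'' t) - reals s ''S'' (nats s ''pos'' 0 + nats s ''J'' t)\<bar>) (Suc P)"
        then have fr: "frame {''t'', ''it''} {''a'', ''s'', ''tau''} s s'"
          and sum0: "reals s' ''s'' 0 = robust_sum (reals s ''eps'' 0) K a (Suc P)"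
          unfolding a_def[abs_def] by blast+
        have "reals s ''eps'' 0 = \<epsilon>" using inv by (simp add: stored_def)
        then have sum: "reals s' ''s'' 0 = robust_sum \<epsilon> K
          (\<lambda>t. \<bar>sketch_coord P g (\<lambda>l. as_array (Y ! j) l - as_array q l) (J t)\<bar>) (Suc P)"
          using sum0 by (simp only: rs)
        note frs = frame_nats[OF fr] frame_reals[OF fr]
        show "completes \<omega> (?out ;; setN ''base'' (NAdd (NV ''base'') (NV ''M''))) s' p' 20
          (\<lambda>s' p'. nats s' ''u'' 0 = j \<and> ?R4 (Suc j) (set_nat ''u'' 0 (Suc j) s') p')"
          using inv u sum by (intro completes_loop_free)
            (auto simp: frs stored_def less_Suc_eq M_def simp del: power_Suc robust_sum.simps)
      qed
      then show "completes \<omega> (estimate_prog ;; ?out ;; setN ''base'' (NAdd (NV ''base'') (NV ''M''))) s p ?T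
        (\<lambda>s' p'. nats s' ''u'' 0 = j \<and> ?R4 (Suc j) (set_nat ''u'' 0 (Suc j) s') p')"
        by (rule completes_mono) auto
    qed (use R4 in \<open>auto simp: stored_def simp del: power_Suc\<close>)
  qed
  then show ?thesis
    unfolding query_program_def
  proof (elim completes_mono)
    show "(3 + sketch_time P m) + ((L * 100 + 100) + ((K * (10 + 15) + 15) + (3 + (length Y * (?T + 15) + 15))))
      \<le> sketch_time P m + clog2 \<delta> (2 * (real (length Y) * real (2 ^ Suc P))) * 100 + K * 25 + length Y * ((P + 2) * (K * 75 + 55) + 40) + 200"
      unfolding L_def[symmetric] by (simp add: algebra_simps)
  qed (auto simp: J_def M_def)
qed

section \<open>Initialization\<close>

text \<open>Starting from \<open>D = 2\<close> and \<open>h = 1\<close> keeps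
  \<open>D = 2 * h\<close> throughout, also for \<open>d = 1\<close>, so the transform always has at
  least one round.\<close>

definition padding_prog :: com where
  "padding_prog = (setN ''D'' (NConst 2) ;; setN ''h'' (NConst 1) ;; setN ''p'' (NConst 1)) ;;
     While (NLess (NV ''D'') (NV ''d''))
       (setN ''h'' (NV ''D'') ;; setN ''D'' (NAdd (NV ''D'') (NV ''D'')) ;; setN ''p'' (NAdd (NV ''p'') (NConst 1)))"

lemma completes_padding:
  assumes d: "nats s ''d'' 0 = d"
  defines "P \<equiv> clog2 2 (real d)"
  shows "completes \<omega> padding_prog s p (P * 40 + 30) (\<lambda>s' p'. p' = p \<and> frame {''D'', ''h'', ''p''} {} s s' \<and>
    nats s' ''D'' 0 = 2 ^ Suc P \<and> nats s' ''h'' 0 = 2 ^ P \<and> nats s' ''p'' 0 = Suc P)"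
proof -
  let ?Inv = "\<lambda>k s' (p'::nat). p' = p \<and> frame {''D'', ''h'', ''p''} {} s s' \<and>
    nats s' ''D'' 0 = 2 ^ Suc k \<and> nats s' ''h'' 0 = 2 ^ k \<and> nats s' ''p'' 0 = Suc k"
  let ?b = "NLess (NV ''D'') (NV ''d'')"
  let ?body = "setN ''h'' (NV ''D'') ;; setN ''D'' (NAdd (NV ''D'') (NV ''D'')) ;; setN ''p'' (NAdd (NV ''p'') (NConst 1))"
  have "completes \<omega> padding_prog s p (10 + (P * (20 + bcost ?b + 1) + bcost ?b + 1)) (?Inv P)"
    unfolding padding_prog_def
  proof (rule completes_seq)
    show "completes \<omega> (setN ''D'' (NConst 2) ;; setN ''h'' (NConst 1) ;; setN ''p'' (NConst 1)) s p 10 (?Inv 0)"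
      by (rule completes_loop_free) simp_all
    fix s' p' assume "?Inv 0 s' p'"
    then show "completes \<omega> (While ?b ?body) s' p' (P * (20 + bcost ?b + 1) + bcost ?b + 1) (?Inv P)"
    proof (rule completes_while)
      fix k s' p' assume k: "k < P" and inv: "?Inv k s' p'"
      have d': "nats s' ''d'' 0 = d" using inv d frame_nats[of "{''D'', ''h'', ''p''}" "{}" s s' "''d''"] by simp
      have "real (2 ^ Suc k) < real d"
        using less_clog2[of k 2 "real d"] k by (simp add: P_def mult.commute)
      then have "(2::nat) ^ Suc k < d" by (simp only: of_nat_less_iff)
      then show "bval ?b s' \<and> completes \<omega> ?body s' p' 20 (?Inv (Suc k))"
        using inv d' by (auto intro!: completes_loop_free)
    next
      fix s' p' assume inv: "?Inv P s' p'"
      have d': "nats s' ''d'' 0 = d" using inv d frame_nats[of "{''D'', ''h'', ''p''}" "{}" s s' "''d''"] by simp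
      have "real d \<le> real (2 ^ Suc P)"
        using clog2[of 2 "real d"] by (simp add: P_def mult.commute)
      then have "d \<le> 2 ^ Suc P" by (simp only: of_nat_le_iff)
      then show "\<not> bval ?b s'" using inv d' by simp
    qed
  qed
  then show ?thesis by (rule completes_mono) simp_all
qed

text \<open>Without rounding of reals, the integer \<open>E\<close> is found by counting upwards;
  its time of order \<open>1 / \<epsilon>^2\<close> fits into the budget of the
  initialization.\<close>

definition accuracy_prog :: com where
  "accuracy_prog = setN ''E'' (NConst 0) ;;
     While (RLess (RMul (RNat (NV ''E'')) (RMul (RV ''eps'') (RV ''eps''))) (RConst 16384)) (setN ''E'' (NAdd (NV ''E'') (NConst 1)))"

lemma completes_accuracy:
  assumes eps: "reals s ''eps'' 0 = \<epsilon>" "0 < \<epsilon>"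
  defines "E \<equiv> nat \<lceil>16384 / \<epsilon>\<^sup>2\<rceil>"
  shows "completes \<omega> accuracy_prog s p (E * 30 + 30) (\<lambda>s' p'. p' = p \<and> frame {''E''} {} s s' \<and> nats s' ''E'' 0 = E)"
proof -
  let ?Inv = "\<lambda>k s' (p'::nat). p' = p \<and> frame {''E''} {} s s' \<and> nats s' ''E'' 0 = k"
  let ?b = "RLess (RMul (RNat (NV ''E'')) (RMul (RV ''eps'') (RV ''eps''))) (RConst 16384)"
  have iff: "real k * (\<epsilon> * \<epsilon>) < 16384 \<longleftrightarrow> k < E" for k
  proof -
    have "k < E \<longleftrightarrow> real k < 16384 / \<epsilon>\<^sup>2"
      unfolding E_def by linarith
    then show ?thesis using eps(2) by (simp add: pos_less_divide_eq power2_eq_square)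
  qed
  have "completes \<omega> accuracy_prog s p (3 + (E * (6 + bcost ?b + 1) + bcost ?b + 1)) (?Inv E)"
    unfolding accuracy_prog_def
  proof (rule completes_seq)
    show "completes \<omega> (setN ''E'' (NConst 0)) s p 3 (?Inv 0)"
      by (rule completes_loop_free) simp_all
    fix s' p' assume "?Inv 0 s' p'"
    then show "completes \<omega> (While ?b (setN ''E'' (NAdd (NV ''E'') (NConst 1)))) s' p' (E * (6 + bcost ?b + 1) + bcost ?b + 1) (?Inv E)"
    proof (rule completes_while)
      fix k s' p' assume k: "k < E" and inv: "?Inv k s' p'"
      have "reals s' ''eps'' 0 = \<epsilon>" using inv eps(1) frame_reals[of "{''E''}" "{}" s s' "''eps''"] by simp
      then show "bval ?b s' \<and> completes \<omega> (setN ''E'' (NAdd (NV ''E'') (NConst 1))) s' p' 6 (?Inv (Suc k))"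
        using inv iff[of k] k by (auto intro!: completes_loop_free)
    next
      fix s' p' assume inv: "?Inv E s' p'"
      have "reals s' ''eps'' 0 = \<epsilon>" using inv eps(1) frame_reals[of "{''E''}" "{}" s s' "''eps''"] by simp
      then show "\<not> bval ?b s'" using inv iff[of E] by simp
    qed
  qed
  then show ?thesis by (rule completes_mono) simp_all
qed

text \<open>Each multiplication has a logarithmic quantity or \<open>D\<close> as its second factor,
  so the products are cheap to compute although \<open>m\<close> is of order
  \<open>1 / \<epsilon>^2\<close>.\<close>

definition copies_prog :: com where
  "copies_prog =
     log_prog ''Lam'' (NConst 1) (RV ''eps'') (RMul (RConst 64) (RNat (NV ''D''))) ;;
     log_prog ''q'' (NConst 1) (RV ''delta'') (RConst 1) ;;
     (setN ''w'' (NAdd (NAdd (NV ''Lam'') (NV ''q'')) (NConst 1)) ;; setN ''Lam'' (NAdd (NV ''Lam'') (NConst 1))) ;;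
     mult_prog ''x'' ''E'' ''Lam'' ;; mult_prog ''z'' ''x'' ''Lam'' ;; mult_prog ''m'' ''z'' ''w'' ;; mult_prog ''M'' ''m'' ''D''"

lemma completes_copies:
  assumes "nats s ''D'' 0 = D" "nats s ''E'' 0 = E" and \<epsilon>: "reals s ''eps'' 0 = \<epsilon>" "0 < \<epsilon>" and \<delta>: "reals s ''delta'' 0 = \<delta>" "0 < \<delta>"
  defines "\<Lambda> \<equiv> clog2 \<epsilon> (64 * real D)" and "q \<equiv> clog2 \<delta> 1"
  shows "completes \<omega> copies_prog s p (\<Lambda> * 200 + q * 200 + D * 25 + 500) (\<lambda>s' p'. p' = p \<and>
    frame {''Lam'', ''q'', ''w'', ''x'', ''z'', ''m'', ''M'', ''c''} {''y''} s s' \<and>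
    nats s' ''m'' 0 = E * (\<Lambda> + 1)\<^sup>2 * (\<Lambda> + q + 1) \<and> nats s' ''M'' 0 = E * (\<Lambda> + 1)\<^sup>2 * (\<Lambda> + q + 1) * D)"
proof -
  let ?N = "{''Lam'', ''q'', ''w'', ''x'', ''z'', ''m'', ''M'', ''c''}"
  let ?fr = "frame ?N {''y''} s"
  have extend: "?fr s''" if "?fr s'" "frame N R s' s''" "N \<subseteq> ?N" "R \<subseteq> {''y''}" for s' s'' N R
    by (rule frame_trans[OF that(1,2)]) (use that in auto)
  have D: "nats s' ''D'' 0 = D" and E: "nats s' ''E'' 0 = E" and eps: "reals s' ''eps'' 0 = \<epsilon>" and delta: "reals s' ''delta'' 0 = \<delta>"
    if fr: "?fr s'" for s'
    using assms(1-3) \<delta>(1) by (simp_all add: frame_nats[OF fr] frame_reals[OF fr])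
  let ?m = "E * (\<Lambda> + 1) * (\<Lambda> + 1) * (\<Lambda> + q + 1)"
  let ?R1 = "\<lambda>s' (p'::nat). p' = p \<and> ?fr s' \<and> nats s' ''Lam'' 0 = \<Lambda>"
  let ?R2 = "\<lambda>s' (p'::nat). p' = p \<and> ?fr s' \<and> nats s' ''Lam'' 0 = \<Lambda> \<and> nats s' ''q'' 0 = q"
  let ?R3 = "\<lambda>s' (p'::nat). p' = p \<and> ?fr s' \<and> nats s' ''Lam'' 0 = \<Lambda> + 1 \<and> nats s' ''w'' 0 = \<Lambda> + q + 1"
  let ?R4 = "\<lambda>s' p'. ?R3 s' p' \<and> nats s' ''x'' 0 = E * (\<Lambda> + 1)"
  let ?R5 = "\<lambda>s' p'. ?R3 s' p' \<and> nats s' ''z'' 0 = E * (\<Lambda> + 1) * (\<Lambda> + 1)"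
  let ?R6 = "\<lambda>s' p'. ?R3 s' p' \<and> nats s' ''m'' 0 = ?m"
  let ?R7 = "\<lambda>s' p'. ?R6 s' p' \<and> nats s' ''M'' 0 = ?m * D"
  have "completes \<omega> copies_prog s p ((\<Lambda> * 100 + 100) + ((q * 100 + 100) + (20 + (((\<Lambda> + 1) * 25 + 20) + (((\<Lambda> + 1) * 25 + 20) +
    (((\<Lambda> + q + 1) * 25 + 20) + (D * 25 + 20))))))) ?R7"
    unfolding copies_prog_def
  proof (rule completes_seq)
    have "completes \<omega> (log_prog ''Lam'' (NConst 1) (RV ''eps'') (RMul (RConst 64) (RNat (NV ''D'')))) s p (\<Lambda> * 100 + 100)
      (\<lambda>s' p'. p' = p \<and> nats s' ''Lam'' 0 = \<Lambda> * 1 \<and> frame {''Lam''} {''y''} s s')"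
      unfolding \<Lambda>_def
    proof (rule completes_log[OF _ \<epsilon>(2)])
      fix s' assume fr: "frame {''Lam''} {''y''} s s'"
      show "rval (RV ''eps'') s' = \<epsilon>" "rval (RMul (RConst 64) (RNat (NV ''D''))) s' = 64 * real D" "nval (NConst 1) s' = 1"
        using assms(1,3) by (simp_all add: frame_nats[OF fr] frame_reals[OF fr])
    qed simp
    then show "completes \<omega> (log_prog ''Lam'' (NConst 1) (RV ''eps'') (RMul (RConst 64) (RNat (NV ''D'')))) s p (\<Lambda> * 100 + 100) ?R1"
    proof (rule completes_mono)
      fix s' p' assume post: "p' = p \<and> nats s' ''Lam'' 0 = \<Lambda> * 1 \<and> frame {''Lam''} {''y''} s s'"
      then have "frame {''Lam''} {''y''} s s'" by blast
      then have "?fr s'" by (rule extend[OF frame_refl]) auto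
      then show "?R1 s' p'" using post by simp
    qed simp
  next
    fix s1 p1 assume R1: "?R1 s1 p1"
    show "completes \<omega> (log_prog ''q'' (NConst 1) (RV ''delta'') (RConst 1) ;;
     (setN ''w'' (NAdd (NAdd (NV ''Lam'') (NV ''q'')) (NConst 1)) ;; setN ''Lam'' (NAdd (NV ''Lam'') (NConst 1))) ;;
     mult_prog ''x'' ''E'' ''Lam'' ;; mult_prog ''z'' ''x'' ''Lam'' ;; mult_prog ''m'' ''z'' ''w'' ;; mult_prog ''M'' ''m'' ''D'') s1 p1
     ((q * 100 + 100) + (20 + (((\<Lambda> + 1) * 25 + 20) + (((\<Lambda> + 1) * 25 + 20) + (((\<Lambda> + q + 1) * 25 + 20) + (D * 25 + 20)))))) ?R7"
    proof (rule completes_seq)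
      have "completes \<omega> (log_prog ''q'' (NConst 1) (RV ''delta'') (RConst 1)) s1 p1 (q * 100 + 100)
        (\<lambda>s' p'. p' = p1 \<and> nats s' ''q'' 0 = q * 1 \<and> frame {''q''} {''y''} s1 s')"
        unfolding q_def
      proof (rule completes_log[OF _ \<delta>(2)])
        fix s' assume fr: "frame {''q''} {''y''} s1 s'"
        show "rval (RV ''delta'') s' = \<delta>" "rval (RConst 1) s' = 1" "nval (NConst 1) s' = 1"
          using R1 delta[of s1] by (simp_all add: frame_reals[OF fr])
      qed simp
      then show "completes \<omega> (log_prog ''q'' (NConst 1) (RV ''delta'') (RConst 1)) s1 p1 (q * 100 + 100) ?R2"
      proof (rule completes_mono)
        fix s' p' assume post: "p' = p1 \<and> nats s' ''q'' 0 = q * 1 \<and> frame {''q''} {''y''} s1 s'"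
        then have fr: "frame {''q''} {''y''} s1 s'" by blast
        have "?fr s1" using R1 by blast
        then have "?fr s'" by (rule extend[OF _ fr]) auto
        then show "?R2 s' p'" using post R1 frame_nats[OF fr] by simp
      qed simp
    next
      fix s2 p2 assume R2: "?R2 s2 p2"
      show "completes \<omega> ((setN ''w'' (NAdd (NAdd (NV ''Lam'') (NV ''q'')) (NConst 1)) ;; setN ''Lam'' (NAdd (NV ''Lam'') (NConst 1))) ;;
        mult_prog ''x'' ''E'' ''Lam'' ;; mult_prog ''z'' ''x'' ''Lam'' ;; mult_prog ''m'' ''z'' ''w'' ;; mult_prog ''M'' ''m'' ''D'') s2 p2
        (20 + (((\<Lambda> + 1) * 25 + 20) + (((\<Lambda> + 1) * 25 + 20) + (((\<Lambda> + q + 1) * 25 + 20) + (D * 25 + 20))))) ?R7"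
      proof (rule completes_seq)
        show "completes \<omega> (setN ''w'' (NAdd (NAdd (NV ''Lam'') (NV ''q'')) (NConst 1)) ;; setN ''Lam'' (NAdd (NV ''Lam'') (NConst 1))) s2 p2 20 ?R3"
          using R2 by (intro completes_loop_free) simp_all
      next
        fix s3 p3 assume R3: "?R3 s3 p3"
        show "completes \<omega> (mult_prog ''x'' ''E'' ''Lam'' ;; mult_prog ''z'' ''x'' ''Lam'' ;; mult_prog ''m'' ''z'' ''w'' ;; mult_prog ''M'' ''m'' ''D'') s3 p3
          (((\<Lambda> + 1) * 25 + 20) + (((\<Lambda> + 1) * 25 + 20) + (((\<Lambda> + q + 1) * 25 + 20) + (D * 25 + 20)))) ?R7"
        proof (intro completes_seq)
          have mult: "completes \<omega> (mult_prog x y z) s' p' (b * 25 + 20) (\<lambda>s'' p''. p'' = p \<and> ?fr s'' \<and> nats s'' x 0 = a * b \<and>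
              (\<forall>v. v \<noteq> x \<and> v \<noteq> ''c'' \<longrightarrow> nats s'' v = nats s' v))"
            if "p' = p" "?fr s'" "distinct [x, y, ''c'']" "x \<noteq> z" "z \<noteq> ''c''" "nats s' y 0 = a" "nats s' z 0 = b" "x \<in> ?N" for x y z s' p' a b
          proof (rule completes_mono[OF completes_mult[OF that(3-7)]])
            fix s'' p'' assume post: "p'' = p' \<and> nats s'' x 0 = a * b \<and> frame {x, ''c''} {} s' s''"
            then have fr: "frame {x, ''c''} {} s' s''" by blast
            have "?fr s''" by (rule extend[OF that(2) fr]) (use that in auto)
            then show "p'' = p \<and> ?fr s'' \<and> nats s'' x 0 = a * b \<and> (\<forall>v. v \<noteq> x \<and> v \<noteq> ''c'' \<longrightarrow> nats s'' v = nats s' v)"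
              using post that(1) frame_nats[OF fr] by simp
          qed simp
          show "completes \<omega> (mult_prog ''x'' ''E'' ''Lam'') s3 p3 ((\<Lambda> + 1) * 25 + 20) ?R4"
            by (rule completes_mono[OF mult[where a = "E" and b = "\<Lambda> + 1"]]) (use R3 E in \<open>simp_all del: mult_Suc_right mult_Suc\<close>)
          show "completes \<omega> (mult_prog ''z'' ''x'' ''Lam'') s4 p4 ((\<Lambda> + 1) * 25 + 20) ?R5" if "?R4 s4 p4" for s4 p4
            by (rule completes_mono[OF mult[where a = "E * (\<Lambda> + 1)" and b = "\<Lambda> + 1"]]) (use that in \<open>simp_all del: mult_Suc_right mult_Suc\<close>)
          show "completes \<omega> (mult_prog ''m'' ''z'' ''w'') s5 p5 ((\<Lambda> + q + 1) * 25 + 20) ?R6" if "?R5 s5 p5" for s5 p5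
            by (rule completes_mono[OF mult[where a = "E * (\<Lambda> + 1) * (\<Lambda> + 1)" and b = "\<Lambda> + q + 1"]]) (use that in \<open>simp_all del: mult_Suc_right mult_Suc\<close>)
          show "completes \<omega> (mult_prog ''M'' ''m'' ''D'') s6 p6 (D * 25 + 20) ?R7" if "?R6 s6 p6" for s6 p6
            by (rule completes_mono[OF mult[where a = "?m" and b = "D"]]) (use that D in \<open>simp_all del: mult_Suc_right mult_Suc\<close>)
        qed
      qed
    qed
  qed
  then show ?thesis by (rule completes_mono) (simp_all add: power2_eq_square algebra_simps)
qed

text \<open>No sample is drawn earlier, so entry \<open>i\<close> of \<open>g\<close> is the clipped
  Gaussian of tape cell \<open>i\<close>, in agreement with the good event for the sketch.\<close>

definition gaussian_prog :: com where
  "gaussian_prog = setR ''T'' (RDiv (RConst 8) (RV ''eps'')) ;; for_loop ''e'' ''M'' (SampleNormal ''g'' (NV ''e'') ;;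
     Cond (RLess (RV ''T'') (RCell ''g'' (NV ''e''))) (RAssign ''g'' (NV ''e'') (RV ''T'')) Skip ;;
     Cond (RLess (RCell ''g'' (NV ''e'')) (RSub (RConst 0) (RV ''T''))) (RAssign ''g'' (NV ''e'') (RSub (RConst 0) (RV ''T''))) Skip)"

lemma completes_gaussian:
  assumes M: "nats s ''M'' 0 = M" and \<epsilon>: "reals s ''eps'' 0 = \<epsilon>" "0 < \<epsilon>"
  shows "completes \<omega> gaussian_prog s 0 (M * 75 + 30) (\<lambda>s' p'. frame {''e''} {''T'', ''g''} s s' \<and>
    (\<forall>i<M. reals s' ''g'' i = clip (8 / \<epsilon>) (fst (\<omega> i))))"
proof -
  let ?Inv = "\<lambda>k s' p'. p' = k \<and> frame {''e''} {''T'', ''g''} s s' \<and> reals s' ''T'' 0 = 8 / \<epsilon> \<and>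
    (\<forall>i<k. reals s' ''g'' i = clip (8 / \<epsilon>) (fst (\<omega> i)))"
  have T: "0 < 8 / \<epsilon>" using \<epsilon> by simp
  have "completes \<omega> gaussian_prog s 0 (10 + (M * (60 + 15) + 15)) (?Inv M)"
    unfolding gaussian_prog_def
  proof (rule completes_seq)
    show "completes \<omega> (setR ''T'' (RDiv (RConst 8) (RV ''eps''))) s 0 10 (\<lambda>s' p'. s' = set_real ''T'' 0 (8 / \<epsilon>) s \<and> p' = 0)"
      using \<epsilon> by (intro completes_loop_free) simp_all
    fix s' p' assume s': "s' = set_real ''T'' 0 (8 / \<epsilon>) s \<and> p' = (0::nat)"
    show "completes \<omega> (for_loop ''e'' ''M'' (SampleNormal ''g'' (NV ''e'') ;;
     Cond (RLess (RV ''T'') (RCell ''g'' (NV ''e''))) (RAssign ''g'' (NV ''e'') (RV ''T'')) Skip ;;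
     Cond (RLess (RCell ''g'' (NV ''e'')) (RSub (RConst 0) (RV ''T''))) (RAssign ''g'' (NV ''e'') (RSub (RConst 0) (RV ''T''))) Skip))
      s' p' (M * (60 + 15) + 15) (?Inv M)"
    proof (rule completes_for[where Inv = ?Inv])
      fix k s' p' assume inv: "?Inv k s' p'"
      then have fr: "frame {''e''} {''T'', ''g''} s s'" by blast
      show "nats s' ''M'' 0 = M" using M by (simp add: frame_nats[OF fr])
      assume "nats s' ''e'' 0 = k"
      then show "completes \<omega> (SampleNormal ''g'' (NV ''e'') ;;
        Cond (RLess (RV ''T'') (RCell ''g'' (NV ''e''))) (RAssign ''g'' (NV ''e'') (RV ''T'')) Skip ;;
        Cond (RLess (RCell ''g'' (NV ''e'')) (RSub (RConst 0) (RV ''T''))) (RAssign ''g'' (NV ''e'') (RSub (RConst 0) (RV ''T''))) Skip) s' p' 60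
        (\<lambda>s' p'. nats s' ''e'' 0 = k \<and> ?Inv (Suc k) (set_nat ''e'' 0 (Suc k) s') p')"
        using inv T by (intro completes_loop_free) (simp_all add: less_Suc_eq clip_def max_def min_def)
    qed (use s' in auto)
  qed
  then show ?thesis by (rule completes_mono) auto
qed

definition init_program :: com where
  "init_program = padding_prog ;; accuracy_prog ;; copies_prog ;; gaussian_prog ;;
     for_loop ''u'' ''n'' (sketch_prog ;; setN ''pos'' (NAdd (NV ''pos'') (NV ''M'')) ;; setN ''off'' (NAdd (NV ''off'') (NV ''d'')))"

lemma as_array_concat:
  assumes "\<And>x. x \<in> set X \<Longrightarrow> length x = d" "k < length X" "l < d"
  shows "as_array (concat X) (k * d + l) = X ! k ! l"
proof -
  have "k * d + l < length (concat X) \<and> concat X ! (k * d + l) = X ! k ! l"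
    using assms
  proof (induction X arbitrary: k)
    case (Cons x X)
    show ?case
    proof (cases k)
      case 0
      then show ?thesis using Cons.prems by (simp add: nth_append)
    next
      case (Suc j)
      have "j * d + l < length (concat X) \<and> concat X ! (j * d + l) = X ! j ! l"
        using Cons.prems Suc by (intro Cons.IH) auto
      then show ?thesis using Suc Cons.prems(1)[of x] by (simp add: nth_append add.assoc)
    qed
  qed simp
  then show ?thesis by (simp add: as_array_def)
qed

locale parameters =
  fixes d :: nat and \<epsilon> \<delta> :: real
  assumes d: "1 \<le> d" and eps: "0 < \<epsilon>" "\<epsilon> < 1 / 2" and delta: "0 < \<delta>" "\<delta> < 1 / 2"
begin

definition P :: nat where "P = clog2 2 (real d)"
definition E :: nat where "E = nat \<lceil>16384 / \<epsilon>\<^sup>2\<rceil>"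
definition \<Lambda> :: nat where "\<Lambda> = clog2 \<epsilon> (64 * real (2 ^ Suc P))"
definition q :: nat where "q = clog2 \<delta> 1"
definition m :: nat where "m = E * (\<Lambda> + 1)\<^sup>2 * (\<Lambda> + q + 1)"

lemma completes_init:
  assumes X: "\<And>x. x \<in> set X \<Longrightarrow> length x = d"
  shows "completes \<omega> init_program (initial_mem d \<epsilon> \<delta> X) 0
    ((P * 40 + 30) + ((E * 30 + 30) + ((\<Lambda> * 200 + q * 200 + 2 ^ Suc P * 25 + 500) + ((m * 2 ^ Suc P * 75 + 30) +
      (length X * ((sketch_time P m + 20) + 15) + 15)))))
    (\<lambda>s' p'. \<exists>g. stored d \<epsilon> \<delta> P m E g X s' \<and> (\<forall>i<m * 2 ^ Suc P. g i = clip (8 / \<epsilon>) (fst (\<omega> i))))"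
proof -
  define s0 where "s0 = initial_mem d \<epsilon> \<delta> X"
  define M where "M = m * 2 ^ Suc P"
  have s0: "nats s0 ''d'' 0 = d" "nats s0 ''n'' 0 = length X" "nats s0 ''pos'' 0 = 0" "nats s0 ''off'' 0 = 0"
    "reals s0 ''eps'' 0 = \<epsilon>" "reals s0 ''delta'' 0 = \<delta>" "reals s0 ''in'' = as_array (concat X)"
    by (simp_all add: s0_def initial_mem_def)
  let ?loop = "for_loop ''u'' ''n'' (sketch_prog ;; setN ''pos'' (NAdd (NV ''pos'') (NV ''M'')) ;; setN ''off'' (NAdd (NV ''off'') (NV ''d'')))"
  let ?copies = "{''Lam'', ''q'', ''w'', ''x'', ''z'', ''m'', ''M'', ''c''}"
  let ?Inv = "\<lambda>g k (s::mem). nats s ''d'' 0 = d \<and> nats s ''h'' 0 = 2 ^ P \<and> nats s ''D'' 0 = 2 ^ Suc P \<and> nats s ''p'' 0 = Suc P \<and>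
     nats s ''m'' 0 = m \<and> nats s ''M'' 0 = M \<and> nats s ''E'' 0 = E \<and>
     nats s ''n'' 0 = length X \<and> nats s ''pos'' 0 = k * M \<and> nats s ''off'' 0 = k * d \<and>
     reals s ''eps'' 0 = \<epsilon> \<and> reals s ''delta'' 0 = \<delta> \<and> reals s ''g'' = g \<and> reals s ''in'' = as_array (concat X) \<and>
     (\<forall>i<k. \<forall>e<M. reals s ''S'' (i * M + e) = sketch_coord P g (as_array (X ! i)) e)"
  let ?Q = "\<lambda>s' (p'::nat). \<exists>g. stored d \<epsilon> \<delta> P m E g X s' \<and> (\<forall>i<M. g i = clip (8 / \<epsilon>) (fst (\<omega> i)))"
  show ?thesis
    unfolding init_program_def s0_def[symmetric] M_def[symmetric]
  proof (rule completes_seq[OF completes_padding[OF s0(1), folded P_def]])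
    fix s1 p1 assume post1: "p1 = (0::nat) \<and> frame {''D'', ''h'', ''p''} {} s0 s1 \<and>
      nats s1 ''D'' 0 = 2 ^ Suc P \<and> nats s1 ''h'' 0 = 2 ^ P \<and> nats s1 ''p'' 0 = Suc P"
    then have fr1: "frame {''D'', ''h'', ''p''} {} s0 s1" by blast
    note frs1 = frame_nats[OF fr1] frame_reals[OF fr1]
    have eps1: "reals s1 ''eps'' 0 = \<epsilon>" by (simp add: frs1 s0)
    show "completes \<omega> (accuracy_prog ;; copies_prog ;; gaussian_prog ;; ?loop) s1 p1
      ((E * 30 + 30) + ((\<Lambda> * 200 + q * 200 + 2 ^ Suc P * 25 + 500) + ((M * 75 + 30) + (length X * ((sketch_time P m + 20) + 15) + 15)))) ?Q"
    proof (rule completes_seq[OF completes_accuracy[OF eps1 eps(1), folded E_def]])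
      fix s2 p2 assume post2: "p2 = p1 \<and> frame {''E''} {} s1 s2 \<and> nats s2 ''E'' 0 = E"
      then have fr2: "frame {''E''} {} s1 s2" by blast
      note frs2 = frame_nats[OF fr2] frame_reals[OF fr2]
      have D2: "nats s2 ''D'' 0 = 2 ^ Suc P" "nats s2 ''E'' 0 = E" "reals s2 ''eps'' 0 = \<epsilon>" "reals s2 ''delta'' 0 = \<delta>"
        using post1 post2 by (simp_all add: frs1 frs2 s0)
      show "completes \<omega> (copies_prog ;; gaussian_prog ;; ?loop) s2 p2
        ((\<Lambda> * 200 + q * 200 + 2 ^ Suc P * 25 + 500) + ((M * 75 + 30) + (length X * ((sketch_time P m + 20) + 15) + 15))) ?Q"
      proof (rule completes_seq[OF completes_copies[OF D2(1,2,3) eps(1) D2(4) delta(1), folded \<Lambda>_def q_def, folded m_def, folded M_def]])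
        fix s3 p3 assume post3: "p3 = p2 \<and> frame ?copies {''y''} s2 s3 \<and> nats s3 ''m'' 0 = m \<and> nats s3 ''M'' 0 = M"
        then have fr3: "frame ?copies {''y''} s2 s3" and M3: "nats s3 ''M'' 0 = M" and p3: "p3 = 0"
          using post1 post2 by auto
        note frs3 = frame_nats[OF fr3] frame_reals[OF fr3]
        have eps3: "reals s3 ''eps'' 0 = \<epsilon>" using D2 by (simp add: frs3)
        show "completes \<omega> (gaussian_prog ;; ?loop) s3 p3 ((M * 75 + 30) + (length X * ((sketch_time P m + 20) + 15) + 15)) ?Q"
          unfolding p3
        proof (rule completes_seq[OF completes_gaussian[OF M3 eps3 eps(1)]])
          fix s4 p4 assume post4: "frame {''e''} {''T'', ''g''} s3 s4 \<and> (\<forall>i<M. reals s4 ''g'' i = clip (8 / \<epsilon>) (fst (\<omega> i)))"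
          then have fr4: "frame {''e''} {''T'', ''g''} s3 s4" by blast
          note frs4 = frame_nats[OF fr4] frame_reals[OF fr4]
          define g where "g = reals s4 ''g''"
          have start: "?Inv g 0 s4"
            using post1 post2 post3 by (simp add: frs1 frs2 frs3 frs4 s0 g_def)
          have "completes \<omega> ?loop s4 p4 (length X * ((sketch_time P m + 20) + 15) + 15) (\<lambda>s' p'. stored d \<epsilon> \<delta> P m E g X s')"
          proof (rule completes_for[where Inv = "\<lambda>k s p. ?Inv g k s"])
            show "?Inv g 0 (set_nat ''u'' 0 0 s4)" using start by (simp del: power_Suc)
            fix k s p assume inv: "?Inv g k s"
            then show "nats s ''n'' 0 = length X" by blast
            assume k: "k < length X" and u: "nats s ''u'' 0 = k"
            let ?v = "\<lambda>l. if l < nats s ''d'' 0 then reals s ''in'' (nats s ''off'' 0 + l) else 0"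
            have v: "?v = as_array (X ! k)"
              using inv k X[of "X ! k"] as_array_concat[OF X k] by (auto simp: as_array_def[of "X ! k"])
            have "completes \<omega> (sketch_prog ;; setN ''pos'' (NAdd (NV ''pos'') (NV ''M'')) ;; setN ''off'' (NAdd (NV ''off'') (NV ''d''))) s p
              ((m * (2 ^ Suc P * (Suc P * 105 + 68) + 67) + 18) + 20)
              (\<lambda>s' p'. nats s' ''u'' 0 = k \<and> ?Inv g (Suc k) (set_nat ''u'' 0 (Suc k) s'))"
            proof (rule completes_seq[OF completes_sketch[where s = s and P = P and m = m]])
              fix s' p' assume post: "p' = p \<and> frame sketch_nats sketch_reals s s' \<and>
                (\<forall>x<nats s ''pos'' 0. reals s' ''S'' x = reals s ''S'' x) \<and>
                (\<forall>e<m * 2 ^ Suc P. reals s' ''S'' (nats s ''pos'' 0 + e) = sketch_coord P (reals s ''g'') ?v e)"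
              then have fr: "frame sketch_nats sketch_reals s s'" by blast
              note frs = frame_nats[OF fr] frame_reals[OF fr]
              have S: "\<forall>i<Suc k. \<forall>e<M. reals s' ''S'' (i * M + e) = sketch_coord P g (as_array (X ! i)) e"
              proof (intro allI impI)
                fix i e assume i: "i < Suc k" and e: "e < M"
                show "reals s' ''S'' (i * M + e) = sketch_coord P g (as_array (X ! i)) e"
                proof (cases "i = k")
                  case True
                  then show ?thesis using post inv e unfolding v M_def[symmetric] by (simp del: power_Suc)
                next
                  case False
                  then have "i < k" using i by simp
                  then have "reals s' ''S'' (i * M + e) = reals s ''S'' (i * M + e)"
                    using post inv mult_add_less[OF \<open>i < k\<close> e] by metis
                  then show ?thesis using inv \<open>i < k\<close> e by metis
                qed
              qed
              show "completes \<omega> (setN ''pos'' (NAdd (NV ''pos'') (NV ''M'')) ;; setN ''off'' (NAdd (NV ''off'') (NV ''d''))) s' p' 20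
                (\<lambda>s' p'. nats s' ''u'' 0 = k \<and> ?Inv g (Suc k) (set_nat ''u'' 0 (Suc k) s'))"
                using inv u S by (intro completes_loop_free) (simp_all add: frs del: power_Suc)
            qed (use inv in simp_all)
            then show "completes \<omega> (sketch_prog ;; setN ''pos'' (NAdd (NV ''pos'') (NV ''M'')) ;; setN ''off'' (NAdd (NV ''off'') (NV ''d''))) s p
              (sketch_time P m + 20) (\<lambda>s' p'. nats s' ''u'' 0 = k \<and> ?Inv g (Suc k) (set_nat ''u'' 0 (Suc k) s'))"
              by (simp only: sketch_time_def)
          next
            fix s assume "?Inv g (length X) s"
            then show "stored d \<epsilon> \<delta> P m E g X s" by (simp add: stored_def M_def del: power_Suc)
          qed simp
          then show "completes \<omega> ?loop s4 p4 (length X * ((sketch_time P m + 20) + 15) + 15) ?Q"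
            by (rule completes_mono) (use post4 in \<open>auto simp: g_def\<close>)
        qed
      qed
    qed
  qed
qed

end

section \<open>The guarantees\<close>

lemma completes_run:
  assumes "completes \<omega> c s 0 T Q"
  obtains t s' p where "run \<omega> c s t s'" "t \<le> T" "Q s' p"
  using assms unfolding completes_def run_def by blast

text \<open>Execution is deterministic on a fixed tape, so the run exhibited by
  \<open>completes\<close> is the only one. Postconditions thus carry over to the arbitrary runs
  that make up a history.\<close>

lemma run_completes:
  assumes "completes \<omega> c s 0 T Q" "run \<omega> c s t s'"
  obtains p where "t \<le> T" "Q s' p"
proof -
  obtain p' where 1: "exec \<omega> c (s, 0) t (s', p')" using assms(2) by (auto simp: run_def)
  obtain t1 s1 p1 where 2: "exec \<omega> c (s, 0) t1 (s1, p1)" "t1 \<le> T" "Q s1 p1"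
    using assms(1) by (auto simp: completes_def)
  show ?thesis using exec_deterministic[OF 1 2(1)] 2 that by auto
qed

lemma runs_within_completes:
  assumes "\<And>\<omega>. completes \<omega> c s 0 T (Q \<omega>)" "real T \<le> b"
  shows "runs_within c s b"
  unfolding runs_within_def
proof
  fix \<omega>
  obtain t s' p where "run \<omega> c s t s'" "t \<le> T"
    using completes_run[OF assms(1)] by metis
  then show "\<exists>t s'. run \<omega> c s t s' \<and> real t \<le> b"
    using assms(2) by (meson of_nat_mono order_trans)
qed

lemma with_prob_mono: "with_prob r R \<Longrightarrow> r' \<le> r \<Longrightarrow> (\<And>\<omega>. R \<omega> \<Longrightarrow> R' \<omega>) \<Longrightarrow> with_prob r' R'"
  unfolding with_prob_def by (meson order_trans)

text \<open>Initialization determines only the first \<open>m * 2 ^ Suc p\<close> cells of the array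
  \<open>g\<close>, and a sketch reads no others.\<close>

lemma good_sketch_cong:
  assumes "good_sketch p m \<epsilon> g" and eq: "\<And>i. i < m * 2 ^ Suc p \<Longrightarrow> g' i = g i"
  shows "good_sketch p m \<epsilon> g'"
proof -
  have "sketch_coord p g' v e = sketch_coord p g v e" if "e < m * 2 ^ Suc p" for v e
  proof -
    have "g' (e div 2 ^ Suc p * 2 ^ Suc p + l) = g (e div 2 ^ Suc p * 2 ^ Suc p + l)" if "l < 2 ^ Suc p" for l
      by (rule eq, rule mult_add_less) (use that \<open>e < m * 2 ^ Suc p\<close> less_mult_imp_div_less in auto)
    then show ?thesis
      unfolding sketch_coord_def by (intro butterfly_pow_cong) simp_all
  qed
  then show ?thesis
    using assms(1) unfolding good_sketch_def by (simp del: power_Suc)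
qed

text \<open>Minimality gives \<open>2 ^ k < exp y\<close> for the predecessor \<open>k\<close>, and
  \<open>ln 2 \<ge> 1 / 2\<close> turns this into \<open>k < 2 * y\<close>.\<close>

lemma clog2_le:
  assumes a: "0 < a" and y: "0 \<le> y" and b: "b \<le> a * exp y"
  shows "real (clog2 a b) \<le> 1 + 2 * y"
proof (cases "clog2 a b")
  case 0
  then show ?thesis using y by simp
next
  case (Suc k)
  then have "2 ^ k * a < b" using less_clog2[of k a b] by simp
  then have "(2::real) ^ k < exp y" using a b by (smt (verit) mult.commute mult_less_cancel_left_pos)
  then have "ln (2 ^ k) < y" by (metis ln_exp ln_less_cancel_iff exp_gt_zero zero_less_power zero_less_numeral)
  then have "real k * ln 2 < y" by (simp add: ln_realpow)
  moreover have "real k * (1 / 2) \<le> real k * ln 2"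
    using ln2_ge_two_thirds by (intro mult_left_mono) auto
  ultimately show ?thesis using Suc by simp
qed

definition estimator :: data_structure where
  "estimator = \<lparr>init_prog = init_program, query_prog = query_program, add_prog = add_program\<rparr>"

context parameters
begin

lemma dim_le: "d \<le> 2 ^ Suc P"
proof -
  have "real d \<le> real (2 ^ Suc P)" using clog2[of 2 "real d"] by (simp add: P_def mult.commute)
  then show ?thesis by (simp only: of_nat_le_iff)
qed

lemma E_ge: "16384 / \<epsilon>\<^sup>2 \<le> real E"
  unfolding E_def by linarith

lemma E_pos: "0 < E"
proof -
  have "0 < 16384 / \<epsilon>\<^sup>2" using eps by simp
  then show ?thesis using E_ge by (metis le_less_trans of_nat_0_less_iff less_le_trans)
qed

lemma m_pos: "0 < m"
  using E_pos by (simp add: m_def)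

lemma init_good:
  "with_prob (1 - \<delta>) (\<lambda>\<omega>. good_sketch P m \<epsilon> (\<lambda>i. clip (8 / \<epsilon>) (fst (\<omega> i))))"
proof (rule with_prob_mono[OF good_sketch_event[of \<epsilon> P \<Lambda> E m q]])
  show "64 * 2 ^ Suc P / \<epsilon> \<le> 2 ^ \<Lambda>"
    using clog2[OF eps(1), of "64 * real (2 ^ Suc P)"] eps by (simp add: \<Lambda>_def pos_divide_le_eq)
  have "1 \<le> 2 ^ q * \<delta>" using clog2[OF delta(1), of 1] by (simp add: q_def)
  then show "1 - \<delta> \<le> 1 - (1 / 2) ^ q" by (simp add: power_divide divide_simps algebra_simps)
qed (use eps E_ge in \<open>auto simp: m_def\<close>)

text \<open>Neither operation changes \<open>g\<close>, so the layout holds with one and the same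
  \<open>g\<close> after every history, and a good \<open>g\<close> stays good whatever the
  adversary does.\<close>

lemma stored_reachable:
  assumes "reachable estimator d s0 X s Y" "stored d \<epsilon> \<delta> P m E g X s0" "X \<noteq> []" "\<And>x. x \<in> set X \<Longrightarrow> length x = d"
  shows "stored d \<epsilon> \<delta> P m E g Y s \<and> Y \<noteq> [] \<and> (\<forall>y\<in>set Y. length y = d)"
  using assms(1)
proof induction
  case start
  then show ?case using assms by auto
next
  case (query s Y qu \<omega> t s')
  have "run \<omega> query_program (feed qu s) t s'" using query by (simp add: estimator_def)
  then show ?case
    using run_completes[OF completes_query[OF _ query(2) m_pos delta(1)]] query.IH by metis
next
  case (add s Y x \<omega> t s')
  have "run \<omega> add_program (feed x s) t s'" using add by (simp add: estimator_def)
  moreover have "stored d \<epsilon> \<delta> P m E g Y s" using add.IH by blast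
  ultimately have "stored d \<epsilon> \<delta> P m E g (Y @ [x]) s'"
    using run_completes[OF completes_add[OF _ add(2)]] by metis
  then show ?case using add by auto
qed

lemma query_answered:
  assumes st: "stored d \<epsilon> \<delta> P m E g Y s" and good: "good_sketch P m \<epsilon> g" and Y: "Y \<noteq> []" "\<forall>y\<in>set Y. length y = d"
    and len: "length x = d"
  shows "answers_query estimator \<epsilon> \<delta> s Y x"
proof -
  define n where "n = length Y"
  define L where "L = clog2 \<delta> (2 * (real n * real (2 ^ Suc P)))"
  define K where "K = L * E"
  let ?v = "\<lambda>i l. as_array (Y ! i) l - as_array x l"
  have n: "1 \<le> real n" using Y by (simp add: n_def Suc_le_eq)
  have big: "1 \<le> real n * real (2 ^ Suc P)"
  proof -
    have "1 \<le> real (2 ^ Suc P)" using one_le_power[of "2::real" "Suc P"] by simp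
    then show ?thesis using mult_mono[OF n, of 1 "real (2 ^ Suc P)"] by simp
  qed
  have L: "2 * (real n * real (2 ^ Suc P)) \<le> 2 ^ L * \<delta>"
    unfolding L_def by (rule clog2[OF delta(1)])
  \<comment> \<open>At least one sample is needed, since the estimate divides by \<open>K\<close>;
    \<open>L = 0\<close> would mean \<open>2 * n * D \<le> \<delta>\<close>.\<close>
  have "0 < L"
  proof (rule ccontr)
    assume "\<not> 0 < L"
    then show False using L big delta by simp
  qed
  then have K: "0 < K" using E_pos by (simp add: K_def)
  \<comment> \<open>As \<open>E * \<epsilon>^2 \<ge> 1024\<close>, the \<open>K = L * E\<close>
    samples make each event fail with probability at most \<open>2 ^ - L\<close>. The
    \<open>P + 3\<close> events per point are at most \<open>2 * 2 ^ Suc P\<close>, a factor that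
    the choice of \<open>L\<close> already contains.\<close>
  have fail: "real n * (real (P + 3) * exp (- real K * (\<epsilon>\<^sup>2 / 1024))) \<le> \<delta>"
  proof -
    have "1024 \<le> real E * \<epsilon>\<^sup>2"
    proof -
      have "16384 \<le> real E * \<epsilon>\<^sup>2" using E_ge eps by (simp add: pos_divide_le_eq)
      then show ?thesis by simp
    qed
    then have "1 \<le> real E * (\<epsilon>\<^sup>2 / 1024)" by simp
    then have "real L * 1 \<le> real L * (real E * (\<epsilon>\<^sup>2 / 1024))" by (intro mult_left_mono) auto
    then have "real L \<le> real K * (\<epsilon>\<^sup>2 / 1024)" by (simp add: K_def mult.assoc)
    then have "exp (- (real K * (\<epsilon>\<^sup>2 / 1024))) \<le> (1 / 2) ^ L" by (rule exp_minus_le_half_power)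
    then have "real n * (real (P + 3) * exp (- real K * (\<epsilon>\<^sup>2 / 1024))) \<le> real n * (real (2 * 2 ^ Suc P) * (1 / 2) ^ L)"
    proof (intro mult_left_mono mult_mono)
      have "P < 2 ^ P" by simp
      then have "P + 3 \<le> 4 * 2 ^ P" by linarith
      then have "P + 3 \<le> 2 * 2 ^ Suc P" by simp
      then show "real (P + 3) \<le> real (2 * 2 ^ Suc P)" by (simp only: of_nat_le_iff)
    qed auto
    also have "\<dots> = 2 * (real n * real (2 ^ Suc P)) / 2 ^ L" by (simp add: power_divide)
    also have "\<dots> \<le> \<delta>" using L by (simp add: pos_divide_le_eq mult.commute)
    finally show ?thesis .
  qed
  \<comment> \<open>Both points are padded with zeros up to \<open>2 ^ Suc P\<close>, which is at
    least \<open>d\<close>; the norm of the difference does not change.\<close>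
  have dist: "L2_set (?v i) {..<2 ^ Suc P} = eucl_dist x (Y ! i)" if "i < n" for i
  proof -
    have l: "length (Y ! i) = d" using Y(2) that by (simp add: n_def)
    have "(\<Sum>l<2 ^ Suc P. (?v i l)\<^sup>2) = (\<Sum>l<d. (x ! l - Y ! i ! l)\<^sup>2)"
      by (rule sum.mono_neutral_cong_right)
         (use dim_le len l in \<open>auto simp: as_array_def power2_eq_square algebra_simps simp del: power_Suc\<close>)
    then show ?thesis unfolding eucl_dist_def L2_set_def len by simp
  qed
  show ?thesis
    unfolding answers_query_def
  proof (rule with_prob_mono[OF good_sketch_query[OF good eps m_pos K fail, of ?v]])
    fix \<omega> :: tape
    assume ok: "\<forall>i<n. let r = sqrt (pi / 2) * robust_sum \<epsilon> K (\<lambda>t. \<bar>sketch_coord P g (?v i) (index_of (m * 2 ^ Suc P) (snd (\<omega> t)))\<bar>) (Suc P) / real K;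
        N = L2_set (?v i) {..<2 ^ Suc P} in (1 - \<epsilon>) * N \<le> r \<and> r \<le> (1 + \<epsilon>) * N"
    obtain t s' where run: "run \<omega> query_program (feed x s) t s'"
      and out: "\<forall>u<length Y. reals s' ''out'' u = sqrt (pi / 2) *
        robust_sum \<epsilon> K (\<lambda>t. \<bar>sketch_coord P g (?v u) (index_of (m * 2 ^ Suc P) (snd (\<omega> t)))\<bar>) (Suc P) / real K"
      by (rule completes_run[OF completes_query[OF st len m_pos delta(1), of \<omega>,
            folded n_def, folded L_def, folded K_def]]) (use n_def in blast)
    have "correct_estimates \<epsilon> Y x (reals s' ''out'')"
      unfolding correct_estimates_def
    proof (intro allI impI)
      fix i assume i: "i < length Y"
      then have i': "i < n" by (simp only: n_def)
      show "(1 - \<epsilon>) * eucl_dist x (Y ! i) \<le> reals s' ''out'' i \<and> reals s' ''out'' i \<le> (1 + \<epsilon>) * eucl_dist x (Y ! i)"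
        using ok[unfolded Let_def, rule_format, OF i'] unfolding dist[OF i'] out[rule_format, OF i] .
    qed
    then show "\<exists>t s'. run \<omega> (query_prog estimator) (feed x s) t s' \<and> correct_estimates \<epsilon> Y x (reals s' ''out'')"
      using run by (auto simp: estimator_def)
  qed simp
qed

section \<open>Running times in terms of \<open>n\<close>, \<open>d\<close>,
  \<open>\<epsilon>\<close> and \<open>\<delta>\<close>\<close>

definition logs :: "nat \<Rightarrow> real" where
  "logs n = 1 + ln (real n) + ln (real d) + ln (1 / \<epsilon>)"

definition F :: real where
  "F = (1 / \<epsilon>)\<^sup>2 * ln (1 / \<delta>)"

text \<open>Being bounded away from 0, \<open>ln (1 / \<delta>)\<close> can absorb additive
  constants; this uses \<open>\<delta> < 1 / 2\<close>.\<close>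

lemma ln_delta: "2 / 3 \<le> ln (1 / \<delta>)"
proof -
  have "ln 2 \<le> ln (1 / \<delta>)" using delta by (subst ln_le_cancel_iff) (auto simp: field_simps)
  then show ?thesis using ln2_ge_two_thirds by linarith
qed

lemma logs_ge:
  assumes "1 \<le> n"
  shows "1 + ln (real n) + ln (real d) \<le> logs n" "1 + ln (real d) + ln (1 / \<epsilon>) \<le> logs n" "1 + ln (real d) \<le> logs n" "1 \<le> logs n"
proof -
  have "0 \<le> ln (real n)" "0 \<le> ln (real d)" "0 \<le> ln (1 / \<epsilon>)"
    using assms d eps by (auto intro!: ln_ge_zero)
  then show "1 + ln (real n) + ln (real d) \<le> logs n" "1 + ln (real d) + ln (1 / \<epsilon>) \<le> logs n" "1 + ln (real d) \<le> logs n" "1 \<le> logs n"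
    by (auto simp: logs_def)
qed

lemma P_le: "1 \<le> n \<Longrightarrow> real P \<le> 2 * logs n"
proof -
  assume n: "1 \<le> n"
  have "real P \<le> 1 + 2 * ln (real d)"
    unfolding P_def by (rule clog2_le) (use d in auto)
  then show ?thesis using logs_ge[OF n] by linarith
qed

lemma pow_P_le: "real (2 ^ Suc P) \<le> 4 * real d"
proof (cases P)
  case (Suc k)
  then have "2 ^ k * 2 < real d" using less_clog2[of k 2 "real d"] by (simp add: P_def)
  moreover have "real (2 ^ Suc P) = 4 * 2 ^ k" by (simp add: Suc)
  ultimately show ?thesis by linarith
qed (use d in simp)

lemma \<Lambda>_le: "1 \<le> n \<Longrightarrow> real \<Lambda> + 1 \<le> 18 * logs n"
proof -
  assume n: "1 \<le> n"
  let ?y = "8 + ln (real d) + ln (1 / \<epsilon>)"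
  have y: "0 \<le> ?y" using d eps by (auto intro!: add_nonneg_nonneg ln_ge_zero)
  have "real \<Lambda> \<le> 1 + 2 * ?y"
    unfolding \<Lambda>_def
  proof (rule clog2_le[OF eps(1) y])
    \<comment> \<open>The 64 in the definition of \<open>\<Lambda>\<close> and the 4 of
      \<open>pow_P_le\<close> multiply to 256, at most \<open>exp 8\<close>; hence the summand 8 in
      \<open>?y\<close>.\<close>
    have "(256::real) = 2 ^ 8" by simp
    also have "\<dots> \<le> exp 1 ^ 8" using exp_ge_add_one_self[of 1] by (intro power_mono) auto
    also have "\<dots> = exp 8" by (simp add: exp_of_nat_mult[symmetric])
    finally have "256 \<le> exp (8::real)" .
    then have "256 * real d \<le> exp 8 * real d" by (intro mult_right_mono) auto
    also have "\<dots> = \<epsilon> * exp ?y" using d eps by (simp add: exp_add)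
    finally show "64 * real (2 ^ Suc P) \<le> \<epsilon> * exp ?y" using pow_P_le by linarith
  qed
  moreover have "l + 1 \<le> 18 * b" if "l \<le> 1 + 2 * (8 + x + y)" "1 + x + y \<le> b" "1 \<le> b" for l x y b :: real
    using that by argo
  ultimately show ?thesis using logs_ge(2,4)[OF n] by blast
qed

lemma q_le: "real q \<le> 4 * ln (1 / \<delta>)"
proof -
  have "real q \<le> 1 + 2 * ln (1 / \<delta>)"
    unfolding q_def by (rule clog2_le) (use delta ln_delta in auto)
  then show ?thesis using ln_delta by linarith
qed

lemma E_le: "real E \<le> 16385 * (1 / \<epsilon>)\<^sup>2"
proof -
  have "1 \<le> (1 / \<epsilon>)\<^sup>2" using eps by (simp add: power_divide)
     (simp add: power_le_one)
  moreover have "16384 / \<epsilon>\<^sup>2 = 16384 * (1 / \<epsilon>)\<^sup>2" by (simp add: power_divide)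
  moreover have "real E \<le> 16384 / \<epsilon>\<^sup>2 + 1"
  proof -
    have "0 \<le> 16384 / \<epsilon>\<^sup>2" by simp
    then show ?thesis unfolding E_def by linarith
  qed
  ultimately show ?thesis by linarith
qed

lemma F_ge: "1 \<le> F"
proof -
  have "(2::real)\<^sup>2 \<le> (1 / \<epsilon>)\<^sup>2" using eps by (intro power_mono) (auto simp: field_simps)
  then have "4 * (2 / 3) \<le> F" unfolding F_def using ln_delta by (intro mult_mono) auto
  then show ?thesis by simp
qed

text \<open>One logarithm for each of the factors \<open>\<Lambda> + 1\<close>,
  \<open>\<Lambda> + 1\<close> and \<open>\<Lambda> + q + 1\<close>. In the last one
  \<open>q\<close> is of order \<open>ln (1 / \<delta>)\<close>, and the sum becomes a product
  because both terms are bounded below. The constant is 16385 times 18 squared times 31.\<close>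

lemma m_le:
  assumes n: "1 \<le> n"
  shows "real m \<le> 164570940 * (logs n ^ 3 * F)"
proof -
  let ?B = "logs n"
  let ?l = "ln (1 / \<delta>)"
  have B: "1 \<le> ?B" by (rule logs_ge[OF n])
  have "?B * 1 \<le> ?B * (3 / 2 * ?l)" using B ln_delta by (intro mult_left_mono) auto
  moreover have "1 * ?l \<le> ?B * ?l" using B ln_delta by (intro mult_right_mono) auto
  moreover have "real (\<Lambda> + q + 1) \<le> 18 * ?B + 4 * ?l" using \<Lambda>_le[OF n] q_le by simp
  ultimately have s: "real (\<Lambda> + q + 1) \<le> 31 * (?B * ?l)" by linarith
  have "real m = real E * (real \<Lambda> + 1)\<^sup>2 * real (\<Lambda> + q + 1)"
    by (simp add: m_def algebra_simps)
  also have "\<dots> \<le> (16385 * (1 / \<epsilon>)\<^sup>2) * (18 * ?B)\<^sup>2 * (31 * (?B * ?l))"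
    using E_le s \<Lambda>_le[OF n] by (intro mult_mono power_mono) auto
  also have "\<dots> = 164570940 * (?B ^ 3 * F)"
    by (simp add: F_def power_mult_distrib power2_eq_square power3_eq_cube)
  finally show ?thesis .
qed

text \<open>The fourth logarithm, and with it the exponent of \<open>polylog\<close>, comes from the
  rounds of the transform.\<close>

lemma sketch_time_le:
  assumes n: "1 \<le> n"
  shows "real (sketch_time P m) \<le> 3 * 10 ^ 11 * (real d * (logs n ^ 4 * F))"
proof -
  let ?B = "logs n"
  have B: "1 \<le> ?B" by (rule logs_ge[OF n])
  have dB: "1 \<le> real d * ?B" using mult_mono[of 1 "real d" 1 ?B] B d by simp
  have BF: "1 \<le> ?B ^ 4 * F" using mult_mono[of 1 "?B ^ 4" 1 F] B F_ge by (simp add: one_le_power)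
  have dBF: "1 \<le> real d * (?B ^ 4 * F)" using mult_mono[of 1 "real d" 1 "?B ^ 4 * F"] BF d by simp
  have "real (2 ^ Suc P * (Suc P * 105 + 68) + 67) \<le> 1599 * (real d * ?B)"
  proof -
    have "real (Suc P * 105 + 68) \<le> 383 * ?B" using P_le[OF n] B by simp
    then have "real (2 ^ Suc P) * real (Suc P * 105 + 68) \<le> (4 * real d) * (383 * ?B)"
      using pow_P_le by (intro mult_mono) auto
    then have "real (2 ^ Suc P) * real (Suc P * 105 + 68) \<le> 1532 * (real d * ?B)" by simp
    then show ?thesis using dB unfolding of_nat_add of_nat_mult by linarith
  qed
  then have "real m * real (2 ^ Suc P * (Suc P * 105 + 68) + 67) \<le> (164570940 * (?B ^ 3 * F)) * (1599 * (real d * ?B))"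
    using m_le[OF n] B F_ge by (intro mult_mono) auto
  also have "\<dots> = 263148933060 * (real d * (?B ^ 4 * F))"
    by (simp add: eval_nat_numeral)
  finally have "real m * real (2 ^ Suc P * (Suc P * 105 + 68) + 67) \<le> 263148933060 * (real d * (?B ^ 4 * F))" .
  then show ?thesis
    using dBF unfolding sketch_time_def of_nat_add of_nat_mult by simp
qed

lemma add_time:
  assumes n: "1 \<le> n"
  shows "real (sketch_time P m + 20) \<le> 10 ^ 12 * (1 / \<epsilon>)\<^sup>2 * real d * ln (1 / \<delta>) * polylog 4 n d \<epsilon>"
proof -
  have BF: "1 \<le> logs n ^ 4 * F" using mult_mono[of 1 "logs n ^ 4" 1 F] logs_ge(4)[OF n] F_ge by (simp add: one_le_power)
  have dBF: "1 \<le> real d * (logs n ^ 4 * F)" using mult_mono[of 1 "real d" 1 "logs n ^ 4 * F"] BF d by simp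
  have "real (sketch_time P m + 20) \<le> 10 ^ 12 * (real d * (logs n ^ 4 * F))"
    using sketch_time_le[OF n] dBF by simp
  then show ?thesis by (simp add: F_def polylog_def logs_def mult.assoc mult.left_commute mult.commute)
qed

text \<open>The term with \<open>d\<close> is the sketch of the query. The term with
  \<open>n\<close> consists of \<open>P + 2\<close> passes over the \<open>L * E\<close> samples for
  every point, which costs two logarithms only.\<close>

lemma query_time:
  assumes n: "1 \<le> n"
  defines "L \<equiv> clog2 \<delta> (2 * (real n * real (2 ^ Suc P)))"
  shows "real (sketch_time P m + L * 100 + L * E * 25 + n * ((P + 2) * (L * E * 75 + 55) + 40) + 200)
    \<le> 10 ^ 12 * (1 / \<epsilon>)\<^sup>2 * (real n + real d) * ln (1 / \<delta>) * polylog 4 n d \<epsilon>"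
proof -
  let ?B = "logs n"
  let ?l = "ln (1 / \<delta>)"
  define W where "W = ?B ^ 4 * F"
  have B: "1 \<le> ?B" by (rule logs_ge[OF n])
  have W: "1 \<le> W" unfolding W_def using mult_mono[of 1 "?B ^ 4" 1 F] B F_ge by (simp add: one_le_power)
  have Bl: "?B * 1 \<le> ?B * (3 / 2 * ?l)" "1 * ?l \<le> ?B * ?l"
    using B ln_delta by (auto intro!: mult_left_mono mult_right_mono)
  have L: "real L \<le> 13 * (?B * ?l)"
  proof -
    let ?y = "3 + ln (real n) + ln (real d) + ?l"
    have "real L \<le> 1 + 2 * ?y"
      unfolding L_def
    proof (rule clog2_le[OF delta(1)])
      show "0 \<le> ?y" using n d ln_delta by (auto intro!: add_nonneg_nonneg ln_ge_zero)
      have "(8::real) = 2 ^ 3" by simp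
      also have "\<dots> \<le> exp 1 ^ 3" using exp_ge_add_one_self[of 1] by (intro power_mono) auto
      also have "\<dots> = exp 3" by (simp add: exp_of_nat_mult[symmetric])
      finally have e8: "8 \<le> exp (3::real)" .
      have "2 * (real n * real (2 ^ Suc P)) \<le> 8 * (real n * real d)"
        using mult_left_mono[OF pow_P_le, of "real n"] by simp
      also have "\<dots> \<le> exp 3 * (real n * real d)" using e8 by (intro mult_right_mono) auto
      also have "\<dots> = \<delta> * exp ?y" using n d delta by (simp add: exp_add)
      finally show "2 * (real n * real (2 ^ Suc P)) \<le> \<delta> * exp ?y" .
    qed
    moreover have "l \<le> 13 * p" if "l \<le> 1 + 2 * (3 + x + y + e)" "1 + x + y \<le> b" "b * 1 \<le> p * (3 / 2)" "1 * e \<le> p" "1 \<le> b" for l x y e b p :: real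
      using that by argo
    moreover have "?B * (3 / 2 * ?l) = ?B * ?l * (3 / 2)" by simp
    ultimately show ?thesis using logs_ge(1)[OF n] Bl B by metis
  qed
  have LE: "real (L * E) \<le> 213005 * (?B * F)"
  proof -
    have "real L * real E \<le> (13 * (?B * ?l)) * (16385 * (1 / \<epsilon>)\<^sup>2)"
      using L E_le B ln_delta by (intro mult_mono) auto
    also have "\<dots> = 213005 * (?B * F)" by (simp add: F_def algebra_simps)
    finally show ?thesis by simp
  qed
  have BF: "1 \<le> ?B * F" using mult_mono[of 1 ?B 1 F] B F_ge by simp
  have B14: "?B \<le> ?B ^ 4" "?B\<^sup>2 \<le> ?B ^ 4"
    using power_increasing[of 1 4 ?B] power_increasing[of 2 4 ?B] B by auto
  have BW: "?B * F \<le> W" "?B\<^sup>2 * F \<le> W"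
    unfolding W_def using B14 F_ge by (auto intro: mult_right_mono)
  have "L * 1 \<le> L * E" using E_pos by (intro mult_left_mono) auto
  then have Lle: "real L \<le> real (L * E)" by (simp only: of_nat_le_iff mult_1_right)
  have 1: "real (L * 100 + L * E * 25 + 200) \<le> 10 ^ 8 * W"
    using Lle LE BW W by simp
  have 2: "real (n * ((P + 2) * (L * E * 75 + 55) + 40)) \<le> real n * (10 ^ 8 * W)"
  proof -
    have "real (P + 2) * real (L * E * 75 + 55) \<le> (4 * ?B) * (15975430 * (?B * F))"
      using P_le[OF n] LE BF B F_ge by (intro mult_mono) auto
    also have "\<dots> = 63901720 * (?B\<^sup>2 * F)" by (simp add: power2_eq_square)
    finally have "real ((P + 2) * (L * E * 75 + 55) + 40) \<le> 10 ^ 8 * W"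
      using BW W unfolding of_nat_add[of _ 40] of_nat_mult[of "P + 2"] by simp
    then show ?thesis unfolding of_nat_mult[of n] by (intro mult_left_mono) auto
  qed
  have dW: "1 * W \<le> real d * W" using d W by (intro mult_right_mono) auto
  have "real (sketch_time P m + L * 100 + L * E * 25 + n * ((P + 2) * (L * E * 75 + 55) + 40) + 200) =
    real (sketch_time P m) + real (L * 100 + L * E * 25 + 200) + real (n * ((P + 2) * (L * E * 75 + 55) + 40))"
    by simp
  also have "\<dots> \<le> 3 * 10 ^ 11 * (real d * W) + 10 ^ 8 * W + real n * (10 ^ 8 * W)"
    using sketch_time_le[OF n] 1 2 unfolding W_def by linarith
  also have "\<dots> \<le> 10 ^ 12 * (real d * W) + 10 ^ 12 * (real n * W)"
  proof -
    have "3 * 10 ^ 11 * a + 10 ^ 8 * v + 10 ^ 8 * b \<le> 10 ^ 12 * a + 10 ^ 12 * b"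
      if "1 * v \<le> a" "1 \<le> v" "0 \<le> b" for a b v :: real
      using that by simp
    from this[OF dW W, of "real n * W"] show ?thesis using W by (simp only: mult.left_commute) simp
  qed
  also have "\<dots> = 10 ^ 12 * (1 / \<epsilon>)\<^sup>2 * (real n + real d) * ln (1 / \<delta>) * polylog 4 n d \<epsilon>"
    by (simp add: W_def F_def polylog_def logs_def algebra_simps)
  finally show ?thesis .
qed

lemma init_time:
  assumes n: "1 \<le> n"
  shows "real ((P * 40 + 30) + ((E * 30 + 30) + ((\<Lambda> * 200 + q * 200 + 2 ^ Suc P * 25 + 500) + ((m * 2 ^ Suc P * 75 + 30) +
      (n * ((sketch_time P m + 20) + 15) + 15)))))
    \<le> 10 ^ 12 * (1 / \<epsilon>)\<^sup>2 * (real n * real d) * ln (1 / \<delta>) * polylog 4 n d \<epsilon>"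
proof -
  let ?B = "logs n"
  define W where "W = real d * (?B ^ 4 * F)"
  have B: "1 \<le> ?B" by (rule logs_ge[OF n])
  have BF: "1 \<le> ?B ^ 4 * F" using mult_mono[of 1 "?B ^ 4" 1 F] B F_ge by (simp add: one_le_power)
  have W: "1 \<le> W" unfolding W_def using mult_mono[of 1 "real d" 1 "?B ^ 4 * F"] BF d by simp
  have dW: "real d \<le> W"
    unfolding W_def using mult_left_mono[OF BF, of "real d"] by simp
  have F_W: "F \<le> W"
  proof -
    have "1 * F \<le> ?B ^ 4 * F" using B F_ge by (intro mult_right_mono) (auto simp: one_le_power)
    also have "\<dots> \<le> W" unfolding W_def using mult_right_mono[of 1 "real d" "?B ^ 4 * F"] BF d by simp
    finally show ?thesis by simp
  qed
  have BW: "?B \<le> W"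
  proof -
    have "?B * 1 \<le> ?B ^ 4 * F" using B F_ge power_increasing[of 1 4 ?B] by (intro mult_mono) auto
    also have "\<dots> \<le> W" unfolding W_def using mult_right_mono[of 1 "real d" "?B ^ 4 * F"] BF d by simp
    finally show ?thesis by simp
  qed
  have inv: "1 \<le> (1 / \<epsilon>)\<^sup>2" using eps by (simp add: power_divide) (simp add: power_le_one)
  have E: "real E \<le> 24578 * W"
  proof -
    have "(1 / \<epsilon>)\<^sup>2 * (2 / 3) \<le> F" unfolding F_def using ln_delta by (intro mult_left_mono) auto
    then show ?thesis using E_le F_W by linarith
  qed
  have q: "real q \<le> 4 * W"
  proof -
    have "1 * ln (1 / \<delta>) \<le> F" unfolding F_def using ln_delta inv by (intro mult_right_mono) auto
    then show ?thesis using q_le F_W by linarith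
  qed
  have mD: "real (m * 2 ^ Suc P) \<le> 658283760 * W"
  proof -
    have "real m * real (2 ^ Suc P) \<le> (164570940 * (?B ^ 3 * F)) * (4 * real d)"
      using m_le[OF n] pow_P_le B F_ge by (intro mult_mono) auto
    also have "\<dots> = 658283760 * (real d * (?B ^ 3 * F))" by simp
    also have "\<dots> \<le> 658283760 * W"
      unfolding W_def using B F_ge power_increasing[of 3 4 ?B] by (intro mult_left_mono mult_right_mono) auto
    finally show ?thesis by simp
  qed
  have 1: "real ((P * 40 + 30) + (E * 30 + 30) + (\<Lambda> * 200 + q * 200 + 2 ^ Suc P * 25 + 500) + (m * 2 ^ Suc P * 75 + 30) + 15) \<le> 10 ^ 11 * W"
    using P_le[OF n] \<Lambda>_le[OF n] pow_P_le E q mD BW dW W by simp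
  have 2: "real (n * ((sketch_time P m + 20) + 15)) \<le> 400000000000 * (real n * W)"
  proof -
    have "real ((sketch_time P m + 20) + 15) \<le> 400000000000 * W"
      using sketch_time_le[OF n] W unfolding W_def[symmetric] by simp
    then have "real n * real ((sketch_time P m + 20) + 15) \<le> real n * (400000000000 * W)"
      by (intro mult_left_mono) auto
    also have "\<dots> = 400000000000 * (real n * W)" by simp
    finally show ?thesis by (simp only: of_nat_mult)
  qed
  \<comment> \<open>Because the database is not empty, the set-up cost, which is not multiplied by
    \<open>n\<close>, is absorbed as well.\<close>
  have nW: "1 * W \<le> real n * W" using n W by (intro mult_right_mono) auto
  have "real ((P * 40 + 30) + ((E * 30 + 30) + ((\<Lambda> * 200 + q * 200 + 2 ^ Suc P * 25 + 500) + ((m * 2 ^ Suc P * 75 + 30) +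
      (n * ((sketch_time P m + 20) + 15) + 15)))))
    = real ((P * 40 + 30) + (E * 30 + 30) + (\<Lambda> * 200 + q * 200 + 2 ^ Suc P * 25 + 500) + (m * 2 ^ Suc P * 75 + 30) + 15)
      + real (n * ((sketch_time P m + 20) + 15))"
    by simp
  also have "\<dots> \<le> 10 ^ 12 * (real n * W)"
  proof -
    have "x + y \<le> 10 ^ 12 * z" if "x \<le> 10 ^ 11 * v" "y \<le> 400000000000 * z" "1 * v \<le> z" "1 \<le> v" for x y z v :: real
      using that by simp
    from this[OF 1 2 nW W] show ?thesis .
  qed
  also have "\<dots> = 10 ^ 12 * (1 / \<epsilon>)\<^sup>2 * (real n * real d) * ln (1 / \<delta>) * polylog 4 n d \<epsilon>"
    by (simp add: W_def F_def polylog_def logs_def mult.assoc mult.left_commute mult.commute)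
  finally show ?thesis .
qed

text \<open>Accuracy needs a good \<open>g\<close>, but the time bounds only need the memory layout
  for some \<open>g\<close>; they therefore hold after every initialization, lucky or not.\<close>

lemma guarantees:
  assumes X: "X \<noteq> []" "\<forall>x\<in>set X. length x = d"
  shows "with_prob (1 - \<delta>) (\<lambda>\<omega>. \<exists>t s0. run \<omega> (init_prog estimator) (initial_mem d \<epsilon> \<delta> X) t s0 \<and>
            correctly_initialized estimator d \<epsilon> \<delta> s0 X)"
    and "runs_within (init_prog estimator) (initial_mem d \<epsilon> \<delta> X)
            (10 ^ 12 * (1/\<epsilon>)\<^sup>2 * (real (length X) * real d) * ln (1/\<delta>) * polylog 4 (length X) d \<epsilon>)"
    and "run (\<omega> :: tape) (init_prog estimator) (initial_mem d \<epsilon> \<delta> X) t s0 \<Longrightarrow> reachable estimator d s0 X s Y \<Longrightarrow> length x = d \<Longrightarrow>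
       runs_within (query_prog estimator) (feed x s)
          (10 ^ 12 * (1/\<epsilon>)\<^sup>2 * (real (length Y) + real d) * ln (1/\<delta>) * polylog 4 (length Y) d \<epsilon>)"
    and "run (\<omega> :: tape) (init_prog estimator) (initial_mem d \<epsilon> \<delta> X) t s0 \<Longrightarrow> reachable estimator d s0 X s Y \<Longrightarrow> length x = d \<Longrightarrow>
       runs_within (add_prog estimator) (feed x s)
          (10 ^ 12 * (1/\<epsilon>)\<^sup>2 * real d * ln (1/\<delta>) * polylog 4 (length Y) d \<epsilon>)"
proof -
  have lenX: "\<And>x. x \<in> set X \<Longrightarrow> length x = d" using X(2) by blast
  have len1: "1 \<le> length Y" if "Y \<noteq> []" for Y :: "point list" using that by (simp add: Suc_le_eq)
  note init = completes_init[OF lenX]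
  show "with_prob (1 - \<delta>) (\<lambda>\<omega>. \<exists>t s0. run \<omega> (init_prog estimator) (initial_mem d \<epsilon> \<delta> X) t s0 \<and>
            correctly_initialized estimator d \<epsilon> \<delta> s0 X)"
  proof (rule with_prob_mono[OF init_good])
    fix \<omega> :: tape assume good: "good_sketch P m \<epsilon> (\<lambda>i. clip (8 / \<epsilon>) (fst (\<omega> i)))"
    obtain t s0 g where run: "run \<omega> init_program (initial_mem d \<epsilon> \<delta> X) t s0" and st: "stored d \<epsilon> \<delta> P m E g X s0"
      and g: "\<forall>i<m * 2 ^ Suc P. g i = clip (8 / \<epsilon>) (fst (\<omega> i))"
      using completes_run[OF init[of X \<omega>]] by metis
    have "good_sketch P m \<epsilon> g" by (rule good_sketch_cong[OF good]) (use g in blast)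
    then have "correctly_initialized estimator d \<epsilon> \<delta> s0 X"
      unfolding correctly_initialized_def using stored_reachable[OF _ st X(1) lenX] query_answered by blast
    then show "\<exists>t s0. run \<omega> (init_prog estimator) (initial_mem d \<epsilon> \<delta> X) t s0 \<and> correctly_initialized estimator d \<epsilon> \<delta> s0 X"
      using run by (auto simp: estimator_def)
  qed simp
  show "runs_within (init_prog estimator) (initial_mem d \<epsilon> \<delta> X)
      (10 ^ 12 * (1/\<epsilon>)\<^sup>2 * (real (length X) * real d) * ln (1/\<delta>) * polylog 4 (length X) d \<epsilon>)"
    unfolding estimator_def data_structure.simps
    by (rule runs_within_completes[OF init init_time[OF len1[OF X(1)]]]) auto
  have stored: "\<exists>g. stored d \<epsilon> \<delta> P m E g Y s \<and> Y \<noteq> []"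
    if "run \<omega> (init_prog estimator) (initial_mem d \<epsilon> \<delta> X) t s0" "reachable estimator d s0 X s Y" for \<omega> t s0 s Y
  proof -
    have "run \<omega> init_program (initial_mem d \<epsilon> \<delta> X) t s0" using that(1) by (simp add: estimator_def)
    then obtain g where "stored d \<epsilon> \<delta> P m E g X s0"
      using run_completes[OF init[of X \<omega>]] by metis
    then show ?thesis using stored_reachable[OF that(2) _ X(1) lenX] by blast
  qed
  assume run: "run \<omega> (init_prog estimator) (initial_mem d \<epsilon> \<delta> X) t s0" and reach: "reachable estimator d s0 X s Y" and len: "length x = d"
  obtain g where g: "stored d \<epsilon> \<delta> P m E g Y s" "Y \<noteq> []" using stored[OF run reach] by blast
  show "runs_within (query_prog estimator) (feed x s)
      (10 ^ 12 * (1/\<epsilon>)\<^sup>2 * (real (length Y) + real d) * ln (1/\<delta>) * polylog 4 (length Y) d \<epsilon>)"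
    unfolding estimator_def data_structure.simps
    by (rule runs_within_completes[OF completes_query[OF g(1) len m_pos delta(1)] query_time[OF len1[OF g(2)]]])
  show "runs_within (add_prog estimator) (feed x s)
      (10 ^ 12 * (1/\<epsilon>)\<^sup>2 * real d * ln (1/\<delta>) * polylog 4 (length Y) d \<epsilon>)"
    unfolding estimator_def data_structure.simps
    by (rule runs_within_completes[OF completes_add[OF g(1) len] add_time[OF len1[OF g(2)]]])
qed

end

theorem theorem1p4:
  "\<exists>(D :: data_structure) (C :: real) (k :: nat).
     \<forall>(d :: nat) (\<epsilon> :: real) (\<delta> :: real) (X :: point list).
       d \<ge> 1 \<longrightarrow> 0 < \<epsilon> \<longrightarrow> \<epsilon> < 1/2 \<longrightarrow> 0 < \<delta> \<longrightarrow> \<delta> < 1/2 \<longrightarrow>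
       X \<noteq> [] \<longrightarrow> (\<forall>x\<in>set X. length x = d) \<longrightarrow>
         with_prob (1 - \<delta>) (\<lambda>\<omega>. \<exists>t s0. run \<omega> (init_prog D) (initial_mem d \<epsilon> \<delta> X) t s0 \<and>
            correctly_initialized D d \<epsilon> \<delta> s0 X)
       \<and> runs_within (init_prog D) (initial_mem d \<epsilon> \<delta> X)
            (C * (1/\<epsilon>)\<^sup>2 * (real (length X) * real d) * ln (1/\<delta>) * polylog k (length X) d \<epsilon>)
       \<and> (\<forall>\<omega> t s0 s Y. run \<omega> (init_prog D) (initial_mem d \<epsilon> \<delta> X) t s0 \<longrightarrow>
            reachable D d s0 X s Y \<longrightarrow>
              (\<forall>q. length q = d \<longrightarrow> runs_within (query_prog D) (feed q s)
                 (C * (1/\<epsilon>)\<^sup>2 * (real (length Y) + real d) * ln (1/\<delta>) * polylog k (length Y) d \<epsilon>))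
            \<and> (\<forall>x. length x = d \<longrightarrow> runs_within (add_prog D) (feed x s)
                 (C * (1/\<epsilon>)\<^sup>2 * real d * ln (1/\<delta>) * polylog k (length Y) d \<epsilon>)))"
proof (intro exI allI impI)
  fix d :: nat and \<epsilon> \<delta> :: real and X :: "point list"
  assume "d \<ge> 1" "0 < \<epsilon>" "\<epsilon> < 1/2" "0 < \<delta>" "\<delta> < 1/2" and X: "X \<noteq> []" "\<forall>x\<in>set X. length x = d"
  then interpret parameters d \<epsilon> \<delta> by unfold_locales
  \<comment> \<open>The witnesses are fixed here: \<open>estimator\<close>, the constant
    \<open>10 ^ 12\<close> and the exponent 4, none of them depending on the parameters.\<close>
  show "with_prob (1 - \<delta>) (\<lambda>\<omega>. \<exists>t s0. run \<omega> (init_prog estimator) (initial_mem d \<epsilon> \<delta> X) t s0 \<and>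
            correctly_initialized estimator d \<epsilon> \<delta> s0 X)
       \<and> runs_within (init_prog estimator) (initial_mem d \<epsilon> \<delta> X)
            (10 ^ 12 * (1/\<epsilon>)\<^sup>2 * (real (length X) * real d) * ln (1/\<delta>) * polylog 4 (length X) d \<epsilon>)
       \<and> (\<forall>\<omega> t s0 s Y. run \<omega> (init_prog estimator) (initial_mem d \<epsilon> \<delta> X) t s0 \<longrightarrow>
            reachable estimator d s0 X s Y \<longrightarrow>
              (\<forall>q. length q = d \<longrightarrow> runs_within (query_prog estimator) (feed q s)
                 (10 ^ 12 * (1/\<epsilon>)\<^sup>2 * (real (length Y) + real d) * ln (1/\<delta>) * polylog 4 (length Y) d \<epsilon>))
            \<and> (\<forall>x. length x = d \<longrightarrow> runs_within (add_prog estimator) (feed x s)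
                 (10 ^ 12 * (1/\<epsilon>)\<^sup>2 * real d * ln (1/\<delta>) * polylog 4 (length Y) d \<epsilon>)))"
    using guarantees[OF X] by blast
qed

end
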